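(* Let $d\ge1$ and let $m$ be a bounded function on the torus $\mathbb{T}^d$ (viewed as a function on $\mathbb{R}^d$ that is $1$-periodic in each coordinate). Assume that $m$ is of class $C^{d+1}$ on $\mathbb{R}^d\setminus\mathbb{Z}^d$ and that there is a constant $c>0$ such that $$|\partial_\xi^\alpha m(\xi)|\le c\,|\xi|^{-|\alpha|},\qquad \xi\in(-1/2,1/2)^d\setminus\{0\},$$ for all $\alpha=(\alpha_1,\dots,\alpha_d)\in\mathbb{N}^d$ with $|\alpha|=\alpha_1+\cdots+\alpha_d\le d+1$. Then $T_m$ extends to a bounded operator from $\ell^p(\mathbb{Z}^d)$ into itself for all $1<p<\infty$.
   Context: $\mathbb{T}^d=\mathbb{R}^d/\mathbb{Z}^d$ with Haar measure equal to Lebesgue measure on $[0,1)^d$; $\mathbb{N}$ contains $0$; $|\xi|$ is the Euclidean norm. $\ell^p(\mathbb{Z}^d)$ is the usual space of $p$-summable complex functions on $\mathbb{Z}^d$. Fourier transform: $\mathcal{F}_{\mathbb{Z}^d}(f)(\xi)=\sum_{n\in\mathbb{Z}^d}f(n)e^{2\pi i n\cdot\xi}$, an isometry of $\ell^2(\mathbb{Z}^d)$ onto $L^2(\mathbb{T}^d)$, with inverse $\mathcal{F}_{\mathbb{Z}^d}^{-1}(u)(n)=\int_{(0,1)^d}u(\xi)e^{-2\pi i\xi\cdot n}\,d\xi$. For a bounded measurable $m$ on $\mathbb{T}^d$, the multiplier operator $T_m$ is defined on $\ell^2(\mathbb{Z}^d)$ by $\mathcal{F}_{\mathbb{Z}^d}(T_m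 f)=m\,\mathcal{F}_{\mathbb{Z}^d}(f)$. "Extends to a bounded operator on $\ell^p$" means that there is a constant $C$ with $\|T_mf\|_{\ell^p}\le C\|f\|_{\ell^p}$ for all $f\in\ell^2\cap\ell^p$. *)

theory Defs
  imports "HOL-Analysis.Analysis"
begin

text \<open>
  Throughout, the dimension is \<open>d = CARD('n)\<close>, \<open>\<real>\<^sup>d\<close> is \<^typ>\<open>real ^ 'n\<close> and
  \<open>\<int>\<^sup>d\<close> is \<^typ>\<open>int ^ 'n\<close>. Functions on the torus are coordinatewise 1-periodic functions on
  \<^typ>\<open>real ^ 'n\<close>, integrated over the open unit cube \<^term>\<open>box 0 (1 :: real ^ 'n)\<close>.
\<close>

definition of_int_vec :: "int ^ 'n::finite \<Rightarrow> real ^ 'n" where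
  "of_int_vec k = (\<chi> i. real_of_int (k $ i))"

definition periodic1 :: "(real ^ 'n::finite \<Rightarrow> 'b) \<Rightarrow> bool" where
  "periodic1 m \<longleftrightarrow> (\<forall>\<xi> i. m (\<xi> + axis i 1) = m \<xi>)"

subsection \<open>Partial derivatives and functions of class \<open>C\<^sup>k\<close>\<close>

definition coord_deriv ::
  "'n::finite \<Rightarrow> (real ^ 'n \<Rightarrow> complex) \<Rightarrow> real ^ 'n \<Rightarrow> complex" where
  "coord_deriv i f x = vector_derivative (\<lambda>t. f (x + t *\<^sub>R axis i 1)) (at 0)"

definition coord_differentiable ::
  "'n::finite \<Rightarrow> (real ^ 'n \<Rightarrow> complex) \<Rightarrow> real ^ 'n \<Rightarrow> bool" where
  "coord_differentiable i f x \<longleftrightarrow> (\<lambda>t. f (x + t *\<^sub>R axis i 1)) differentiable (at 0)"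

text \<open>Intended for open \<open>S\<close>: every iterated partial derivative of order at most \<open>k\<close>, in every
  order of differentiation, exists and is continuous on \<open>S\<close>. Continuity of the derivatives of order
  below \<open>k\<close> need not be demanded separately, since a function whose first partial derivatives exist
  and are continuous on an open set is continuous there.\<close>

primrec class_C :: "nat \<Rightarrow> (real ^ 'n::finite) set \<Rightarrow> (real ^ 'n \<Rightarrow> complex) \<Rightarrow> bool" where
  "class_C 0 S f \<longleftrightarrow> continuous_on S f"
| "class_C (Suc k) S f \<longleftrightarrow>
     (\<forall>i. (\<forall>x\<in>S. coord_differentiable i f x) \<and> class_C k S (coord_deriv i f))"

text \<open>The coordinates are differentiated in one fixed order, chosen arbitrarily; for functions of
  class \<open>C\<^sup>k\<close> on an open set and multi-indices of order at most \<open>k\<close> the result does not depend on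
  it.\<close>

definition coord_list :: "'n::finite list" where
  "coord_list = (SOME is. distinct is \<and> set is = UNIV)"

definition multi_deriv ::
  "nat ^ 'n::finite \<Rightarrow> (real ^ 'n \<Rightarrow> complex) \<Rightarrow> real ^ 'n \<Rightarrow> complex" where
  "multi_deriv \<alpha> f = foldr (\<lambda>i. coord_deriv i ^^ (\<alpha> $ i)) coord_list f"

definition multi_order :: "nat ^ 'n::finite \<Rightarrow> nat" where
  "multi_order \<alpha> = (\<Sum>i\<in>UNIV. \<alpha> $ i)"

subsection \<open>The spaces \<open>\<ell>\<^sup>p(\<int>\<^sup>d)\<close>\<close>

definition lp :: "real \<Rightarrow> (int ^ 'n::finite \<Rightarrow> complex) set" where
  "lp p = {f. (\<lambda>n. norm (f n) powr p) summable_on UNIV}"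

definition lp_norm :: "real \<Rightarrow> (int ^ 'n::finite \<Rightarrow> complex) \<Rightarrow> real" where
  "lp_norm p f = (\<Sum>\<^sub>\<infinity>n. norm (f n) powr p) powr (1 / p)"

subsection \<open>Fourier transform and multiplier operators\<close>

definition L2_torus :: "(real ^ 'n::finite \<Rightarrow> complex) set" where
  "L2_torus = {u. u \<in> borel_measurable (lebesgue_on (box 0 1)) \<and>
                  integrable (lebesgue_on (box 0 1)) (\<lambda>\<xi>. (norm (u \<xi>))\<^sup>2)}"

text \<open>For general \<open>f \<in> \<ell>\<^sup>2\<close> the Fourier series converges only in the sense of \<open>L\<^sup>2\<close>;
  the limit is unique up to null sets.\<close>

definition is_fourier :: "(int ^ 'n::finite \<Rightarrow> complex) \<Rightarrow> (real ^ 'n \<Rightarrow> complex) \<Rightarrow> bool" where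
  "is_fourier f u \<longleftrightarrow> u \<in> L2_torus \<and>
     ((\<lambda>A. \<integral>\<xi>. (norm (u \<xi> - (\<Sum>n\<in>A. f n * cis (2 * pi * (of_int_vec n \<bullet> \<xi>)))))\<^sup>2
              \<partial>lebesgue_on (box 0 1)) \<longlongrightarrow> 0) (finite_subsets_at_top UNIV)"

definition fourier :: "(int ^ 'n::finite \<Rightarrow> complex) \<Rightarrow> real ^ 'n \<Rightarrow> complex" where
  "fourier f = (SOME u. is_fourier f u)"

definition inv_fourier :: "(real ^ 'n::finite \<Rightarrow> complex) \<Rightarrow> int ^ 'n \<Rightarrow> complex" where
  "inv_fourier u n =
     (\<integral>\<xi>. u \<xi> * cis (- 2 * pi * (\<xi> \<bullet> of_int_vec n)) \<partial>lebesgue_on (box 0 1))"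

text \<open>On \<open>\<ell>\<^sup>2\<close> this solves the defining equation \<open>\<F>(T\<^sub>m f) = m \<F>(f)\<close>,
  since \<^const>\<open>inv_fourier\<close> inverts the isometry \<^const>\<open>fourier\<close> from \<open>\<ell>\<^sup>2(\<int>\<^sup>d)\<close>
  onto \<open>L\<^sup>2\<close> of the torus. The choice of the representative \<^term>\<open>fourier f\<close> is
  immaterial.\<close>

definition multiplier_op ::
  "(real ^ 'n::finite \<Rightarrow> complex) \<Rightarrow> (int ^ 'n \<Rightarrow> complex) \<Rightarrow> int ^ 'n \<Rightarrow> complex" where
  "multiplier_op m f = inv_fourier (\<lambda>\<xi>. m \<xi> * fourier f \<xi>)"

definition extends_bounded_lp ::
  "real \<Rightarrow> ((int ^ 'n::finite \<Rightarrow> complex) \<Rightarrow> int ^ 'n \<Rightarrow> complex) \<Rightarrow> bool" where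
  "extends_bounded_lp p T \<longleftrightarrow>
     (\<exists>C. \<forall>f \<in> lp 2 \<inter> lp p. T f \<in> lp p \<and> lp_norm p (T f) \<le> C * lp_norm p f)"

end

theory Submission
  imports Defs
begin

text \<open>The operator is the convolution with the kernel \<open>K = inv_fourier m\<close>, and the theorem is
Calderon-Zygmund theory on the lattice \<open>\<int>\<^sup>d\<close>. All estimates are made for
\<open>conv_on K A f n\<close>, the sum of \<open>f k * K (n - k)\<close> over a finite set \<open>A\<close>,
summed over \<open>n\<close> in a finite set \<open>B\<close>, with constants that depend on neither set. Convergence
therefore matters only at the very end, where \<open>T\<^sub>m f\<close> is the pointwise limit of these sums.

Two properties of \<open>K\<close> carry the argument; together they form \<open>cz_kernel\<close>. The first is
boundedness on \<open>\<ell>\<^sup>2\<close>: it follows from Bessel's inequality because \<open>m\<close> is bounded. The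
second is Hoermander's condition, a bound for the sum of \<open>|K (n - h) - K n|\<close> over
\<open>|n| \<ge> 4 |h|\<close> that is uniform in \<open>h\<close>.

Hoermander's condition is where the hypotheses on the derivatives enter. Let \<open>r = d + 1\<close> and let
\<open>D\<close> be the \<open>r\<close>-fold difference of \<open>m\<close> with step \<open>t\<close> along the \<open>i\<close>-th
axis. Its Fourier coefficients are \<open>(exp (2 pi i n\<^sub>i t) - 1)\<^sup>r * K n\<close>, and the factor is bounded
away from 0 where \<open>|n\<^sub>i|\<close> is comparable to \<open>1 / t\<close>. So differences take the place of
smooth cut-offs and integration by parts, and only the pure derivatives
\<open>\<partial>\<^sub>i\<^sup>r m\<close> occur. Where \<open>|\<xi>| \<le> 2 r t\<close> one uses that \<open>m\<close> is
bounded, elsewhere that \<open>D\<close> is at most \<open>t\<^sup>r\<close> times a bound for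
\<open>\<partial>\<^sub>i\<^sup>r m\<close>. Both regimes together bound the integral of \<open>|D|\<^sup>2\<close> by a
multiple of \<open>t\<^sup>d\<close> and that of \<open>|\<xi>|\<^sup>2 |D|\<^sup>2\<close> by a multiple of
\<open>t\<^sup>d * t\<^sup>2\<close>. Bessel's inequality and the Cauchy-Schwarz inequality over the at most
\<open>C R\<^sup>d\<close> lattice points of size about \<open>R\<close>, with \<open>t\<close> comparable to \<open>1 / R\<close>,
bound the sum of \<open>|K (n - e\<^sub>j) - K n|\<close> over these points by \<open>C / R\<close>
(\<open>kernel_unit_step_sum_le\<close>). Working in \<open>L\<^sup>2\<close> matters here: a pointwise estimate of the
difference from \<open>d + 1\<close> derivatives would lose a factor \<open>log R\<close>. A path of unit steps from 0
to \<open>h\<close> turns this into \<open>C |h| / R\<close>, and summing over dyadic \<open>R \<ge> 4 |h|\<close> gives the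
condition (\<open>hoermander_condition_from_unit_steps\<close>).

For a kernel with these properties the Calderon-Zygmund decomposition yields the weak type (1,1)
estimate \<open>cz_kernel_weak_type\<close>. Interpolation with \<open>\<ell>\<^sup>2\<close> covers \<open>1 < p < 2\<close>, and
duality covers \<open>p > 2\<close>, since the transposed operator has the reflected kernel and that kernel
satisfies the same hypotheses (\<open>cz_kernel_strong_type\<close>). Finally, the Riesz-Fischer theorem
(\<open>is_fourier_exists\<close>) provides the Fourier transform of every square-summable \<open>f\<close>, and the
partial sums of its Fourier series give the limit that ends the proof.\<close>

section \<open>Dyadic cubes and the Calderon-Zygmund decomposition\<close>

definition sup_abs :: "int ^ 'n::finite \<Rightarrow> int" where
  "sup_abs x = Max (range (\<lambda>i. \<bar>x $ i\<bar>))"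

lemma sup_abs_le_iff: "sup_abs x \<le> b \<longleftrightarrow> (\<forall>i. \<bar>x $ i\<bar> \<le> b)"
  by (auto simp: sup_abs_def)

lemma sup_abs_less_iff: "sup_abs x < b \<longleftrightarrow> (\<forall>i. \<bar>x $ i\<bar> < b)"
  by (auto simp: sup_abs_def)

lemma abs_le_sup_abs: "\<bar>x $ i\<bar> \<le> sup_abs x"
  using sup_abs_le_iff[of x "sup_abs x"] by auto

lemma sup_abs_attained: obtains i where "\<bar>x $ i\<bar> = sup_abs x"
proof -
  have "sup_abs x \<in> range (\<lambda>i. \<bar>x $ i\<bar>)"
    unfolding sup_abs_def by (rule Max_in) auto
  then show ?thesis using that by auto
qed

lemma sup_abs_uminus [simp]: "sup_abs (- x) = sup_abs x"
  by (simp add: sup_abs_def)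

lemma product_set_finite_card:
  fixes S :: "'n::finite \<Rightarrow> 'a set"
  assumes "\<And>i. finite (S i)"
  shows "finite {x :: 'a ^ 'n. \<forall>i. x $ i \<in> S i}"
    and "card {x :: 'a ^ 'n. \<forall>i. x $ i \<in> S i} = (\<Prod>i\<in>UNIV. card (S i))"
proof -
  have eq: "{x :: 'a ^ 'n. \<forall>i. x $ i \<in> S i} = vec_lambda ` (PiE UNIV S)"
  proof (intro equalityI subsetI)
    fix x :: "'a ^ 'n" assume "x \<in> {x. \<forall>i. x $ i \<in> S i}"
    then have "vec_nth x \<in> PiE UNIV S" by auto
    then show "x \<in> vec_lambda ` (PiE UNIV S)"
      by (metis image_eqI vec_nth_inverse)
  qed auto
  have inj: "inj_on vec_lambda (PiE UNIV S)"
    by (metis inj_onI UNIV_I vec_lambda_inverse)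
  show "finite {x :: 'a ^ 'n. \<forall>i. x $ i \<in> S i}"
    unfolding eq by (intro finite_imageI finite_PiE) (auto simp: assms)
  show "card {x :: 'a ^ 'n. \<forall>i. x $ i \<in> S i} = (\<Prod>i\<in>UNIV. card (S i))"
    unfolding eq by (simp add: card_image[OF inj] card_PiE)
qed

lemma sup_abs_ball_finite_card:
  fixes c :: "int ^ 'n::finite"
  assumes "0 \<le> b"
  shows "finite {x. sup_abs (x - c) < b}"
    and "real (card {x. sup_abs (x - c) < b}) \<le> (2 * real_of_int b) ^ CARD('n)"
proof -
  have eq: "{x. sup_abs (x - c) < b} = {x. \<forall>i. x $ i \<in> {c $ i - b <..< c $ i + b}}"
    by (auto simp: sup_abs_less_iff abs_less_iff algebra_simps)
  note fc = product_set_finite_card[of "\<lambda>i. {c $ i - b <..< c $ i + b}"]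
  show "finite {x. sup_abs (x - c) < b}" unfolding eq by (rule fc(1)) simp
  have "card {x. sup_abs (x - c) < b} = nat (2 * b - 1) ^ CARD('n)"
    unfolding eq by (subst fc(2)) (auto simp: algebra_simps)
  also have "real \<dots> \<le> (2 * real_of_int b) ^ CARD('n)"
    unfolding of_nat_power using assms by (intro power_mono) auto
  finally show "real (card {x. sup_abs (x - c) < b}) \<le> (2 * real_of_int b) ^ CARD('n)" .
qed

text \<open>The cube of side \<open>2 ^ k\<close> that contains \<open>c\<close>, named by any of its points. Integer division rounds
down also for negative coordinates, so the cubes of one generation partition the lattice, and the
cubes of the next generation are unions of them.\<close>

definition dyadic :: "nat \<Rightarrow> int ^ 'n::finite \<Rightarrow> (int ^ 'n) set" where
  "dyadic k c = {x. \<forall>i. x $ i div 2 ^ k = c $ i div 2 ^ k}"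

lemma dyadic_self [simp]: "c \<in> dyadic k c"
  by (simp add: dyadic_def)

lemma dyadic_eq: "x \<in> dyadic k c \<Longrightarrow> dyadic k x = dyadic k c"
  by (simp add: dyadic_def)

lemma dyadic_mono: 
  assumes "k \<le> l" shows "dyadic k c \<subseteq> dyadic l c"
proof -
  obtain j where l: "l = k + j" using assms le_Suc_ex by blast
  have "x div 2 ^ l = (x div 2 ^ k) div 2 ^ j" for x :: int
    by (simp add: l power_add zdiv_zmult2_eq)
  then show ?thesis by (auto simp: dyadic_def)
qed

lemma dyadic_finite_card:
  fixes c :: "int ^ 'n::finite"
  shows "finite (dyadic k c)" and "card (dyadic k c) = 2 ^ (k * CARD('n))"
proof -
  have iff: "x div 2 ^ k = y div 2 ^ k \<longleftrightarrow> x \<in> {(y div 2 ^ k) * 2 ^ k ..< (y div 2 ^ k) * 2 ^ k + 2 ^ k}"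
    (is "?L \<longleftrightarrow> ?R") for x y :: int
  proof
    assume L: ?L
    have "x = 2 ^ k * (y div 2 ^ k) + x mod 2 ^ k" using L by (metis mult_div_mod_eq)
    moreover have "0 \<le> x mod 2 ^ k" "x mod 2 ^ k < 2 ^ k" by simp_all
    ultimately show ?R
      by (metis (no_types) add_left_mono add_strict_left_mono add.right_neutral atLeastLessThan_iff mult.commute)
  next
    assume ?R
    then show ?L
      by (intro int_div_pos_eq[where r = "x - (y div 2 ^ k) * 2 ^ k"]) (auto simp: algebra_simps)
  qed
  have eq: "dyadic k c = {x. \<forall>i. x $ i \<in> {(c $ i div 2 ^ k) * 2 ^ k ..< (c $ i div 2 ^ k) * 2 ^ k + 2 ^ k}}"
    by (auto simp only: dyadic_def iff)
  note fc = product_set_finite_card[of "\<lambda>i. {(c $ i div 2 ^ k) * 2 ^ k ..< (c $ i div 2 ^ k) * 2 ^ k + 2 ^ k}"]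
  show "finite (dyadic k c)" unfolding eq by (rule fc(1)) simp
  show "card (dyadic k c) = 2 ^ (k * CARD('n))"
    unfolding eq by (subst fc(2)) (auto simp: power_mult nat_power_eq)
qed

lemma dyadic_diameter:
  assumes "x \<in> dyadic k c" shows "sup_abs (x - c) < 2 ^ k"
proof -
  have "\<bar>x - y\<bar> < 2 ^ k" if "x div 2 ^ k = y div 2 ^ k" for x y :: int
  proof -
    have "x = 2 ^ k * (y div 2 ^ k) + x mod 2 ^ k" "y = 2 ^ k * (y div 2 ^ k) + y mod 2 ^ k"
      using that by (metis mult_div_mod_eq)+
    moreover have "0 \<le> x mod 2 ^ k" "x mod 2 ^ k < 2 ^ k" "0 \<le> y mod 2 ^ k" "y mod 2 ^ k < 2 ^ k"
      by simp_all
    ultimately show ?thesis unfolding abs_less_iff by linarith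
  qed
  then show ?thesis using assms by (auto simp: dyadic_def sup_abs_less_iff)
qed

text \<open>The maximal dyadic cubes on which the average of \<open>|f|\<close> exceeds \<open>\<tau>\<close>: \<open>\<Omega>\<close> is their
union and \<open>lev c\<close> is the generation of the one that contains \<open>c\<close>. They exist because \<open>f\<close> is
summable, so that large cubes have small averages. The parent of a maximal cube has average at most
\<open>\<tau>\<close>, whence the upper bound with the factor \<open>2 ^ d\<close>; a point outside \<open>\<Omega>\<close> is itself
a cube of side 1 that was not selected.\<close>

lemma calderon_zygmund_cubes:
  fixes f :: "int ^ 'n::finite \<Rightarrow> complex" and \<tau> :: real
  assumes A: "finite A" and supp: "\<And>x. x \<notin> A \<Longrightarrow> f x = 0" and lam: "\<tau> > 0"
  obtains \<Omega> :: "(int ^ 'n) set" and lev :: "int ^ 'n \<Rightarrow> nat"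
  where "finite \<Omega>"
    and "\<And>c. c \<in> \<Omega> \<Longrightarrow> dyadic (lev c) c \<subseteq> \<Omega>"
    and "\<And>c x. c \<in> \<Omega> \<Longrightarrow> x \<in> dyadic (lev c) c \<Longrightarrow> lev x = lev c"
    and "\<And>c. c \<in> \<Omega> \<Longrightarrow> \<tau> * real (card (dyadic (lev c) c)) < (\<Sum>x\<in>dyadic (lev c) c. norm (f x))"
    and "\<And>c. c \<in> \<Omega> \<Longrightarrow> (\<Sum>x\<in>dyadic (lev c) c. norm (f x)) \<le> 2 ^ CARD('n) * \<tau> * real (card (dyadic (lev c) c))"
    and "\<And>x. x \<notin> \<Omega> \<Longrightarrow> norm (f x) \<le> \<tau>"
proof -
  define S where "S k c = (\<Sum>x\<in>dyadic k c. norm (f x))" for k and c :: "int ^ 'n"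
  define big where "big k c \<longleftrightarrow> \<tau> * 2 ^ (k * CARD('n)) < S k c" for k and c :: "int ^ 'n"
  define \<Omega> where "\<Omega> = {c. \<exists>k. big k c}"
  define lev where "lev c = (GREATEST k. big k c)" for c
  have S_total: "S k c \<le> (\<Sum>x\<in>A. norm (f x))" for k c
  proof -
    have "S k c = (\<Sum>x\<in>dyadic k c \<inter> A. norm (f x))"
      unfolding S_def using supp by (intro sum.mono_neutral_right) (auto simp: dyadic_finite_card)
    also have "\<dots> \<le> (\<Sum>x\<in>A. norm (f x))" using A by (intro sum_mono2) auto
    finally show ?thesis .
  qed
  obtain N :: nat where N: "(\<Sum>x\<in>A. norm (f x)) / \<tau> < real N" using reals_Archimedean2 by blast
  have bounded: "k \<le> N" if "big k c" for k c
  proof -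
    have "k < 2 ^ k" by (rule less_exp)
    also have "(2::nat) ^ k \<le> 2 ^ (k * CARD('n))" by (intro power_increasing) (auto simp: Suc_leI)
    finally have "real k \<le> 2 ^ (k * CARD('n))" by (metis less_imp_le of_nat_le_iff of_nat_numeral of_nat_power)
    then have "\<tau> * real k \<le> \<tau> * 2 ^ (k * CARD('n))" using lam by simp
    also have "\<dots> < (\<Sum>x\<in>A. norm (f x))" using that S_total[of k c] by (simp add: big_def)
    finally have "real k < (\<Sum>x\<in>A. norm (f x)) / \<tau>" using lam by (simp add: field_simps)
    then show ?thesis using N by linarith
  qed
  have big_lev: "big (lev c) c" if "c \<in> \<Omega>" for c
  proof -
    obtain k where "big k c" using \<open>c \<in> \<Omega>\<close> by (auto simp: \<Omega>_def)
    then show ?thesis unfolding lev_def by (rule GreatestI_nat) (rule bounded)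
  qed
  have le_lev: "k \<le> lev c" if "big k c" for k c
    using that unfolding lev_def by (rule Greatest_le_nat) (rule bounded)
  have big_cong: "big k x = big k c" if "x \<in> dyadic k c" for k x c
    by (simp add: big_def S_def dyadic_eq[OF that])
  show thesis
  proof (rule that[of \<Omega> lev])
    have "\<Omega> \<subseteq> (\<Union>k\<le>N. \<Union>a\<in>A. dyadic k a)"
    proof
      fix c assume "c \<in> \<Omega>"
      then obtain k where k: "big k c" by (auto simp: \<Omega>_def)
      have "0 < \<tau> * 2 ^ (k * CARD('n))" using lam by simp
      then have "S k c \<noteq> 0" using k by (auto simp: big_def)
      then obtain a where a: "a \<in> dyadic k c" "f a \<noteq> 0" 
        unfolding S_def by (metis norm_zero sum.neutral)
      then have "c \<in> dyadic k a" by (simp add: dyadic_def)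
      then show "c \<in> (\<Union>k\<le>N. \<Union>a\<in>A. dyadic k a)" using a supp bounded[OF k] by blast
    qed
    then show "finite \<Omega>" by (rule finite_subset) (use A in \<open>auto simp: dyadic_finite_card\<close>)
    show "dyadic (lev c) c \<subseteq> \<Omega>" if "c \<in> \<Omega>" for c
      using big_lev[OF that] big_cong by (auto simp: \<Omega>_def)
    show "lev x = lev c" if c: "c \<in> \<Omega>" and x: "x \<in> dyadic (lev c) c" for c x
    proof (rule antisym)
      show ge: "lev c \<le> lev x" using big_lev[OF c] big_cong[OF x] le_lev by blast
      have "x \<in> \<Omega>" using big_lev[OF c] big_cong[OF x] by (auto simp: \<Omega>_def)
      moreover have "x \<in> dyadic (lev x) c" using x dyadic_mono[OF ge] by blast
      ultimately show "lev x \<le> lev c" using big_lev big_cong le_lev by blast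
    qed
    show "\<tau> * real (card (dyadic (lev c) c)) < (\<Sum>x\<in>dyadic (lev c) c. norm (f x))" if "c \<in> \<Omega>" for c
      using big_lev[OF that] by (simp add: big_def S_def dyadic_finite_card)
    show "(\<Sum>x\<in>dyadic (lev c) c. norm (f x)) \<le> 2 ^ CARD('n) * \<tau> * real (card (dyadic (lev c) c))"
      if "c \<in> \<Omega>" for c
    proof -
      have "(\<Sum>x\<in>dyadic (lev c) c. norm (f x)) \<le> S (Suc (lev c)) c"
        unfolding S_def by (intro sum_mono2 dyadic_finite_card dyadic_mono) auto
      also have "\<dots> \<le> \<tau> * 2 ^ (Suc (lev c) * CARD('n))"
        using le_lev[of "Suc (lev c)" c] by (force simp: big_def)
      finally show ?thesis by (simp add: dyadic_finite_card power_add algebra_simps)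
    qed
    show "norm (f x) \<le> \<tau>" if "x \<notin> \<Omega>" for x
    proof -
      have "dyadic 0 x = {x}" by (auto simp: dyadic_def vec_eq_iff)
      moreover have "\<not> big 0 x" using that by (auto simp: \<Omega>_def)
      ultimately show ?thesis by (simp add: big_def S_def)
    qed
  qed
qed

text \<open>The good part \<open>g\<close> is \<open>f\<close> with its values on every selected cube replaced by their average, which
makes it bounded; the bad part \<open>b\<close> lives on the selected cubes and has mean zero on each.\<close>

lemma calderon_zygmund_decomposition:
  fixes f :: "int ^ 'n::finite \<Rightarrow> complex" and \<tau> :: real
  assumes A: "finite A" and supp: "\<And>x. x \<notin> A \<Longrightarrow> f x = 0" and lam: "\<tau> > 0"
  obtains \<Q> :: "(int ^ 'n) set set" and g b :: "int ^ 'n \<Rightarrow> complex"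
  where "finite \<Q>" and "disjoint \<Q>"
    and "\<And>q. q \<in> \<Q> \<Longrightarrow> \<exists>k c. q = dyadic k c"
    and "\<tau> * (\<Sum>q\<in>\<Q>. real (card q)) \<le> (\<Sum>x\<in>A. norm (f x))"
    and "\<And>x. f x = g x + b x"
    and "\<And>x. x \<notin> \<Union>\<Q> \<Longrightarrow> b x = 0"
    and "\<And>q. q \<in> \<Q> \<Longrightarrow> (\<Sum>x\<in>q. b x) = 0"
    and "\<And>x. norm (g x) \<le> 2 ^ CARD('n) * \<tau>"
    and "(\<Sum>x\<in>A \<union> \<Union>\<Q>. norm (g x)) \<le> (\<Sum>x\<in>A. norm (f x))"
    and "(\<Sum>x\<in>\<Union>\<Q>. norm (b x)) \<le> 2 * (\<Sum>x\<in>A. norm (f x))"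
proof -
  obtain \<Omega> :: "(int ^ 'n) set" and lev :: "int ^ 'n \<Rightarrow> nat"
    where fin: "finite \<Omega>"
    and sub: "\<And>c. c \<in> \<Omega> \<Longrightarrow> dyadic (lev c) c \<subseteq> \<Omega>"
    and lev: "\<And>c x. c \<in> \<Omega> \<Longrightarrow> x \<in> dyadic (lev c) c \<Longrightarrow> lev x = lev c"
    and lower: "\<And>c. c \<in> \<Omega> \<Longrightarrow> \<tau> * real (card (dyadic (lev c) c)) < (\<Sum>x\<in>dyadic (lev c) c. norm (f x))"
    and upper: "\<And>c. c \<in> \<Omega> \<Longrightarrow> (\<Sum>x\<in>dyadic (lev c) c. norm (f x)) \<le> 2 ^ CARD('n) * \<tau> * real (card (dyadic (lev c) c))"
    and small: "\<And>x. x \<notin> \<Omega> \<Longrightarrow> norm (f x) \<le> \<tau>"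
    by (rule calderon_zygmund_cubes[OF A supp lam], assumption, rule that)
  define Q where "Q c = dyadic (lev c) c" for c
  define \<Q> where "\<Q> = Q ` \<Omega>"
  define g where "g x = (if x \<in> \<Omega> then (\<Sum>y\<in>Q x. f y) / of_nat (card (Q x)) else f x)" for x
  define b where "b x = f x - g x" for x
  have Q_self: "c \<in> Q c" for c by (simp add: Q_def)
  have Q_eq: "Q x = Q c" if "c \<in> \<Omega>" "x \<in> Q c" for x c
    using lev[of c x] dyadic_eq[of x "lev c" c] that by (simp add: Q_def)
  have Q_fin: "finite (Q c)" and Q_pos: "0 < card (Q c)" for c
    by (simp_all add: Q_def dyadic_finite_card)
  have Union_Q: "\<Union>\<Q> = \<Omega>" using sub Q_self by (auto simp: \<Q>_def Q_def)
  have disj: "disjoint \<Q>"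
  proof (rule disjointI)
    fix q r assume "q \<in> \<Q>" "r \<in> \<Q>" "q \<noteq> r"
    then show "q \<inter> r = {}" unfolding \<Q>_def using Q_eq by blast
  qed
  have sum_split: "(\<Sum>x\<in>\<Omega>. h x) = (\<Sum>q\<in>\<Q>. \<Sum>x\<in>q. h x)" for h :: "int ^ 'n \<Rightarrow> real"
    unfolding Union_Q[symmetric] using disj Q_fin
    by (subst sum.Union_disjoint) (auto simp: \<Q>_def disjoint_def)
  have g_on: "g x = (\<Sum>y\<in>Q c. f y) / of_nat (card (Q c))" if "c \<in> \<Omega>" "x \<in> Q c" for x c
    using that sub[of c] Q_eq[OF that] by (auto simp: g_def Q_def)
  have sum_g: "(\<Sum>x\<in>Q c. norm (g x)) \<le> (\<Sum>x\<in>Q c. norm (f x))" if "c \<in> \<Omega>" for c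
  proof -
    have "(\<Sum>x\<in>Q c. norm (g x)) = norm (\<Sum>y\<in>Q c. f y)"
      using g_on[OF that] Q_pos[of c] by (simp add: norm_divide)
    also have "\<dots> \<le> (\<Sum>x\<in>Q c. norm (f x))" by (rule norm_sum)
    finally show ?thesis .
  qed
  have sum_g_\<Omega>: "(\<Sum>x\<in>\<Omega>. norm (g x)) \<le> (\<Sum>x\<in>\<Omega>. norm (f x))"
    unfolding sum_split by (rule sum_mono) (auto simp: \<Q>_def intro: sum_g)
  have f_total: "(\<Sum>x\<in>X. norm (f x)) \<le> (\<Sum>x\<in>A. norm (f x))" if "finite X" for X
  proof -
    have "(\<Sum>x\<in>X. norm (f x)) = (\<Sum>x\<in>X \<inter> A. norm (f x))"
      using supp that by (intro sum.mono_neutral_right) auto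
    also have "\<dots> \<le> (\<Sum>x\<in>A. norm (f x))" using A by (intro sum_mono2) auto
    finally show ?thesis .
  qed
  show thesis
  proof (rule that[of \<Q> g b])
    show "finite \<Q>" using fin by (simp add: \<Q>_def)
    show "disjoint \<Q>" by (rule disj)
    show "\<exists>k c. q = dyadic k c" if "q \<in> \<Q>" for q
      using that unfolding \<Q>_def Q_def by blast
    have "\<tau> * (\<Sum>q\<in>\<Q>. real (card q)) \<le> (\<Sum>q\<in>\<Q>. \<Sum>x\<in>q. norm (f x))"
      unfolding sum_distrib_left using lower by (intro sum_mono) (auto simp: \<Q>_def Q_def intro: less_imp_le)
    also have "\<dots> \<le> (\<Sum>x\<in>A. norm (f x))" unfolding sum_split[symmetric] by (rule f_total[OF fin])
    finally show "\<tau> * (\<Sum>q\<in>\<Q>. real (card q)) \<le> (\<Sum>x\<in>A. norm (f x))" .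
    show "f x = g x + b x" for x by (simp add: b_def)
    show "b x = 0" if "x \<notin> \<Union>\<Q>" for x using that by (simp add: Union_Q b_def g_def)
    show "(\<Sum>x\<in>q. b x) = 0" if q: "q \<in> \<Q>" for q
    proof -
      obtain c where c: "c \<in> \<Omega>" "q = Q c" using q by (auto simp: \<Q>_def)
      have "(\<Sum>x\<in>q. g x) = (\<Sum>x\<in>q. f x)" using g_on[OF c(1)] Q_pos[of c] by (simp add: c(2))
      then show ?thesis by (simp add: b_def sum_subtractf)
    qed
    show "norm (g x) \<le> 2 ^ CARD('n) * \<tau>" for x
    proof (cases "x \<in> \<Omega>")
      case True
      have "norm (g x) = norm (\<Sum>y\<in>Q x. f y) / real (card (Q x))" using True by (simp add: g_def norm_divide)
      also have "\<dots> \<le> (\<Sum>y\<in>Q x. norm (f y)) / real (card (Q x))" by (intro divide_right_mono norm_sum) simp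
      also have "\<dots> \<le> 2 ^ CARD('n) * \<tau>"
        using upper[OF True] Q_pos[of x] by (simp add: Q_def divide_le_eq)
      finally show ?thesis .
    next
      case False
      have "1 * \<tau> \<le> 2 ^ CARD('n) * \<tau>" using lam by (intro mult_right_mono) auto
      then show ?thesis using False small[of x] by (simp add: g_def)
    qed
    have "(\<Sum>x\<in>A \<union> \<Union>\<Q>. norm (g x)) = (\<Sum>x\<in>\<Omega>. norm (g x)) + (\<Sum>x\<in>A - \<Omega>. norm (g x))"
      unfolding Union_Q using A fin by (subst sum.union_disjoint[symmetric]) (auto intro: sum.cong)
    also have "\<dots> \<le> (\<Sum>x\<in>\<Omega>. norm (f x)) + (\<Sum>x\<in>A - \<Omega>. norm (f x))"
      by (intro add_mono sum_g_\<Omega> sum_mono) (auto simp: g_def)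
    also have "\<dots> = (\<Sum>x\<in>A \<union> \<Omega>. norm (f x))"
      using A fin by (subst sum.union_disjoint[symmetric]) (auto intro: sum.cong)
    also have "\<dots> \<le> (\<Sum>x\<in>A. norm (f x))" using A fin by (intro f_total) auto
    finally show "(\<Sum>x\<in>A \<union> \<Union>\<Q>. norm (g x)) \<le> (\<Sum>x\<in>A. norm (f x))" .
    have "(\<Sum>x\<in>\<Union>\<Q>. norm (b x)) \<le> (\<Sum>x\<in>\<Omega>. norm (f x)) + (\<Sum>x\<in>\<Omega>. norm (g x))"
      unfolding Union_Q sum.distrib[symmetric] b_def by (intro sum_mono norm_triangle_ineq4)
    also have "\<dots> \<le> 2 * (\<Sum>x\<in>A. norm (f x))" using sum_g_\<Omega> f_total[OF fin] by simp
    finally show "(\<Sum>x\<in>\<Union>\<Q>. norm (b x)) \<le> 2 * (\<Sum>x\<in>A. norm (f x))" .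
  qed
qed

section \<open>Singular integrals on the lattice\<close>

text \<open>Convolution with \<open>K\<close> of the restriction of \<open>f\<close> to \<open>A\<close>. For finite \<open>A\<close> it is a finite
sum, whatever the decay of \<open>K\<close>.\<close>

definition conv_on :: "(int ^ 'n::finite \<Rightarrow> complex) \<Rightarrow> (int ^ 'n) set \<Rightarrow> (int ^ 'n \<Rightarrow> complex) \<Rightarrow> int ^ 'n \<Rightarrow> complex" where
  "conv_on K A f n = (\<Sum>k\<in>A. f k * K (n - k))"

text \<open>A single constant serves for the bound on \<open>\<ell>\<^sup>2\<close> and for Hoermander's condition. The factor 4
leaves room, on the way from \<open>n\<close> to \<open>n - h\<close>, to stay at a distance from the origin comparable
to \<open>|n|\<close>.\<close>

definition cz_kernel :: "real \<Rightarrow> (int ^ 'n::finite \<Rightarrow> complex) \<Rightarrow> bool" where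
  "cz_kernel M K \<longleftrightarrow> 0 \<le> M \<and>
     (\<forall>A B f. finite A \<longrightarrow> finite B \<longrightarrow>
        (\<Sum>n\<in>B. (norm (conv_on K A f n))\<^sup>2) \<le> M * (\<Sum>k\<in>A. (norm (f k))\<^sup>2)) \<and>
     (\<forall>h B. finite B \<longrightarrow> (\<forall>n\<in>B. 4 * sup_abs h \<le> sup_abs n) \<longrightarrow>
        (\<Sum>n\<in>B. norm (K (n - h) - K n)) \<le> M)"

lemma chebyshev_card:
  fixes F :: "'a \<Rightarrow> real"
  assumes "finite B" and "\<And>n. n \<in> B \<Longrightarrow> 0 \<le> F n"
  shows "s * real (card {n \<in> B. s < F n}) \<le> (\<Sum>n\<in>B. F n)"
proof -
  have "s * real (card {n \<in> B. s < F n}) = (\<Sum>n | n \<in> B \<and> s < F n. s)" by simp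
  also have "\<dots> \<le> (\<Sum>n | n \<in> B \<and> s < F n. F n)" by (intro sum_mono) auto
  also have "\<dots> \<le> (\<Sum>n\<in>B. F n)" using assms by (intro sum_mono2) auto
  finally show ?thesis .
qed

lemma cz_kernelD:
  assumes "cz_kernel M K"
  shows "0 \<le> M"
    and "finite A \<Longrightarrow> finite B \<Longrightarrow>
      (\<Sum>n\<in>B. (norm (conv_on K A f n))\<^sup>2) \<le> M * (\<Sum>k\<in>A. (norm (f k))\<^sup>2)"
    and "finite B \<Longrightarrow> (\<And>n. n \<in> B \<Longrightarrow> 4 * sup_abs h \<le> sup_abs n) \<Longrightarrow>
      (\<Sum>n\<in>B. norm (K (n - h) - K n)) \<le> M"
  using assms by (simp_all add: cz_kernel_def)

text \<open>The mean of \<open>b\<close> vanishes, so \<open>K (n - x)\<close> may be replaced by \<open>K (n - x) - K (n - c)\<close>, to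
which Hoermander's condition applies with \<open>h = x - c\<close>.\<close>

lemma cz_kernel_bad_part:
  fixes K :: "int ^ 'n::finite \<Rightarrow> complex"
  assumes K: "cz_kernel M K" and B: "finite B"
    and mean: "(\<Sum>x\<in>dyadic k c. b x) = 0"
    and far: "\<And>n. n \<in> B \<Longrightarrow> 4 * 2 ^ k \<le> sup_abs (n - c)"
  shows "(\<Sum>n\<in>B. norm (conv_on K (dyadic k c) b n)) \<le> M * (\<Sum>x\<in>dyadic k c. norm (b x))"
proof -
  have "conv_on K (dyadic k c) b n = (\<Sum>x\<in>dyadic k c. b x * (K (n - x) - K (n - c)))" for n
  proof -
    have "(\<Sum>x\<in>dyadic k c. b x * K (n - c)) = 0"
      by (subst sum_distrib_right[symmetric]) (simp add: mean)
    then show ?thesis by (simp add: conv_on_def right_diff_distrib sum_subtractf)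
  qed
  then have "(\<Sum>n\<in>B. norm (conv_on K (dyadic k c) b n))
      \<le> (\<Sum>n\<in>B. \<Sum>x\<in>dyadic k c. norm (b x) * norm (K (n - x) - K (n - c)))"
    by (auto intro!: sum_mono sum_norm_le simp: norm_mult)
  also have "\<dots> = (\<Sum>x\<in>dyadic k c. norm (b x) * (\<Sum>n\<in>B. norm (K (n - x) - K (n - c))))"
    by (subst sum.swap) (simp add: sum_distrib_left)
  also have "\<dots> \<le> (\<Sum>x\<in>dyadic k c. norm (b x) * M)"
  proof (intro sum_mono mult_left_mono norm_ge_zero)
    fix x assume x: "x \<in> dyadic k c"
    have "(\<Sum>n\<in>B. norm (K (n - x) - K (n - c)))
        = (\<Sum>n\<in>(\<lambda>n. n - c) ` B. norm (K (n - (x - c)) - K n))"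
      by (subst sum.reindex) (auto intro: inj_onI)
    also have "\<dots> \<le> M"
    proof (rule cz_kernelD(3)[OF K])
      fix n assume "n \<in> (\<lambda>n. n - c) ` B"
      then show "4 * sup_abs (x - c) \<le> sup_abs n" using far dyadic_diameter[OF x] by force
    qed (use B in simp)
    finally show "(\<Sum>n\<in>B. norm (K (n - x) - K (n - c))) \<le> M" .
  qed
  finally show ?thesis by (simp add: sum_distrib_left mult.commute)
qed

text \<open>The three terms of the constant belong to the three parts of the Calderon-Zygmund argument at height
\<open>\<tau>\<close>. The good part is bounded, so its \<open>\<ell>\<^sup>2\<close> norm is controlled by \<open>\<tau>\<close> and the
\<open>\<ell>\<^sup>1\<close> norm. The enlarged selected cubes \<open>E\<close> contain few points. Away from \<open>E\<close> the
bad part is small in \<open>\<ell>\<^sup>1\<close>.\<close>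

lemma cz_kernel_weak_type:
  fixes K :: "int ^ 'n::finite \<Rightarrow> complex"
  assumes K: "cz_kernel M K" and A: "finite A" and B: "finite B" and \<tau>: "0 < \<tau>"
  shows "\<tau> * real (card {n \<in> B. 2 * \<tau> < norm (conv_on K A f n)})
    \<le> (2 ^ CARD('n) * M + 8 ^ CARD('n) + 2 * M) * (\<Sum>k\<in>A. norm (f k))"
proof -
  let ?d = "CARD('n)"
  have M: "0 \<le> M" by (rule cz_kernelD(1)[OF K])
  define f' where "f' x = (if x \<in> A then f x else 0)" for x
  have f'_sum: "(\<Sum>x\<in>A. norm (f' x)) = (\<Sum>x\<in>A. norm (f x))" by (simp add: f'_def)
  obtain \<Q> :: "(int ^ 'n) set set" and g b :: "int ^ 'n \<Rightarrow> complex"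
    where Qfin: "finite \<Q>" and Qdisj: "disjoint \<Q>"
    and Qdy: "\<And>q. q \<in> \<Q> \<Longrightarrow> \<exists>k c. q = dyadic k c"
    and Qcard: "\<tau> * (\<Sum>q\<in>\<Q>. real (card q)) \<le> (\<Sum>x\<in>A. norm (f' x))"
    and fgb: "\<And>x. f' x = g x + b x"
    and b0: "\<And>x. x \<notin> \<Union>\<Q> \<Longrightarrow> b x = 0"
    and bmean: "\<And>q. q \<in> \<Q> \<Longrightarrow> (\<Sum>x\<in>q. b x) = 0"
    and gsup: "\<And>x. norm (g x) \<le> 2 ^ ?d * \<tau>"
    and gsum: "(\<Sum>x\<in>A \<union> \<Union>\<Q>. norm (g x)) \<le> (\<Sum>x\<in>A. norm (f' x))"
    and bsum: "(\<Sum>x\<in>\<Union>\<Q>. norm (b x)) \<le> 2 * (\<Sum>x\<in>A. norm (f' x))"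
  proof (rule calderon_zygmund_decomposition[OF A _ \<tau>, of f'])
    show "f' x = 0" if "x \<notin> A" for x using that by (simp add: f'_def)
  qed (rule that)
  let ?F = "\<Sum>x\<in>A. norm (f x)"
  obtain k c where kc: "\<And>q. q \<in> \<Q> \<Longrightarrow> q = dyadic (k q) (c q)" using Qdy by metis
  have Q_fin: "finite q" if "q \<in> \<Q>" for q
    by (subst kc[OF that]) (rule dyadic_finite_card)
  define S where "S = A \<union> \<Union>\<Q>"
  have S: "finite S" using A Qfin Q_fin by (auto simp: S_def)
  define E where "E = (\<Union>q\<in>\<Q>. {n. sup_abs (n - c q) < 4 * 2 ^ k q})"
  have split: "conv_on K A f n = conv_on K S g n + conv_on K S b n" for n
  proof -
    have "conv_on K A f n = conv_on K S f' n"
      unfolding conv_on_def using S by (intro sum.mono_neutral_cong_left) (auto simp: S_def f'_def)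
    then show ?thesis by (simp add: conv_on_def fgb distrib_right sum.distrib)
  qed
  have E: "finite E" "\<tau> * real (card E) \<le> 8 ^ ?d * ?F"
  proof -
    show "finite E" unfolding E_def using Qfin by (auto intro: sup_abs_ball_finite_card)
    have "real (card E) \<le> (\<Sum>q\<in>\<Q>. real (card {n. sup_abs (n - c q) < 4 * 2 ^ k q}))"
      unfolding E_def of_nat_sum[symmetric] by (intro of_nat_mono card_UN_le Qfin)
    also have "\<dots> \<le> (\<Sum>q\<in>\<Q>. 8 ^ ?d * real (card q))"
    proof (rule sum_mono)
      fix q assume q: "q \<in> \<Q>"
      have "real (card {n. sup_abs (n - c q) < 4 * 2 ^ k q}) \<le> (2 * real_of_int (4 * 2 ^ k q)) ^ ?d"
        by (rule sup_abs_ball_finite_card) simp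
      also have "\<dots> = 8 ^ ?d * real (card (dyadic (k q) (c q)))"
        by (simp add: dyadic_finite_card power_mult power_mult_distrib)
      finally show "real (card {n. sup_abs (n - c q) < 4 * 2 ^ k q}) \<le> 8 ^ ?d * real (card q)"
        using kc[OF q] by simp
    qed
    finally have "\<tau> * real (card E) \<le> 8 ^ ?d * (\<tau> * (\<Sum>q\<in>\<Q>. real (card q)))"
      using \<tau> by (simp add: sum_distrib_left[symmetric] mult.left_commute)
    also have "\<dots> \<le> 8 ^ ?d * ?F" using Qcard f'_sum by (intro mult_left_mono) auto
    finally show "\<tau> * real (card E) \<le> 8 ^ ?d * ?F" .
  qed
  let ?G = "{n \<in> B. \<tau> < norm (conv_on K S g n)}"
  let ?H = "{n \<in> B - E. \<tau> < norm (conv_on K S b n)}"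
  have good: "\<tau> * real (card ?G) \<le> 2 ^ ?d * M * ?F"
  proof -
    have "\<tau>\<^sup>2 * real (card ?G) \<le> \<tau>\<^sup>2 * real (card {n \<in> B. \<tau>\<^sup>2 < (norm (conv_on K S g n))\<^sup>2})"
      using \<tau> B by (intro mult_left_mono of_nat_mono card_mono) (auto intro: power_strict_mono)
    also have "\<dots> \<le> (\<Sum>n\<in>B. (norm (conv_on K S g n))\<^sup>2)" by (rule chebyshev_card[OF B]) simp
    also have "\<dots> \<le> M * (\<Sum>x\<in>S. (norm (g x))\<^sup>2)" using cz_kernelD(2)[OF K S B] .
    also have "\<dots> \<le> M * (\<Sum>x\<in>S. (2 ^ ?d * \<tau>) * norm (g x))"
      using M gsup by (auto intro!: mult_left_mono sum_mono mult_right_mono simp: power2_eq_square)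
    also have "\<dots> \<le> M * ((2 ^ ?d * \<tau>) * ?F)"
      unfolding sum_distrib_left[symmetric] using M \<tau> gsum f'_sum by (intro mult_left_mono) (auto simp: S_def)
    finally have "\<tau> * (\<tau> * real (card ?G)) \<le> \<tau> * (2 ^ ?d * M * ?F)"
      by (simp add: power2_eq_square algebra_simps)
    then show ?thesis using \<tau> by simp
  qed
  have bad: "\<tau> * real (card ?H) \<le> 2 * M * ?F"
  proof -
    have eq: "conv_on K S b n = (\<Sum>q\<in>\<Q>. conv_on K q b n)" for n
    proof -
      have "conv_on K S b n = (\<Sum>x\<in>\<Union>\<Q>. b x * K (n - x))"
        unfolding conv_on_def using b0 S by (intro sum.mono_neutral_right) (auto simp: S_def)
      then show ?thesis
        using Q_fin Qdisj by (simp add: sum.Union_disjoint disjoint_def conv_on_def)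
    qed
    have "\<tau> * real (card ?H) \<le> (\<Sum>n\<in>B - E. norm (conv_on K S b n))"
      using B by (intro chebyshev_card) auto
    also have "\<dots> \<le> (\<Sum>n\<in>B - E. \<Sum>q\<in>\<Q>. norm (conv_on K q b n))"
      unfolding eq by (intro sum_mono norm_sum)
    also have "\<dots> = (\<Sum>q\<in>\<Q>. \<Sum>n\<in>B - E. norm (conv_on K q b n))" by (rule sum.swap)
    also have "\<dots> \<le> (\<Sum>q\<in>\<Q>. M * (\<Sum>x\<in>q. norm (b x)))"
    proof (rule sum_mono)
      fix q assume q: "q \<in> \<Q>"
      have far: "4 * 2 ^ k q \<le> sup_abs (n - c q)" if "n \<in> B - E" for n
        using that q by (force simp: E_def)
      have "(\<Sum>n\<in>B - E. norm (conv_on K (dyadic (k q) (c q)) b n)) \<le> M * (\<Sum>x\<in>dyadic (k q) (c q). norm (b x))"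
        using K B bmean[OF q] kc[OF q] far by (intro cz_kernel_bad_part) auto
      then show "(\<Sum>n\<in>B - E. norm (conv_on K q b n)) \<le> M * (\<Sum>x\<in>q. norm (b x))"
        using kc[OF q] by simp
    qed
    also have "\<dots> = M * (\<Sum>x\<in>\<Union>\<Q>. norm (b x))"
      using Q_fin Qdisj by (simp add: sum.Union_disjoint disjoint_def sum_distrib_left)
    also have "\<dots> \<le> M * (2 * ?F)" using M bsum f'_sum by (intro mult_left_mono) auto
    finally show ?thesis by simp
  qed
  have "{n \<in> B. 2 * \<tau> < norm (conv_on K A f n)} \<subseteq> ?G \<union> E \<union> ?H"
  proof
    fix n assume "n \<in> {n \<in> B. 2 * \<tau> < norm (conv_on K A f n)}"
    then show "n \<in> ?G \<union> E \<union> ?H"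
      using norm_triangle_ineq[of "conv_on K S g n" "conv_on K S b n"] by (auto simp: split)
  qed
  then have "card {n \<in> B. 2 * \<tau> < norm (conv_on K A f n)} \<le> card (?G \<union> E \<union> ?H)"
    using B E by (intro card_mono) auto
  also have "\<dots> \<le> card ?G + card E + card ?H"
    by (meson add_le_mono1 card_Un_le le_trans)
  finally have "\<tau> * real (card {n \<in> B. 2 * \<tau> < norm (conv_on K A f n)})
      \<le> \<tau> * (real (card ?G) + real (card E) + real (card ?H))"
    using \<tau> by (intro mult_left_mono) auto
  then show ?thesis using good bad E by (simp add: algebra_simps)
qed

text \<open>A geometric sum over dyadic levels is dominated by its largest term.\<close>

lemma sum_dyadic_powers_le:
  fixes J :: "int set"
  assumes J: "finite J" and q: "0 < q" and a: "\<And>j. j \<in> J \<Longrightarrow> 2 powr real_of_int j \<le> a"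
  shows "(\<Sum>j\<in>J. 2 powr (q * real_of_int j)) \<le> a powr q / (1 - 2 powr (- q))"
proof (cases "J = {}")
  case True
  have "2 powr (- q) < 1" using powr_less_mono[of "- q" 0 2] q by simp
  then show ?thesis using True by simp
next
  case False
  define t where "t = Max J"
  have t: "t \<in> J" "\<And>j. j \<in> J \<Longrightarrow> j \<le> t" using J False by (auto simp: t_def)
  let ?x = "2 powr (- q)"
  have x: "0 < ?x" "?x < 1" using powr_less_mono[of "- q" 0 2] q by simp_all
  have "(\<Sum>j\<in>J. 2 powr (q * real_of_int j)) = (\<Sum>i\<in>(\<lambda>j. nat (t - j)) ` J. 2 powr (q * t) * ?x ^ i)"
  proof (subst sum.reindex)
    show "inj_on (\<lambda>j. nat (t - j)) J"
    proof (rule inj_onI)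
      fix i j assume "i \<in> J" "j \<in> J" "nat (t - i) = nat (t - j)"
      then show "i = j" using t(2)[of i] t(2)[of j] by simp
    qed
    have "2 powr (q * real_of_int j) = 2 powr (q * t) * ?x ^ nat (t - j)" if "j \<in> J" for j
    proof -
      have "?x ^ nat (t - j) = 2 powr (- q * real (nat (t - j)))" 
        by (simp add: powr_powr flip: powr_realpow)
      then show ?thesis using t(2)[OF that] by (simp add: algebra_simps flip: powr_add)
    qed
    then show "(\<Sum>j\<in>J. 2 powr (q * real_of_int j)) = sum ((\<lambda>i. 2 powr (q * t) * ?x ^ i) \<circ> (\<lambda>j. nat (t - j))) J"
      by simp
  qed
  also have "\<dots> = 2 powr (q * t) * (\<Sum>i\<in>(\<lambda>j. nat (t - j)) ` J. ?x ^ i)" by (simp add: sum_distrib_left)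
  also have "\<dots> \<le> 2 powr (q * t) * (\<Sum>i. ?x ^ i)"
    using x J by (intro mult_left_mono sum_le_suminf summable_geometric) auto
  also have "(\<Sum>i. ?x ^ i) = 1 / (1 - ?x)" using x by (intro suminf_geometric) auto
  also have "2 powr (q * t) = (2 powr t) powr q" by (simp add: powr_powr mult.commute)
  also have "\<dots> * (1 / (1 - ?x)) \<le> a powr q * (1 / (1 - ?x))"
    using x q a[OF t(1)] by (intro mult_right_mono powr_mono2) auto
  finally show ?thesis by simp
qed

text \<open>Marcinkiewicz interpolation, with the layers of the output taken at the dyadic heights
\<open>P j = 2 powr j\<close>. At height \<open>P j\<close> the values of \<open>f\<close> above \<open>P j\<close> are treated by the
weak type estimate (\<open>U j\<close>) and the others by the \<open>\<ell>\<^sup>2\<close> bound (\<open>V j\<close>). Summed over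
\<open>j\<close>, the first series is geometric because \<open>p > 1\<close> and the second because \<open>p < 2\<close>.\<close>

lemma cz_kernel_strong_type_below_2:
  fixes K :: "int ^ 'n::finite \<Rightarrow> complex"
  assumes K: "cz_kernel M K" and p: "1 < p" "p < 2"
  shows "\<exists>C. \<forall>A B f. finite A \<longrightarrow> finite B \<longrightarrow>
     (\<Sum>n\<in>B. norm (conv_on K A f n) powr p) \<le> C * (\<Sum>k\<in>A. norm (f k) powr p)"
proof -
  define W where "W = 2 ^ CARD('n) * M + 8 ^ CARD('n) + 2 * M"
  define C where "C = 2 powr p * (4 * W / (1 - 2 powr (- (p - 1))) + 4 * M / (1 - 2 powr (- (2 - p))))"
  have M: "0 \<le> M" by (rule cz_kernelD(1)[OF K])
  have W: "0 \<le> W" using M by (simp add: W_def)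
  have "(\<Sum>n\<in>B. norm (conv_on K A f n) powr p) \<le> C * (\<Sum>k\<in>A. norm (f k) powr p)"
    if A: "finite A" and B: "finite B" for A B f
  proof -
    define F where "F n = norm (conv_on K A f n)" for n
    \<comment> \<open>The largest integer \<open>j\<close> with \<open>2 powr j < F n\<close>; the inequality is strict, because the
      level sets are.\<close>
    define lv where "lv n = \<lceil>log 2 (F n)\<rceil> - 1" for n
    define J where "J = lv ` {n \<in> B. F n \<noteq> 0}"
    define P where "P j = 2 powr real_of_int j" for j
    have P: "0 < P j" for j by (simp add: P_def)
    have J: "finite J" using B by (simp add: J_def)
    have F0: "0 \<le> F n" for n by (simp add: F_def)
    have lv: "P (lv n) < F n" "F n \<le> 2 * P (lv n)" if "F n \<noteq> 0" for n
    proof -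
      have F: "0 < F n" using that F0[of n] by simp
      have "real_of_int (lv n) < log 2 (F n)" "log 2 (F n) \<le> real_of_int (lv n) + 1"
        unfolding lv_def by linarith+
      then have "2 powr real_of_int (lv n) < 2 powr log 2 (F n)" "2 powr log 2 (F n) \<le> 2 powr (real_of_int (lv n) + 1)"
        by (simp_all only: powr_less_cancel_iff powr_le_cancel_iff one_less_numeral_iff semiring_norm)
      moreover have "2 powr log 2 (F n) = F n" using F by simp
      ultimately show "P (lv n) < F n" "F n \<le> 2 * P (lv n)"
        by (simp_all only: P_def powr_add) simp
    qed
    have layer: "F n powr p \<le> 2 powr p * (\<Sum>j | j \<in> J \<and> P j < F n. P j powr p)" if n: "n \<in> B" for n
    proof (cases "F n = 0")
      case True
      then show ?thesis using P by (simp add: sum_nonneg)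
    next
      case False
      have "F n powr p \<le> (2 * P (lv n)) powr p" using lv[OF False] F0 p by (intro powr_mono2) auto
      also have "\<dots> = 2 powr p * P (lv n) powr p" using P by (simp add: powr_mult less_imp_le)
      also have "P (lv n) powr p \<le> (\<Sum>j | j \<in> J \<and> P j < F n. P j powr p)"
        using J n False lv[OF False] by (intro member_le_sum) (auto simp: J_def)
      finally show ?thesis by simp
    qed
    define U where "U j = (\<Sum>k | k \<in> A \<and> P j < norm (f k). norm (f k))" for j
    define V where "V j = (\<Sum>k | k \<in> A \<and> norm (f k) \<le> P j. (norm (f k))\<^sup>2)" for j
    have count: "P j powr p * real (card {n \<in> B. P j < F n})
        \<le> 4 * W * (P j powr (p - 1) * U j) + 4 * M * (P j powr (- (2 - p)) * V j)" for j
    proof -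
      define A1 where "A1 = {k \<in> A. P j < norm (f k)}"
      define A2 where "A2 = {k \<in> A. norm (f k) \<le> P j}"
      have A12: "finite A1" "finite A2" "A = A1 \<union> A2" "A1 \<inter> A2 = {}" using A by (auto simp: A1_def A2_def)
      have split: "conv_on K A f n = conv_on K A1 f n + conv_on K A2 f n" for n
        unfolding conv_on_def A12(3) by (rule sum.union_disjoint) (use A12 in auto)
      let ?G = "{n \<in> B. P j / 2 < norm (conv_on K A1 f n)}"
      let ?H = "{n \<in> B. P j / 2 < norm (conv_on K A2 f n)}"
      have "{n \<in> B. P j < F n} \<subseteq> ?G \<union> ?H"
      proof
        fix n assume "n \<in> {n \<in> B. P j < F n}"
        then show "n \<in> ?G \<union> ?H"
          using norm_triangle_ineq[of "conv_on K A1 f n" "conv_on K A2 f n"] by (auto simp: split F_def)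
      qed
      then have "card {n \<in> B. P j < F n} \<le> card (?G \<union> ?H)" using B by (intro card_mono) auto
      also have "\<dots> \<le> card ?G + card ?H" by (rule card_Un_le)
      finally have le: "real (card {n \<in> B. P j < F n}) \<le> real (card ?G) + real (card ?H)" by linarith
      have "P j / 4 * real (card {n \<in> B. 2 * (P j / 4) < norm (conv_on K A1 f n)}) \<le> W * U j"
        unfolding W_def U_def A1_def[symmetric] using P[of j] A12 B K by (intro cz_kernel_weak_type) auto
      then have G: "P j * real (card ?G) \<le> 4 * W * U j" by simp
      have "(P j / 2)\<^sup>2 * real (card ?H) \<le> (P j / 2)\<^sup>2 * real (card {n \<in> B. (P j / 2)\<^sup>2 < (norm (conv_on K A2 f n))\<^sup>2})"
        using P[of j] B by (intro mult_left_mono of_nat_mono card_mono) (auto intro!: power_strict_mono)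
      also have "\<dots> \<le> (\<Sum>n\<in>B. (norm (conv_on K A2 f n))\<^sup>2)" by (rule chebyshev_card[OF B]) simp
      also have "\<dots> \<le> M * V j" unfolding V_def A2_def[symmetric] using cz_kernelD(2)[OF K A12(2) B] .
      finally have H: "P j powr 2 * real (card ?H) \<le> 4 * M * V j" using P[of j] by (simp add: power_divide)
      have "P j powr p * real (card {n \<in> B. P j < F n}) \<le> P j powr p * (real (card ?G) + real (card ?H))"
        using le by (intro mult_left_mono) auto
      also have "\<dots> = P j powr (p - 1) * (P j * real (card ?G)) + P j powr (- (2 - p)) * (P j powr 2 * real (card ?H))"
      proof -
        have "P j powr p = P j powr (p - 1) * P j" using P[of j] by (simp add: powr_diff)
        moreover have "P j powr p = P j powr (- (2 - p)) * P j powr 2" by (simp flip: powr_add)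
        ultimately show ?thesis by (simp only: distrib_left mult.assoc[symmetric])
      qed
      also have "\<dots> \<le> P j powr (p - 1) * (4 * W * U j) + P j powr (- (2 - p)) * (4 * M * V j)"
        using G H by (intro add_mono mult_left_mono) auto
      finally show ?thesis by (simp add: algebra_simps)
    qed
    have sumU: "(\<Sum>j\<in>J. P j powr (p - 1) * U j) \<le> (\<Sum>k\<in>A. norm (f k) powr p) / (1 - 2 powr (- (p - 1)))"
    proof -
      have "(\<Sum>j\<in>J. P j powr (p - 1) * U j)
          = (\<Sum>j\<in>J. \<Sum>k | k \<in> A \<and> P j < norm (f k). P j powr (p - 1) * norm (f k))"
        by (simp add: U_def sum_distrib_left)
      also have "\<dots> = (\<Sum>k\<in>A. \<Sum>j | j \<in> J \<and> P j < norm (f k). P j powr (p - 1) * norm (f k))"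
        using J A by (rule sum.swap_restrict)
      also have "\<dots> \<le> (\<Sum>k\<in>A. norm (f k) powr p / (1 - 2 powr (- (p - 1))))"
      proof (rule sum_mono)
        fix k assume "k \<in> A"
        have "(\<Sum>j | j \<in> J \<and> P j < norm (f k). P j powr (p - 1))
            = (\<Sum>j | j \<in> J \<and> P j < norm (f k). 2 powr ((p - 1) * real_of_int j))"
          by (simp add: P_def powr_powr mult.commute)
        also have "\<dots> \<le> norm (f k) powr (p - 1) / (1 - 2 powr (- (p - 1)))"
          using J p by (intro sum_dyadic_powers_le) (auto simp: P_def)
        finally have "(\<Sum>j | j \<in> J \<and> P j < norm (f k). P j powr (p - 1)) * norm (f k)
            \<le> norm (f k) powr (p - 1) / (1 - 2 powr (- (p - 1))) * norm (f k)"
          by (rule mult_right_mono) simp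
        moreover have "norm (f k) powr (p - 1) * norm (f k) = norm (f k) powr p"
          by (cases "f k = 0") (auto simp: powr_diff)
        ultimately show "(\<Sum>j | j \<in> J \<and> P j < norm (f k). P j powr (p - 1) * norm (f k))
            \<le> norm (f k) powr p / (1 - 2 powr (- (p - 1)))"
          by (simp add: sum_distrib_right)
      qed
      finally show ?thesis by (simp add: sum_divide_distrib)
    qed
    have sumV: "(\<Sum>j\<in>J. P j powr (- (2 - p)) * V j) \<le> (\<Sum>k\<in>A. norm (f k) powr p) / (1 - 2 powr (- (2 - p)))"
    proof -
      have "(\<Sum>j\<in>J. P j powr (- (2 - p)) * V j)
          = (\<Sum>j\<in>J. \<Sum>k | k \<in> A \<and> norm (f k) \<le> P j. P j powr (- (2 - p)) * (norm (f k))\<^sup>2)"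
        by (simp add: V_def sum_distrib_left)
      also have "\<dots> = (\<Sum>k\<in>A. \<Sum>j | j \<in> J \<and> norm (f k) \<le> P j. P j powr (- (2 - p)) * (norm (f k))\<^sup>2)"
        using J A by (rule sum.swap_restrict)
      also have "\<dots> \<le> (\<Sum>k\<in>A. norm (f k) powr p / (1 - 2 powr (- (2 - p))))"
      proof (rule sum_mono)
        fix k assume "k \<in> A"
        show "(\<Sum>j | j \<in> J \<and> norm (f k) \<le> P j. P j powr (- (2 - p)) * (norm (f k))\<^sup>2)
            \<le> norm (f k) powr p / (1 - 2 powr (- (2 - p)))"
        proof (cases "f k = 0")
          case False
          let ?J = "{j \<in> J. norm (f k) \<le> P j}"
          have "(\<Sum>j\<in>?J. P j powr (- (2 - p))) = (\<Sum>j\<in>uminus ` ?J. 2 powr ((2 - p) * real_of_int j))"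
            by (subst sum.reindex) (auto simp: P_def powr_powr algebra_simps intro: inj_onI)
          also have "\<dots> \<le> (1 / norm (f k)) powr (2 - p) / (1 - 2 powr (- (2 - p)))"
          proof (intro sum_dyadic_powers_le)
            fix j assume "j \<in> uminus ` ?J"
            then have "norm (f k) \<le> P (- j)" by auto
            then show "2 powr real_of_int j \<le> 1 / norm (f k)"
              using False by (simp add: P_def powr_minus field_simps)
          qed (use J p in auto)
          finally have "(\<Sum>j\<in>?J. P j powr (- (2 - p))) * (norm (f k))\<^sup>2
              \<le> (1 / norm (f k)) powr (2 - p) / (1 - 2 powr (- (2 - p))) * (norm (f k))\<^sup>2"
            by (rule mult_right_mono) simp
          moreover have "(1 / norm (f k)) powr (2 - p) * (norm (f k))\<^sup>2 = norm (f k) powr p"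
          proof -
            have "(1 / norm (f k)) powr (2 - p) = norm (f k) powr (p - 2)"
              using False by (simp add: powr_divide powr_minus_divide[symmetric])
            moreover have "(norm (f k))\<^sup>2 = norm (f k) powr 2" using False by simp
            ultimately show ?thesis by (simp only: powr_add[symmetric]) simp
          qed
          ultimately show ?thesis by (simp add: sum_distrib_right)
        qed simp
      qed
      finally show ?thesis by (simp add: sum_divide_distrib)
    qed
    have "(\<Sum>n\<in>B. F n powr p) \<le> (\<Sum>n\<in>B. 2 powr p * (\<Sum>j | j \<in> J \<and> P j < F n. P j powr p))"
      by (intro sum_mono layer)
    also have "\<dots> = 2 powr p * (\<Sum>n\<in>B. \<Sum>j | j \<in> J \<and> P j < F n. P j powr p)" by (simp add: sum_distrib_left)
    also have "(\<Sum>n\<in>B. \<Sum>j | j \<in> J \<and> P j < F n. P j powr p) = (\<Sum>j\<in>J. \<Sum>n | n \<in> B \<and> P j < F n. P j powr p)"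
      using B J by (rule sum.swap_restrict)
    also have "\<dots> = (\<Sum>j\<in>J. P j powr p * real (card {n \<in> B. P j < F n}))" by (simp add: mult.commute)
    also have "\<dots> \<le> (\<Sum>j\<in>J. 4 * W * (P j powr (p - 1) * U j) + 4 * M * (P j powr (- (2 - p)) * V j))"
      by (intro sum_mono count)
    also have "\<dots> = 4 * W * (\<Sum>j\<in>J. P j powr (p - 1) * U j) + 4 * M * (\<Sum>j\<in>J. P j powr (- (2 - p)) * V j)"
      by (simp add: sum.distrib sum_distrib_left)
    also have "\<dots> \<le> 4 * W * ((\<Sum>k\<in>A. norm (f k) powr p) / (1 - 2 powr (- (p - 1))))
        + 4 * M * ((\<Sum>k\<in>A. norm (f k) powr p) / (1 - 2 powr (- (2 - p))))"
      using M W sumU sumV by (intro add_mono mult_left_mono) auto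
    finally show ?thesis by (simp add: C_def F_def algebra_simps)
  qed
  then show ?thesis by blast
qed

text \<open>The reflected kernel belongs to the transposed operator, which is what duality needs.\<close>

lemma cz_kernel_reflect:
  fixes K :: "int ^ 'n::finite \<Rightarrow> complex"
  assumes "cz_kernel M K" shows "cz_kernel M (\<lambda>n. K (- n))"
  unfolding cz_kernel_def
proof (intro conjI allI impI)
  show "0 \<le> M" using assms by (simp add: cz_kernel_def)
next
  fix A B :: "(int ^ 'n) set" and f assume AB: "finite A" "finite B"
  have "conv_on (\<lambda>n. K (- n)) A f n = conv_on K (uminus ` A) (\<lambda>x. f (- x)) (- n)" for n
    unfolding conv_on_def by (subst sum.reindex) (auto intro!: inj_onI)
  then have "(\<Sum>n\<in>B. (norm (conv_on (\<lambda>n. K (- n)) A f n))\<^sup>2)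
      = (\<Sum>n\<in>uminus ` B. (norm (conv_on K (uminus ` A) (\<lambda>x. f (- x)) n))\<^sup>2)"
    by (subst sum.reindex) (auto intro!: inj_onI)
  also have "\<dots> \<le> M * (\<Sum>k\<in>uminus ` A. (norm (f (- k)))\<^sup>2)"
    using AB by (intro cz_kernelD(2)[OF assms]) auto
  also have "(\<Sum>k\<in>uminus ` A. (norm (f (- k)))\<^sup>2) = (\<Sum>k\<in>A. (norm (f k))\<^sup>2)"
    by (subst sum.reindex) (auto intro!: inj_onI)
  finally show "(\<Sum>n\<in>B. (norm (conv_on (\<lambda>n. K (- n)) A f n))\<^sup>2) \<le> M * (\<Sum>k\<in>A. (norm (f k))\<^sup>2)" .
next
  fix h :: "int ^ 'n" and B :: "(int ^ 'n) set" assume B: "finite B" "\<forall>n\<in>B. 4 * sup_abs h \<le> sup_abs n"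
  have "(\<Sum>n\<in>B. norm (K (- (n - h)) - K (- n))) = (\<Sum>n\<in>uminus ` B. norm (K (n - (- h)) - K n))"
    by (subst sum.reindex) (auto intro!: inj_onI)
  also have "\<dots> \<le> M"
    by (rule cz_kernelD(3)[OF assms]) (use B in auto)
  finally show "(\<Sum>n\<in>B. norm (K (- (n - h)) - K (- n))) \<le> M" .
qed

text \<open>For \<open>p > 2\<close> test the output \<open>F\<close> against \<open>g = |F| powr (p - 2) * cnj F\<close>: this gives the sum
\<open>X\<close> of \<open>|F| powr p\<close>, and \<open>|g| powr q = |F| powr p\<close> for the conjugate exponent
\<open>q\<close>. The transposed operator is bounded for \<open>q < 2\<close>, so Young's inequality with a weight bounds
\<open>X\<close> by a multiple of the sum of \<open>|f| powr p\<close> plus \<open>X / 2\<close>, which is absorbed on the left;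
this is legitimate since \<open>X\<close> is a finite sum.\<close>

lemma cz_kernel_strong_type:
  fixes K :: "int ^ 'n::finite \<Rightarrow> complex"
  assumes K: "cz_kernel M K" and p: "1 < p"
  shows "\<exists>C. \<forall>A B f. finite A \<longrightarrow> finite B \<longrightarrow>
     (\<Sum>n\<in>B. norm (conv_on K A f n) powr p) \<le> C * (\<Sum>k\<in>A. norm (f k) powr p)"
proof -
  consider "p < 2" | "p = 2" | "2 < p" by linarith
  then show ?thesis
  proof cases
    case 1
    then show ?thesis using cz_kernel_strong_type_below_2[OF K p] by simp
  next
    case 2
    have eq: "norm (z :: complex) powr 2 = (norm z)\<^sup>2" for z by (cases "z = 0") auto
    show ?thesis unfolding 2 eq using cz_kernelD(2)[OF K] by blast
  next
    case 3
    define q where "q = p / (p - 1)"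
    have q: "1 < q" "q < 2" "1 / p + 1 / q = 1" using 3 by (auto simp: q_def field_simps)
    obtain C0 where C0: "\<And>A B g. finite A \<Longrightarrow> finite B \<Longrightarrow>
        (\<Sum>n\<in>B. norm (conv_on (\<lambda>n. K (- n)) A g n) powr q) \<le> C0 * (\<Sum>k\<in>A. norm (g k) powr q)"
      using cz_kernel_strong_type_below_2[OF cz_kernel_reflect[OF K] q(1,2)] by blast
    define C1 where "C1 = max C0 1"
    \<comment> \<open>The weight in Young's inequality, chosen so that the second term becomes \<open>X / 2\<close>.\<close>
    define s where "s = (2 * C1) powr (1 / q)"
    have s: "0 < s" "s powr q = 2 * C1" using q by (auto simp: s_def C1_def powr_powr)
    have "(\<Sum>n\<in>B. norm (conv_on K A f n) powr p) \<le> (2 * s powr p) * (\<Sum>k\<in>A. norm (f k) powr p)"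
      if A: "finite A" and B: "finite B" for A B f
    proof -
      define F where "F n = conv_on K A f n" for n
      define g where "g n = of_real (norm (F n) powr (p - 2)) * cnj (F n)" for n
      define G where "G k = conv_on (\<lambda>n. K (- n)) B g k" for k
      define X where "X = (\<Sum>n\<in>B. norm (F n) powr p)"
      have Fg: "F n * g n = of_real (norm (F n) powr p)" for n
      proof (cases "F n = 0")
        case False
        have "F n * g n = of_real (norm (F n) powr (p - 2)) * (F n * cnj (F n))" by (simp add: g_def)
        also have "F n * cnj (F n) = of_real (norm (F n) powr 2)" using False complex_norm_square[of "F n"] by simp
        finally show ?thesis by (simp only: of_real_mult[symmetric] powr_add[symmetric]) simp
      qed (simp add: g_def)
      have gq: "norm (g n) powr q = norm (F n) powr p" for n
      proof (cases "F n = 0")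
        case False
        have "norm (g n) = norm (F n) powr (p - 2) * norm (F n) powr 1" using False by (simp add: g_def norm_mult)
        also have "\<dots> = norm (F n) powr (p - 1)" by (simp only: powr_add[symmetric]) simp
        finally show ?thesis using 3 by (simp add: powr_powr q_def)
      qed (simp add: g_def)
      have "complex_of_real X = (\<Sum>n\<in>B. F n * g n)" by (simp add: X_def Fg)
      also have "\<dots> = (\<Sum>n\<in>B. \<Sum>k\<in>A. f k * (g n * K (n - k)))"
        unfolding F_def conv_on_def sum_distrib_right by (simp add: mult_ac)
      also have "\<dots> = (\<Sum>k\<in>A. f k * G k)"
        by (subst sum.swap) (simp add: G_def conv_on_def sum_distrib_left)
      finally have "\<bar>X\<bar> = norm (\<Sum>k\<in>A. f k * G k)" by (metis norm_of_real)
      also have "\<dots> \<le> (\<Sum>k\<in>A. norm (f k) * norm (G k))" by (rule order_trans[OF norm_sum]) (simp add: norm_mult)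
      also have "\<dots> \<le> (\<Sum>k\<in>A. s powr p * norm (f k) powr p + norm (G k) powr q / (2 * C1))"
      proof (rule sum_mono)
        fix k
        have "norm (f k) * norm (G k) = (s * norm (f k)) * (norm (G k) / s)" using s by simp
        also have "\<dots> \<le> (s * norm (f k)) powr p / p + (norm (G k) / s) powr q / q"
          using p q s by (intro Youngs_inequality) auto
        also have "\<dots> \<le> (s * norm (f k)) powr p / 1 + (norm (G k) / s) powr q / 1"
          using p q by (intro add_mono divide_left_mono) auto
        also have "\<dots> = s powr p * norm (f k) powr p + norm (G k) powr q / (2 * C1)"
          using s by (simp add: powr_mult powr_divide)
        finally show "norm (f k) * norm (G k) \<le> s powr p * norm (f k) powr p + norm (G k) powr q / (2 * C1)" .
      qed
      also have "\<dots> = s powr p * (\<Sum>k\<in>A. norm (f k) powr p) + (\<Sum>k\<in>A. norm (G k) powr q) / (2 * C1)"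
        by (simp add: sum.distrib sum_distrib_left sum_divide_distrib)
      also have "(\<Sum>k\<in>A. norm (G k) powr q) / (2 * C1) \<le> X / 2"
      proof -
        have "(\<Sum>k\<in>A. norm (G k) powr q) \<le> C0 * X"
          unfolding G_def X_def gq[symmetric] by (rule C0[OF B A])
        also have "\<dots> \<le> C1 * X" by (intro mult_right_mono) (auto simp: C1_def X_def sum_nonneg)
        finally show ?thesis by (simp add: C1_def field_simps)
      qed
      finally have "X \<le> s powr p * (\<Sum>k\<in>A. norm (f k) powr p) + X / 2" by simp
      then show ?thesis by (simp add: X_def F_def)
    qed
    then show ?thesis by blast
  qed
qed

section \<open>Fourier coefficients on the torus\<close>


definition character :: "int ^ 'n::finite \<Rightarrow> real ^ 'n \<Rightarrow> complex" where
  "character n \<xi> = cis (2 * pi * (of_int_vec n \<bullet> \<xi>))"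

definition trig_poly :: "(int ^ 'n::finite) set \<Rightarrow> (int ^ 'n \<Rightarrow> complex) \<Rightarrow> real ^ 'n \<Rightarrow> complex" where
  "trig_poly A f \<xi> = (\<Sum>k\<in>A. f k * character k \<xi>)"

text \<open>Bounded Borel functions on the torus. Borel measurability, rather than Lebesgue measurability, allows
one to translate and to pass between \<^const>\<open>lebesgue\<close> and \<^const>\<open>lborel\<close> freely;
boundedness makes everything integrable.\<close>

definition torus_fun :: "(real ^ 'n::finite \<Rightarrow> complex) \<Rightarrow> bool" where
  "torus_fun u \<longleftrightarrow> u \<in> borel_measurable borel \<and> bounded (range u) \<and> periodic1 u"

abbreviation torus :: "(real ^ 'n::finite) measure" where
  "torus \<equiv> lebesgue_on (box 0 1)"

lemma of_int_vec_add: "of_int_vec (n + k) = of_int_vec n + of_int_vec k"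
  and of_int_vec_minus: "of_int_vec (- n) = - of_int_vec n"
  and of_int_vec_0: "of_int_vec 0 = 0"
  and of_int_vec_nth: "of_int_vec n $ i = real_of_int (n $ i)"
  and of_int_vec_axis: "of_int_vec (axis i 1) = axis i 1"
  by (auto simp: of_int_vec_def vec_eq_iff axis_def)

lemma norm_character [simp]: "norm (character n \<xi>) = 1"
  by (simp add: character_def)

lemma character_0 [simp]: "character 0 \<xi> = 1"
  by (simp add: character_def of_int_vec_0)

lemma character_add: "character (n + k) \<xi> = character n \<xi> * character k \<xi>"
  by (simp add: character_def of_int_vec_add inner_add_left distrib_left cis_mult)

lemma cnj_character: "cnj (character n \<xi>) = character (- n) \<xi>"
  by (simp add: character_def of_int_vec_minus cis_cnj)

lemma character_shift: "character n (\<xi> + s *\<^sub>R axis i 1) = cis (2 * pi * (real_of_int (n $ i) * s)) * character n \<xi>"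
  by (simp add: character_def inner_add_right inner_axis of_int_vec_nth cis_mult algebra_simps)

lemma continuous_character [continuous_intros]: "continuous_on S (character n)"
  unfolding character_def cis_conv_exp by (intro continuous_intros)

lemma borel_character [measurable]: "character n \<in> borel_measurable borel"
  by (intro borel_measurable_continuous_onI continuous_character)

lemma inv_fourier_character:
  "inv_fourier u n = (\<integral>\<xi>. u \<xi> * character (- n) \<xi> \<partial>torus)"
  by (simp add: inv_fourier_def character_def of_int_vec_minus inner_commute)

lemma torus_fun_character: "torus_fun (character n)"
  unfolding torus_fun_def periodic1_def
proof (intro conjI allI)
  show "bounded (range (character n))" by (auto simp: bounded_iff intro!: exI[of _ 1])
  show "character n (\<xi> + axis i 1) = character n \<xi>" for \<xi> i
    using character_shift[of n \<xi> 1 i] by (simp add: cis_multiple_2pi mult.commute[of _ "2 * pi"] flip: mult.assoc)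
qed simp

lemma bounded_range_mult:
  fixes u v :: "'a \<Rightarrow> complex"
  assumes "bounded (range u)" "bounded (range v)"
  shows "bounded (range (\<lambda>x. u x * v x))"
proof -
  obtain a b where "\<And>x. norm (u x) \<le> a" "\<And>x. norm (v x) \<le> b"
    using assms unfolding bounded_iff by auto
  then have "norm (u x * v x) \<le> a * b" for x
    unfolding norm_mult by (meson mult_mono norm_ge_zero order_trans)
  then show ?thesis unfolding bounded_iff by auto
qed

lemma torus_fun_mult: "torus_fun u \<Longrightarrow> torus_fun v \<Longrightarrow> torus_fun (\<lambda>x. u x * v x)"
  by (auto simp: torus_fun_def periodic1_def bounded_range_mult)

lemma torus_fun_diff: 
  assumes "torus_fun u" "torus_fun v" shows "torus_fun (\<lambda>x. u x - v x)"
  using assms bounded_minus_comp[of u UNIV v] by (auto simp: torus_fun_def periodic1_def)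

lemma torus_fun_const: "torus_fun (\<lambda>x. c)"
  by (auto simp: torus_fun_def periodic1_def)

lemma torus_fun_cnj: "torus_fun u \<Longrightarrow> torus_fun (\<lambda>x. cnj (u x))"
proof -
  assume u: "torus_fun u"
  have "cnj \<in> borel_measurable borel" by (intro borel_measurable_continuous_onI continuous_intros)
  then have "(\<lambda>x. cnj (u x)) \<in> borel_measurable borel"
    using u unfolding torus_fun_def by (auto intro: measurable_compose)
  then show ?thesis using u by (auto simp: torus_fun_def periodic1_def bounded_iff)
qed

lemma torus_fun_sum:
  assumes "\<And>i. i \<in> I \<Longrightarrow> torus_fun (u i)" shows "torus_fun (\<lambda>x. \<Sum>i\<in>I. u i x)"
  using assms
proof (induction I rule: infinite_finite_induct)
  case (insert i I)
  then have "torus_fun (\<lambda>x. u i x - (0 - (\<Sum>i\<in>I. u i x)))" by (intro torus_fun_diff torus_fun_const) auto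
  then show ?case using insert by simp
qed (auto intro: torus_fun_const)

lemmas torus_fun_intros = torus_fun_mult torus_fun_diff torus_fun_sum torus_fun_cnj torus_fun_character torus_fun_const

lemma torus_fun_translate:
  assumes "torus_fun u" shows "torus_fun (\<lambda>x. u (x + v))"
  unfolding torus_fun_def
proof (intro conjI)
  have [measurable]: "u \<in> borel_measurable borel" using assms by (simp add: torus_fun_def)
  show "(\<lambda>x. u (x + v)) \<in> borel_measurable borel" by measurable
  have "range (\<lambda>x. u (x + v)) \<subseteq> range u" by auto
  then show "bounded (range (\<lambda>x. u (x + v)))" using assms bounded_subset unfolding torus_fun_def by blast
  show "periodic1 (\<lambda>x. u (x + v))"
    using assms unfolding torus_fun_def periodic1_def by (metis add.assoc add.commute)
qed

lemma torus_fun_trig_poly: "torus_fun (trig_poly A f)"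
proof -
  have "torus_fun (\<lambda>\<xi>. \<Sum>k\<in>A. f k * character k \<xi>)" by (intro torus_fun_intros)
  then show ?thesis unfolding trig_poly_def[abs_def] .
qed

lemma finite_measure_torus: "finite_measure (torus :: (real ^ 'n::finite) measure)"
  by (intro finite_measure_lebesgue_on) (simp add: lmeasurable_box)

lemma measure_torus: "measure (torus :: (real ^ 'n::finite) measure) (box 0 1) = 1"
proof -
  have "measure lborel (box 0 (1 :: real ^ 'n)) = (\<Prod>b\<in>Basis. (1 - 0 :: real ^ 'n) \<bullet> b)"
    by (rule measure_lborel_box) (auto simp: Basis_vec_def inner_axis)
  also have "\<dots> = 1" by (intro prod.neutral) (auto simp: Basis_vec_def inner_axis)
  finally show ?thesis by (simp add: measure_restrict_space)
qed

lemma borel_torus: "u \<in> borel_measurable borel \<Longrightarrow> u \<in> borel_measurable torus"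
  by (intro measurable_restrict_space1 measurable_completion) simp

lemma torus_integrable:
  assumes "torus_fun u" shows "integrable torus u"
proof -
  obtain b where "\<And>x. norm (u x) \<le> b" using assms unfolding torus_fun_def bounded_iff by auto
  then show ?thesis using assms
    by (intro finite_measure.integrable_const_bound[OF finite_measure_torus, of _ b] borel_torus) (auto simp: torus_fun_def)
qed

lemma AE_lborel_coordinate: "AE x in lborel. (x :: real ^ 'n::finite) $ i \<noteq> a"
proof (rule AE_I')
  have "negligible {x :: real ^ 'n. x \<bullet> axis i 1 = a}"
    by (rule negligible_standard_hyperplane) (auto simp: Basis_vec_def)
  then have "{x :: real ^ 'n. x $ i = a} \<in> null_sets lebesgue"
    by (simp add: inner_axis negligible_iff_null_sets)
  moreover have "{x :: real ^ 'n. x $ i = a} \<in> sets lborel" by simp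
  ultimately show "{x :: real ^ 'n. x $ i = a} \<in> null_sets lborel"
    by (simp add: null_sets_completion_iff)
qed auto

text \<open>The half-open cube differs from the open one by a null set, and its translates tile space exactly.\<close>

lemma integral_torus:
  fixes F :: "real ^ 'n::finite \<Rightarrow> complex"
  assumes [measurable]: "F \<in> borel_measurable borel"
  shows "(\<integral>x. F x \<partial>torus) = (\<integral>x. indicator {x. \<forall>j. 0 \<le> x $ j \<and> x $ j < 1} x *\<^sub>R F x \<partial>lborel)"
proof -
  have [measurable]: "box 0 (1 :: real ^ 'n) \<in> sets borel" "{x :: real ^ 'n. \<forall>j. 0 \<le> x $ j \<and> x $ j < 1} \<in> sets borel"
    by measurable
  have "(\<integral>x. F x \<partial>torus) = (\<integral>x. indicator (box 0 1) x *\<^sub>R F x \<partial>lebesgue)"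
    by (rule integral_restrict_space) simp
  also have "\<dots> = (\<integral>x. indicator (box 0 1) x *\<^sub>R F x \<partial>lborel)"
    by (rule integral_completion) simp
  also have "\<dots> = (\<integral>x. indicator {x. \<forall>j. 0 \<le> x $ j \<and> x $ j < 1} x *\<^sub>R F x \<partial>lborel)"
  proof (rule integral_cong_AE)
    have "AE x in lborel. \<forall>j. (x :: real ^ 'n) $ j \<noteq> 0"
    proof -
      have "AE x in lborel. \<forall>j\<in>UNIV. (x :: real ^ 'n) $ j \<noteq> 0"
        by (intro AE_finite_allI AE_lborel_coordinate) simp
      then show ?thesis by simp
    qed
    then show "AE x in lborel. indicator (box 0 1) x *\<^sub>R F x
        = indicator {x. \<forall>j. 0 \<le> x $ j \<and> x $ j < 1} x *\<^sub>R F x"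
      by eventually_elim (auto simp: indicator_def mem_box_cart less_le)
  qed simp_all
  finally show ?thesis .
qed

lemma integral_lborel_translate:
  fixes g :: "real ^ 'n::finite \<Rightarrow> complex"
  assumes [measurable]: "g \<in> borel_measurable borel"
  shows "(\<integral>x. g (x + v) \<partial>lborel) = (\<integral>x. g x \<partial>lborel)"
proof -
  have "(\<integral>x. g x \<partial>lborel) = (\<integral>x. g x \<partial>distr lborel borel ((+) v))" by (simp add: lborel_distr_plus)
  also have "\<dots> = (\<integral>x. g (v + x) \<partial>lborel)" by (rule integral_distr) simp_all
  finally show ?thesis by (simp add: add.commute)
qed

text \<open>Translating the cube by \<open>s\<close> along an axis pushes a slab of width \<open>s\<close> out of the unit cube on one
side. By periodicity it contributes the same as the slab that was vacated on the other side.\<close>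

lemma integral_torus_shift:
  fixes F :: "real ^ 'n::finite \<Rightarrow> complex"
  assumes F: "torus_fun F" and s: "0 \<le> s" "s \<le> 1"
  shows "(\<integral>x. F (x + s *\<^sub>R axis i 1) \<partial>torus) = (\<integral>x. F x \<partial>torus)"
proof -
  have [measurable]: "F \<in> borel_measurable borel" using F by (simp add: torus_fun_def)
  obtain b where b: "\<And>x. norm (F x) \<le> b" using F unfolding torus_fun_def bounded_iff by auto
  define slab where "slab l u = {x :: real ^ 'n. l \<le> x $ i \<and> x $ i < u \<and> (\<forall>j. j \<noteq> i \<longrightarrow> 0 \<le> x $ j \<and> x $ j < 1)}" for l u
  have slab [measurable]: "slab l u \<in> sets borel" for l u unfolding slab_def by measurable
  define I where "I l u = (\<integral>x. indicator (slab l u) x *\<^sub>R F x \<partial>lborel)" for l u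
  have int: "integrable lborel (\<lambda>x. indicator (slab l u) x *\<^sub>R F x)" if "0 \<le> l" "u \<le> 2" for l u
  proof (rule integrableI_bounded_set_indicator)
    have "slab l u \<subseteq> cbox 0 (\<chi> j. 2)"
    proof
      fix x assume x: "x \<in> slab l u"
      have "0 \<le> x $ j \<and> x $ j \<le> 2" for j
        using x that by (cases "j = i") (auto simp: slab_def intro: less_imp_le order_trans)
      then show "x \<in> cbox 0 (\<chi> j. 2)" by (simp add: mem_box_cart)
    qed
    then show "emeasure lborel (slab l u) < \<infinity>" by (intro emeasure_bounded_finite bounded_subset[OF bounded_cbox])
  qed (use b in auto)
  have split: "I l u = I l w + I w u" if "0 \<le> l" "l \<le> w" "w \<le> u" "u \<le> 2" for l w u
  proof -
    have "I l w + I w u = (\<integral>x. indicator (slab l w) x *\<^sub>R F x + indicator (slab w u) x *\<^sub>R F x \<partial>lborel)"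
      unfolding I_def using that by (intro Bochner_Integration.integral_add[symmetric] int) auto
    also have "\<dots> = I l u" unfolding I_def
      using that by (intro Bochner_Integration.integral_cong) (auto simp: slab_def indicator_def)
    finally show ?thesis by simp
  qed
  have move: "(\<integral>x. indicator (slab l u) x *\<^sub>R F (x + a *\<^sub>R axis i 1) \<partial>lborel) = I (l + a) (u + a)" for l u a
  proof -
    have "indicator (slab l u) x = (indicator (slab (l + a) (u + a)) (x + a *\<^sub>R axis i 1) :: real)" for x
      by (simp add: slab_def indicator_def axis_def)
    then show ?thesis
      unfolding I_def by (subst integral_lborel_translate[where v = "a *\<^sub>R axis i 1", symmetric]) simp_all
  qed
  have cube: "slab 0 1 = {x. \<forall>j. 0 \<le> x $ j \<and> x $ j < 1}" by (auto simp: slab_def)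
  have "(\<integral>x. F (x + s *\<^sub>R axis i 1) \<partial>torus) = I s (1 + s)"
    using move[of 0 1 s] by (simp add: integral_torus cube)
  also have "\<dots> = I s 1 + I 1 (1 + s)" using s by (intro split) auto
  also have "I 1 (1 + s) = I 0 s"
  proof -
    have "F (x + axis i 1) = F x" for x using F by (simp add: torus_fun_def periodic1_def)
    then show ?thesis using move[of 0 s 1] by (simp add: I_def add.commute)
  qed
  also have "I s 1 + I 0 s = I 0 1" using split[of 0 s 1] s by simp
  also have "\<dots> = (\<integral>x. F x \<partial>torus)" by (simp add: I_def integral_torus cube)
  finally show ?thesis .
qed

lemma inv_fourier_translate:
  fixes s :: real
  assumes u: "torus_fun u" and s: "0 \<le> s" "s \<le> 1"
  shows "inv_fourier (\<lambda>\<xi>. u (\<xi> + s *\<^sub>R axis i 1)) n = cis (2 * pi * (real_of_int (n $ i) * s)) * inv_fourier u n"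
proof -
  let ?F = "\<lambda>\<xi>. u \<xi> * character (- n) \<xi>"
  have "inv_fourier u n = (\<integral>\<xi>. ?F (\<xi> + s *\<^sub>R axis i 1) \<partial>torus)"
    unfolding inv_fourier_character using u s by (intro integral_torus_shift[symmetric] torus_fun_intros)
  also have "\<dots> = (\<integral>\<xi>. cis (- (2 * pi * (real_of_int (n $ i) * s))) * (u (\<xi> + s *\<^sub>R axis i 1) * character (- n) \<xi>) \<partial>torus)"
    by (simp add: character_shift algebra_simps)
  also have "\<dots> = cis (- (2 * pi * (real_of_int (n $ i) * s))) * inv_fourier (\<lambda>\<xi>. u (\<xi> + s *\<^sub>R axis i 1)) n"
    by (simp add: inv_fourier_character)
  finally have "cis (2 * pi * (real_of_int (n $ i) * s)) * inv_fourier u n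
      = (cis (2 * pi * (real_of_int (n $ i) * s)) * cis (- (2 * pi * (real_of_int (n $ i) * s)))) * inv_fourier (\<lambda>\<xi>. u (\<xi> + s *\<^sub>R axis i 1)) n"
    by simp
  then show ?thesis by (simp only: cis_mult) simp
qed

text \<open>If \<open>n\<^sub>i\<close> is nonzero, translating by half a period along the \<open>i\<close>-th axis changes the sign of
the character but not its integral.\<close>

lemma integral_character: "(\<integral>\<xi>. character n \<xi> \<partial>torus) = (if n = 0 then 1 else 0)"
proof (cases "n = 0")
  case True
  then show ?thesis by (simp add: measure_torus)
next
  case False
  then obtain i where i: "n $ i \<noteq> 0" by (auto simp: vec_eq_iff)
  define s where "s = 1 / (2 * \<bar>real_of_int (n $ i)\<bar>)"
  have "1 \<le> \<bar>n $ i\<bar>" using i by linarith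
  then have "1 \<le> \<bar>real_of_int (n $ i)\<bar>" by linarith
  then have s: "0 \<le> s" "s \<le> 1" by (auto simp: s_def divide_le_eq)
  have half: "cis (2 * pi * (real_of_int (n $ i) * s)) = -1"
  proof (cases "0 < n $ i")
    case True
    then show ?thesis by (simp add: s_def)
  next
    case False
    then have "2 * pi * (real_of_int (n $ i) * s) = - pi" using i by (simp add: s_def field_simps)
    then show ?thesis by (simp add: complex_eq_iff)
  qed
  have "character n (\<xi> + s *\<^sub>R axis i 1) = - character n \<xi>" for \<xi>
    unfolding character_shift half by simp
  then have "(\<integral>\<xi>. character n \<xi> \<partial>torus) = - (\<integral>\<xi>. character n \<xi> \<partial>torus)"
    using integral_torus_shift[OF torus_fun_character s, of n i] by simp
  then show ?thesis using False by (simp add: complex_eq_iff)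
qed

lemma inv_fourier_trig_poly:
  assumes "finite A" shows "inv_fourier (trig_poly A f) n = (if n \<in> A then f n else 0)"
proof -
  have "inv_fourier (trig_poly A f) n = (\<integral>\<xi>. (\<Sum>k\<in>A. f k * character (k - n) \<xi>) \<partial>torus)"
    by (simp add: inv_fourier_character trig_poly_def sum_distrib_right mult.assoc flip: character_add)
  also have "\<dots> = (\<Sum>k\<in>A. f k * (\<integral>\<xi>. character (k - n) \<xi> \<partial>torus))"
    by (subst Bochner_Integration.integral_sum) (auto intro!: torus_integrable torus_fun_intros)
  also have "\<dots> = (\<Sum>k\<in>A. if k = n then f k else 0)"
    by (intro sum.cong) (auto simp: integral_character)
  finally show ?thesis using assms by simp
qed

lemma inv_fourier_mult_character:
  "inv_fourier (\<lambda>\<xi>. character k \<xi> * u \<xi>) n = inv_fourier u (n - k)"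
proof -
  have "character k \<xi> * u \<xi> * character (- n) \<xi> = u \<xi> * character (- (n - k)) \<xi>" for \<xi>
  proof -
    have "character (- (n - k)) \<xi> = character k \<xi> * character (- n) \<xi>"
      using character_add[of k "- n" \<xi>] by simp
    then show ?thesis by simp
  qed
  then show ?thesis by (simp only: inv_fourier_character)
qed

lemma inv_fourier_diff:
  assumes "torus_fun u" "torus_fun v"
  shows "inv_fourier (\<lambda>\<xi>. u \<xi> - v \<xi>) n = inv_fourier u n - inv_fourier v n"
  unfolding inv_fourier_character left_diff_distrib
  using assms by (intro Bochner_Integration.integral_diff torus_integrable torus_fun_intros)

lemma integral_inner_trig_poly:
  assumes u: "torus_fun u"
  shows "(\<integral>\<xi>. u \<xi> * cnj (trig_poly A f \<xi>) \<partial>torus) = (\<Sum>k\<in>A. cnj (f k) * inv_fourier u k)"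
proof -
  have "(\<integral>\<xi>. u \<xi> * cnj (trig_poly A f \<xi>) \<partial>torus)
      = (\<integral>\<xi>. (\<Sum>k\<in>A. cnj (f k) * (u \<xi> * character (- k) \<xi>)) \<partial>torus)"
    by (simp add: trig_poly_def cnj_character sum_distrib_left algebra_simps)
  also have "\<dots> = (\<Sum>k\<in>A. cnj (f k) * (\<integral>\<xi>. u \<xi> * character (- k) \<xi> \<partial>torus))"
    using u by (subst Bochner_Integration.integral_sum) (auto intro!: torus_integrable torus_fun_intros)
  finally show ?thesis by (simp add: inv_fourier_character)
qed

lemma torus_fun_norm2: "torus_fun u \<Longrightarrow> torus_fun (\<lambda>\<xi>. complex_of_real ((norm (u \<xi>))\<^sup>2))"
  unfolding complex_norm_square by (intro torus_fun_intros)

lemma torus_norm2_integrable: 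
  assumes "torus_fun u" shows "integrable torus (\<lambda>\<xi>. (norm (u \<xi>))\<^sup>2)"
  using torus_integrable[OF torus_fun_norm2[OF assms]] by (simp only: complex_of_real_integrable_eq)

lemma trig_poly_norm:
  assumes "finite A"
  shows "(\<integral>\<xi>. (norm (trig_poly A f \<xi>))\<^sup>2 \<partial>torus) = (\<Sum>k\<in>A. (norm (f k))\<^sup>2)"
proof -
  have "complex_of_real (\<integral>\<xi>. (norm (trig_poly A f \<xi>))\<^sup>2 \<partial>torus)
      = (\<integral>\<xi>. trig_poly A f \<xi> * cnj (trig_poly A f \<xi>) \<partial>torus)"
    by (simp only: complex_norm_square flip: integral_complex_of_real)
  also have "\<dots> = (\<Sum>k\<in>A. cnj (f k) * f k)"
    using assms by (simp add: integral_inner_trig_poly torus_fun_trig_poly inv_fourier_trig_poly)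
  also have "\<dots> = complex_of_real (\<Sum>k\<in>A. (norm (f k))\<^sup>2)"
    unfolding of_real_sum complex_norm_square by (simp only: mult.commute)
  finally show ?thesis by (simp only: of_real_eq_iff)
qed

text \<open>Expand the square of the distance from \<open>u\<close> to the partial sum of its Fourier series.\<close>

lemma bessel_inequality:
  assumes B: "finite B" and u: "torus_fun u"
  shows "(\<Sum>n\<in>B. (norm (inv_fourier u n))\<^sup>2) \<le> (\<integral>\<xi>. (norm (u \<xi>))\<^sup>2 \<partial>torus)"
proof -
  let ?S = "trig_poly B (inv_fourier u)"
  let ?b = "\<Sum>n\<in>B. (norm (inv_fourier u n))\<^sup>2"
  have ints: "integrable torus (\<lambda>\<xi>. (norm (u \<xi>))\<^sup>2)" "integrable torus (\<lambda>\<xi>. (norm (?S \<xi>))\<^sup>2)"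
    "integrable torus (\<lambda>\<xi>. u \<xi> * cnj (?S \<xi>))"
    using u by (auto intro!: torus_integrable torus_norm2_integrable torus_fun_intros torus_fun_trig_poly)
  have eq: "(norm (u \<xi> - ?S \<xi>))\<^sup>2 = (norm (u \<xi>))\<^sup>2 - 2 * Re (u \<xi> * cnj (?S \<xi>)) + (norm (?S \<xi>))\<^sup>2" for \<xi>
    unfolding cmod_power2 by (simp add: power2_eq_square algebra_simps)
  have "0 \<le> (\<integral>\<xi>. (norm (u \<xi> - ?S \<xi>))\<^sup>2 \<partial>torus)" by simp
  also have "\<dots> = (\<integral>\<xi>. (norm (u \<xi>))\<^sup>2 \<partial>torus) - 2 * Re (\<integral>\<xi>. u \<xi> * cnj (?S \<xi>) \<partial>torus) + (\<integral>\<xi>. (norm (?S \<xi>))\<^sup>2 \<partial>torus)"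
  proof -
    have "integrable torus (\<lambda>\<xi>. 2 * Re (u \<xi> * cnj (?S \<xi>)))"
      using integrable_Re[OF ints(3)] by (rule integrable_mult_right)
    then show ?thesis
      unfolding eq using ints
      by (simp only: Bochner_Integration.integral_add Bochner_Integration.integral_diff
          Bochner_Integration.integrable_diff integral_mult_right_zero integral_Re)
  qed
  also have "(\<integral>\<xi>. u \<xi> * cnj (?S \<xi>) \<partial>torus) = complex_of_real ?b"
    unfolding integral_inner_trig_poly[OF u] of_real_sum complex_norm_square by (simp only: mult.commute)
  also have "(\<integral>\<xi>. (norm (?S \<xi>))\<^sup>2 \<partial>torus) = ?b" using B by (rule trig_poly_norm)
  finally show ?thesis by simp
qed

section \<open>Iterated differences of the multiplier\<close>


primrec step_diff :: "nat \<Rightarrow> real ^ 'n::finite \<Rightarrow> (real ^ 'n \<Rightarrow> complex) \<Rightarrow> real ^ 'n \<Rightarrow> complex" where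
  "step_diff 0 v u = u"
| "step_diff (Suc r) v u = step_diff r v (\<lambda>\<xi>. u (\<xi> + v) - u \<xi>)"

lemma torus_fun_step_diff: "torus_fun u \<Longrightarrow> torus_fun (step_diff r v u)"
  by (induction r arbitrary: u) (auto intro: torus_fun_diff torus_fun_translate)

text \<open>A translation multiplies Fourier coefficients by a phase, so differences play the role of integration
by parts.\<close>

lemma inv_fourier_step_diff:
  fixes t :: real
  assumes "torus_fun u" and "0 \<le> t" "t \<le> 1"
  shows "inv_fourier (step_diff r (t *\<^sub>R axis i 1) u) n = (cis (2 * pi * (real_of_int (n $ i) * t)) - 1) ^ r * inv_fourier u n"
  using assms(1)
proof (induction r arbitrary: u)
  case (Suc r)
  have "torus_fun (\<lambda>\<xi>. u (\<xi> + t *\<^sub>R axis i 1) - u \<xi>)"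
    using Suc.prems by (intro torus_fun_diff torus_fun_translate)
  from Suc.IH[OF this] show ?case
    using Suc.prems assms(2,3) by (simp add: inv_fourier_diff inv_fourier_translate torus_fun_translate algebra_simps)
qed simp

lemma has_vector_derivative_shift_arg:
  fixes f :: "real \<Rightarrow> 'a::real_normed_vector"
  assumes "(f has_vector_derivative D) (at (s + a))"
  shows "((\<lambda>s. f (s + a)) has_vector_derivative D) (at s)"
proof -
  have "((\<lambda>s. s + a) has_vector_derivative 1) (at s)"
    by (auto intro!: derivative_eq_intros)
  from vector_diff_chain_at[OF this, of f D] assms show ?thesis by (simp add: o_def)
qed

text \<open>An \<open>r\<close>-fold difference is controlled by the \<open>r\<close>-th derivative through \<open>r\<close> applications of the
mean value inequality. The family \<open>U\<close> collects the successive derivatives in the direction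
\<open>v\<close>; the induction replaces it by the family of its differences.\<close>

lemma step_diff_le_derivative:
  fixes U :: "nat \<Rightarrow> real ^ 'n::finite \<Rightarrow> complex"
  assumes t: "0 \<le> t"
    and deriv: "\<And>k s. k < r \<Longrightarrow> 0 \<le> s \<Longrightarrow> s \<le> real r * t \<Longrightarrow>
      ((\<lambda>s. U k (\<xi> + s *\<^sub>R v)) has_vector_derivative U (Suc k) (\<xi> + s *\<^sub>R v)) (at s)"
    and bound: "\<And>s. 0 \<le> s \<Longrightarrow> s \<le> real r * t \<Longrightarrow> norm (U r (\<xi> + s *\<^sub>R v)) \<le> M"
  shows "norm (step_diff r (t *\<^sub>R v) (U 0) \<xi>) \<le> M * t ^ r"
  using deriv bound
proof (induction r arbitrary: U M)
  case 0
  then show ?case using "0.prems"(2)[of 0] by simp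
next
  case (Suc r)
  define U' where "U' k \<xi> = U k (\<xi> + t *\<^sub>R v) - U k \<xi>" for k \<xi>
  have "norm (step_diff r (t *\<^sub>R v) (U' 0) \<xi>) \<le> (M * t) * t ^ r"
  proof (rule Suc.IH)
    fix k s assume k: "k < r" and s: "0 \<le> s" "s \<le> real r * t"
    have s': "s \<le> real (Suc r) * t" "0 \<le> s + t" "s + t \<le> real (Suc r) * t"
      using s t by (simp_all add: algebra_simps)
    have "((\<lambda>s. U k (\<xi> + (s + t) *\<^sub>R v)) has_vector_derivative U (Suc k) (\<xi> + (s + t) *\<^sub>R v)) (at s)"
      using k s' by (intro has_vector_derivative_shift_arg[of "\<lambda>s. U k (\<xi> + s *\<^sub>R v)"] Suc.prems(1)) auto
    then show "((\<lambda>s. U' k (\<xi> + s *\<^sub>R v)) has_vector_derivative U' (Suc k) (\<xi> + s *\<^sub>R v)) (at s)"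
      using Suc.prems(1)[of k s] k s(1) s' unfolding U'_def
      by (auto simp: algebra_simps intro!: has_vector_derivative_diff)
  next
    fix s assume s: "0 \<le> s" "s \<le> real r * t"
    have "norm (U r (\<xi> + (s + t) *\<^sub>R v) - U r (\<xi> + s *\<^sub>R v)) \<le> M * norm ((s + t) - s)"
    proof (rule differentiable_bound[of "{s..s + t}" "\<lambda>s. U r (\<xi> + s *\<^sub>R v)" "\<lambda>x h. h *\<^sub>R U (Suc r) (\<xi> + x *\<^sub>R v)"])
      fix x assume x: "x \<in> {s..s + t}"
      then have x': "0 \<le> x" "x \<le> real (Suc r) * t" using s by (auto simp: algebra_simps)
      show "((\<lambda>s. U r (\<xi> + s *\<^sub>R v)) has_derivative (\<lambda>h. h *\<^sub>R U (Suc r) (\<xi> + x *\<^sub>R v))) (at x within {s..s + t})"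
        using Suc.prems(1)[of r x] x' by (auto simp: has_vector_derivative_def intro: has_derivative_at_withinI)
      show "onorm (\<lambda>h. h *\<^sub>R U (Suc r) (\<xi> + x *\<^sub>R v)) \<le> M"
        using Suc.prems(2)[OF x'] by (intro onorm_le) (simp add: mult.commute[of M] mult_left_mono)
    qed (use t in auto)
    then show "norm (U' r (\<xi> + s *\<^sub>R v)) \<le> M * t"
      using t by (simp add: U'_def algebra_simps)
  qed
  then show ?case by (simp add: U'_def[abs_def] mult.assoc)
qed

lemma step_diff_le_sup:
  assumes "\<And>x. norm (u x) \<le> b"
  shows "norm (step_diff r v u \<xi>) \<le> 2 ^ r * b"
  using assms
proof (induction r arbitrary: u b)
  case (Suc r)
  have "norm (u (x + v) - u x) \<le> 2 * b" for x
    using norm_triangle_ineq4[of "u (x + v)" "u x"] Suc.prems[of x] Suc.prems[of "x + v"] by linarith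
  from Suc.IH[of "\<lambda>x. u (x + v) - u x", OF this] show ?case by simp
qed simp

lemma class_C_funpow:
  "class_C (j + k) S f \<Longrightarrow> class_C j S ((coord_deriv i ^^ k) f)"
proof (induction k arbitrary: f)
  case (Suc k)
  then have "class_C (j + k) S (coord_deriv i f)" by simp
  from Suc.IH[OF this] show ?case by (simp add: funpow_swap1)
qed simp

lemma coord_line_derivative:
  assumes "coord_differentiable i g (\<xi> + s *\<^sub>R axis i 1)"
  shows "((\<lambda>s. g (\<xi> + s *\<^sub>R axis i 1)) has_vector_derivative coord_deriv i g (\<xi> + s *\<^sub>R axis i 1)) (at s)"
proof -
  let ?x = "\<xi> + s *\<^sub>R axis i 1"
  have "((\<lambda>t. g (?x + t *\<^sub>R axis i 1)) has_vector_derivative coord_deriv i g ?x) (at (s + (- s)))"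
    using assms unfolding coord_differentiable_def coord_deriv_def by (simp add: vector_derivative_works)
  from has_vector_derivative_shift_arg[OF this] show ?thesis by (simp add: algebra_simps)
qed

text \<open>Change one coordinate at a time: on a closed ball the partial derivatives are bounded, so each change
costs at most a multiple of its length, and \<open>f\<close> is locally Lipschitz.\<close>

lemma continuous_on_of_continuous_partials:
  fixes f :: "real ^ 'n::finite \<Rightarrow> complex"
  assumes S: "open S" and diff: "\<And>i x. x \<in> S \<Longrightarrow> coord_differentiable i f x"
    and cont: "\<And>i. continuous_on S (coord_deriv i f)"
  shows "continuous_on S f"
proof (rule continuous_at_imp_continuous_on, intro ballI)
  fix x assume "x \<in> S"
  then obtain e where e: "0 < e" "cball x e \<subseteq> S" using S open_contains_cball by blast
  have "compact (coord_deriv i f ` cball x e)" for i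
    using cont e by (intro compact_continuous_image compact_cball) (auto intro: continuous_on_subset)
  then have "bounded (\<Union>i\<in>UNIV. coord_deriv i f ` cball x e)" by (intro bounded_UN) (auto intro: compact_imp_bounded)
  then obtain M where M: "\<And>i y. y \<in> cball x e \<Longrightarrow> norm (coord_deriv i f y) \<le> M"
    unfolding bounded_iff by blast
  have M0: "0 \<le> M" using M[of x] e norm_ge_zero order_trans by (metis centre_in_cball less_imp_le)
  have lip: "norm (f (x + h) - f x) \<le> M * (\<Sum>j\<in>J. \<bar>h $ j\<bar>)"
    if "finite J" "\<And>j. j \<notin> J \<Longrightarrow> h $ j = 0" "norm h \<le> e" for J h
    using that
  proof (induction J arbitrary: h)
    case empty
    then have "h = 0" by (simp add: vec_eq_iff)
    then show ?case by simp
  next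
    case (insert j J)
    define h' where "h' = h - (h $ j) *\<^sub>R axis j 1"
    have h'_nth: "h' $ l = (if l = j then 0 else h $ l)" for l by (simp add: h'_def axis_def)
    have inside: "x + h' + s *\<^sub>R axis j 1 \<in> cball x e" if "\<bar>s\<bar> \<le> \<bar>h $ j\<bar>" for s
    proof -
      have "norm (h' + s *\<^sub>R axis j 1) \<le> norm h"
        using that by (intro norm_le_componentwise_cart) (auto simp: h'_nth axis_def)
      moreover have "dist x (x + v) = norm v" for v by (simp add: dist_norm)
      ultimately show ?thesis using insert.prems(2) by (simp only: mem_cball add.assoc)
    qed
    have "norm h' \<le> norm h" by (intro norm_le_componentwise_cart) (auto simp: h'_nth)
    then have IH: "norm (f (x + h') - f x) \<le> M * (\<Sum>j\<in>J. \<bar>h' $ j\<bar>)"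
      using insert.prems by (intro insert.IH) (auto simp: h'_nth)
    have seg: "\<bar>s\<bar> \<le> \<bar>h $ j\<bar>" if "s \<in> closed_segment 0 (h $ j)" for s
      using that by (auto simp: closed_segment_eq_real_ivl split: if_splits)
    have "norm (f (x + h' + (h $ j) *\<^sub>R axis j 1) - f (x + h' + 0 *\<^sub>R axis j 1)) \<le> M * norm (h $ j - 0)"
    proof (rule differentiable_bound[of "closed_segment 0 (h $ j)" "\<lambda>s. f (x + h' + s *\<^sub>R axis j 1)"
          "\<lambda>s y. y *\<^sub>R coord_deriv j f (x + h' + s *\<^sub>R axis j 1)"])
      fix s assume "s \<in> closed_segment 0 (h $ j)"
      then have s: "x + h' + s *\<^sub>R axis j 1 \<in> cball x e" by (intro inside seg)
      then have "coord_differentiable j f (x + h' + s *\<^sub>R axis j 1)" using diff e by blast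
      from coord_line_derivative[OF this]
      show "((\<lambda>s. f (x + h' + s *\<^sub>R axis j 1)) has_derivative (\<lambda>y. y *\<^sub>R coord_deriv j f (x + h' + s *\<^sub>R axis j 1)))
          (at s within closed_segment 0 (h $ j))"
        by (auto simp: has_vector_derivative_def intro: has_derivative_at_withinI)
      show "onorm (\<lambda>y. y *\<^sub>R coord_deriv j f (x + h' + s *\<^sub>R axis j 1)) \<le> M"
        using M[OF s] by (intro onorm_le) (simp add: mult.commute[of M] mult_left_mono)
    qed auto
    moreover have "x + h' + (h $ j) *\<^sub>R axis j 1 = x + h" by (simp add: h'_def)
    ultimately have "norm (f (x + h) - f (x + h')) \<le> M * \<bar>h $ j\<bar>" by simp
    moreover have "norm (f (x + h) - f x) \<le> norm (f (x + h) - f (x + h')) + norm (f (x + h') - f x)"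
      by (metis diff_add_cancel add_diff_eq norm_triangle_ineq)
    moreover have "(\<Sum>j\<in>J. \<bar>h' $ j\<bar>) = (\<Sum>j\<in>J. \<bar>h $ j\<bar>)"
      using insert.hyps by (intro sum.cong) (auto simp: h'_nth)
    ultimately show ?case using IH insert.hyps by (simp add: distrib_left)
  qed
  have near: "norm (f y - f x) \<le> M * (\<Sum>j\<in>UNIV. \<bar>(y - x) $ j\<bar>)" if "y \<in> cball x e" for y
    using lip[of UNIV "y - x"] that by (simp add: dist_norm norm_minus_commute)
  have "((\<lambda>y. M * (\<Sum>j\<in>UNIV. \<bar>(y - x) $ j\<bar>)) \<longlongrightarrow> M * (\<Sum>j\<in>UNIV. \<bar>(x - x) $ j\<bar>)) (at x)"
    by (intro tendsto_intros)
  then have lim: "((\<lambda>y. M * (\<Sum>j\<in>UNIV. \<bar>(y - x) $ j\<bar>)) \<longlongrightarrow> 0) (at x)" by simp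
  have "eventually (\<lambda>y. y \<in> cball x e) (at x)"
    using e by (auto simp: eventually_at dist_commute intro!: exI[of _ e])
  then have ev: "eventually (\<lambda>y. norm (f y - f x) \<le> M * (\<Sum>j\<in>UNIV. \<bar>(y - x) $ j\<bar>)) (at x)"
    by eventually_elim (rule near)
  from Lim_null_comparison[OF ev lim] show "isCont f x" by (simp add: isCont_def LIM_zero_iff)
qed

text \<open>The definition of \<^const>\<open>class_C\<close> asks for continuity of the derivatives of top order only.
Continuity of the function itself is what makes the multiplier measurable.\<close>

lemma class_C_imp_continuous_on: "open S \<Longrightarrow> class_C k S f \<Longrightarrow> continuous_on S f"
proof (induction k arbitrary: f)
  case (Suc k)
  show ?case
  proof (rule continuous_on_of_continuous_partials)
    show "open S" by (rule Suc.prems)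
    show "coord_differentiable i f x" if "x \<in> S" for i x using Suc.prems(2) that by simp
    show "continuous_on S (coord_deriv i f)" for i using Suc.IH[OF Suc.prems(1)] Suc.prems(2) by simp
  qed
qed simp

lemma periodic1_coord_deriv: "periodic1 f \<Longrightarrow> periodic1 (coord_deriv i f)"
proof -
  assume "periodic1 f"
  then have "f (x + axis j 1 + t *\<^sub>R axis i 1) = f (x + t *\<^sub>R axis i 1)" for x j t
    unfolding periodic1_def by (metis add.assoc add.commute)
  then show ?thesis unfolding periodic1_def coord_deriv_def by simp
qed

lemma periodic1_funpow_coord_deriv: "periodic1 f \<Longrightarrow> periodic1 ((coord_deriv i ^^ k) f)"
  by (induction k) (auto intro: periodic1_coord_deriv)

lemma multi_deriv_single:
  fixes i :: "'n::finite"
  shows "multi_deriv (\<chi> j. if j = i then k else 0) f = (coord_deriv i ^^ k) f"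
proof -
  have "\<exists>js :: 'n list. distinct js \<and> set js = UNIV" using finite_distinct_list[of "UNIV :: 'n set"] by auto
  then have js: "distinct (coord_list :: 'n list)" "set (coord_list :: 'n list) = UNIV"
    unfolding coord_list_def by (metis (mono_tags, lifting) someI_ex)+
  have "foldr (\<lambda>j. coord_deriv j ^^ (if j = i then k else 0)) js f
      = (if i \<in> set js then (coord_deriv i ^^ k) f else f)" if "distinct js" for js
    using that by (induction js) auto
  then show ?thesis using js by (simp add: multi_deriv_def)
qed

lemma multi_order_single: "multi_order (\<chi> j. if j = i then k else 0) = k"
  by (simp add: multi_order_def)

lemma closed_lattice: "closed (range of_int_vec :: (real ^ 'n::finite) set)"
proof (rule discrete_imp_closed[of 1])
  show "\<forall>x\<in>range of_int_vec. \<forall>y\<in>range of_int_vec. dist y x < 1 \<longrightarrow> y = (x :: real ^ 'n)"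
  proof (intro ballI impI)
    fix x y :: "real ^ 'n" assume "x \<in> range of_int_vec" "y \<in> range of_int_vec" and d: "dist y x < 1"
    then obtain k l where kl: "x = of_int_vec k" "y = of_int_vec l" by auto
    have "l $ i = k $ i" for i
    proof -
      have "\<bar>(y - x) $ i\<bar> < 1" using d component_le_norm_cart[of "y - x" i] by (simp add: dist_norm)
      then show ?thesis by (simp add: kl of_int_vec_nth)
    qed
    then show "y = x" by (simp add: kl vec_eq_iff of_int_vec_nth)
  qed
qed simp

text \<open>The segment on which a difference is formed may leave the cube through the face where the \<open>i\<close>-th
coordinate is \<open>1/2\<close>. Beyond the face, periodicity moves the point back into the cube, to a place
whose distance from the origin is at least \<open>1/4\<close>, hence comparable to 1; on the face itself the
bound follows by continuity.\<close>

lemma derivative_bound_near_cube: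
  fixes g :: "real ^ 'n::finite \<Rightarrow> complex" and r :: nat
  assumes cont: "continuous_on (- range of_int_vec) g" and per: "periodic1 g" and c: "0 \<le> c"
    and bound: "\<And>\<xi>. (\<forall>j. \<bar>\<xi> $ j\<bar> < 1/2) \<Longrightarrow> \<xi> \<noteq> 0 \<Longrightarrow> norm (g \<xi>) * norm \<xi> ^ r \<le> c"
    and eta: "\<And>j. \<bar>\<eta> $ j\<bar> < 1/2" and eta0: "\<eta> \<noteq> 0"
    and s: "0 \<le> s" "s \<le> 1/4" "s \<le> norm \<eta> / 2"
  shows "\<eta> + s *\<^sub>R axis i 1 \<notin> range of_int_vec"
    and "norm (g (\<eta> + s *\<^sub>R axis i 1)) * norm \<eta> ^ r \<le> c * (4 * real CARD('n)) ^ r"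
proof -
  let ?d = "real CARD('n)"
  have d: "1 \<le> ?d" by (simp add: Suc_leI)
  define \<theta> where "\<theta> = \<eta> + s *\<^sub>R axis i 1"
  have th_nth: "\<theta> $ j = \<eta> $ j + (if j = i then s else 0)" for j by (auto simp: \<theta>_def axis_def)
  have "norm \<eta> \<le> norm \<theta> + norm (s *\<^sub>R axis i (1 :: real))"
    unfolding \<theta>_def by (metis add_diff_cancel_right' norm_triangle_ineq4)
  then have th_norm: "norm \<eta> \<le> 2 * norm \<theta>" using s by simp
  then have th0: "\<theta> \<noteq> 0" using eta0 by auto
  show notin: "\<eta> + s *\<^sub>R axis i 1 \<notin> range of_int_vec"
  proof
    assume "\<eta> + s *\<^sub>R axis i 1 \<in> range of_int_vec"
    then obtain k where k: "\<theta> = of_int_vec k" by (auto simp: \<theta>_def)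
    have "k $ j = 0" for j
    proof -
      have "\<bar>\<theta> $ j\<bar> < 1" using eta[of j] s by (auto simp: th_nth abs_if split: if_splits)
      then show ?thesis by (simp add: k of_int_vec_nth)
    qed
    then show False using th0 by (simp add: k vec_eq_iff of_int_vec_nth)
  qed
  have pow: "norm \<eta> ^ r \<le> 2 ^ r * norm \<theta> ^ r"
    using th_norm by (metis norm_ge_zero power_mono power_mult_distrib)
  have two_le: "(2::real) ^ r \<le> (4 * ?d) ^ r" using d by (intro power_mono) linarith+
  have main: "norm (g (\<eta> + s *\<^sub>R axis i 1)) * norm \<eta> ^ r \<le> c * (4 * ?d) ^ r" if "norm (g \<theta>) * norm \<theta> ^ r \<le> c"
  proof -
    have "norm (g \<theta>) * norm \<eta> ^ r \<le> norm (g \<theta>) * (2 ^ r * norm \<theta> ^ r)"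
      using pow by (intro mult_left_mono) auto
    also have "\<dots> \<le> 2 ^ r * c" using that by simp
    also have "\<dots> \<le> c * (4 * ?d) ^ r" using two_le c by (simp add: mult.commute mult_left_mono)
    finally show ?thesis by (simp add: \<theta>_def)
  qed
  have cube: "\<bar>\<theta> $ j\<bar> < 1/2" if "j \<noteq> i" for j using eta[of j] that by (simp add: th_nth)
  have th_i: "- 1/2 < \<theta> $ i" using eta[of i] s by (auto simp: th_nth abs_if split: if_splits)
  consider "\<theta> $ i < 1/2" | "\<theta> $ i = 1/2" | "1/2 < \<theta> $ i" by linarith
  then show "norm (g (\<eta> + s *\<^sub>R axis i 1)) * norm \<eta> ^ r \<le> c * (4 * ?d) ^ r"
  proof cases
    case 1
    have "\<bar>\<theta> $ j\<bar> < 1/2" for j using cube[of j] 1 th_i by (cases "j = i") auto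
    then show ?thesis using bound th0 main by blast
  next
    case 2
    have "open (- range of_int_vec :: (real ^ 'n) set)" using closed_lattice by (rule open_Compl)
    then have "isCont g \<theta>" using cont notin by (simp add: continuous_on_eq_continuous_at \<theta>_def)
    moreover have "((\<lambda>x. \<theta> - x *\<^sub>R axis i 1) \<longlongrightarrow> \<theta> - 0 *\<^sub>R axis i 1) (at_right 0)"
      by (intro tendsto_intros)
    ultimately have "((\<lambda>x. g (\<theta> - x *\<^sub>R axis i 1)) \<longlongrightarrow> g \<theta>) (at_right 0)"
      using isCont_tendsto_compose by fastforce
    moreover have "((\<lambda>x. norm (\<theta> - x *\<^sub>R axis i 1) ^ r) \<longlongrightarrow> norm (\<theta> - 0 *\<^sub>R axis i 1) ^ r) (at_right 0)"
      by (intro tendsto_intros)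
    ultimately have lim: "((\<lambda>x. norm (g (\<theta> - x *\<^sub>R axis i 1)) * norm (\<theta> - x *\<^sub>R axis i 1) ^ r) \<longlongrightarrow> norm (g \<theta>) * norm \<theta> ^ r) (at_right 0)"
      by (intro tendsto_mult tendsto_norm) auto
    have "eventually (\<lambda>x :: real. 0 < x \<and> x < 1/4) (at_right 0)"
      by (intro eventually_conj eventually_at_right_less) (auto simp: eventually_at_right_field intro: exI[of _ "1/4"])
    then have "eventually (\<lambda>x. norm (g (\<theta> - x *\<^sub>R axis i 1)) * norm (\<theta> - x *\<^sub>R axis i 1) ^ r \<le> c) (at_right 0)"
    proof eventually_elim
      case (elim x)
      have nth: "(\<theta> - x *\<^sub>R axis i 1) $ j = \<theta> $ j - (if j = i then x else 0)" for j by (simp add: axis_def)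
      have "\<bar>(\<theta> - x *\<^sub>R axis i 1) $ j\<bar> < 1/2" for j
        unfolding nth using cube[of j] 2 elim by (cases "j = i") auto
      moreover have "\<theta> - x *\<^sub>R axis i 1 \<noteq> 0"
      proof
        assume zero: "\<theta> - x *\<^sub>R axis i 1 = 0"
        have "\<theta> $ i - x = (\<theta> - x *\<^sub>R axis i 1) $ i" unfolding nth by simp
        also have "\<dots> = 0" unfolding zero by simp
        finally show False using 2 elim by simp
      qed
      ultimately show ?case by (intro bound) auto
    qed
    then have "norm (g \<theta>) * norm \<theta> ^ r \<le> c"
      using lim by (intro tendsto_upperbound[OF lim]) auto
    then show ?thesis by (rule main)
  next
    case 3
    define \<zeta> where "\<zeta> = \<theta> - axis i 1"
    have z_nth: "\<zeta> $ j = \<theta> $ j - (if j = i then 1 else 0)" for j by (simp add: \<zeta>_def axis_def)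
    have zi: "\<zeta> $ i < - 1/4" "- 1/2 < \<zeta> $ i" using 3 eta[of i] s by (auto simp: z_nth th_nth abs_if split: if_splits)
    have "\<bar>\<zeta> $ j\<bar> < 1/2" for j
    proof (cases "j = i")
      case True then show ?thesis using zi by auto
    next
      case False then show ?thesis using cube[of j] by (simp add: z_nth)
    qed
    moreover have "\<zeta> \<noteq> 0" using zi by auto
    ultimately have b: "norm (g \<zeta>) * norm \<zeta> ^ r \<le> c" by (intro bound) auto
    have "g \<theta> = g \<zeta>" using per unfolding periodic1_def by (metis \<zeta>_def diff_add_cancel)
    moreover have "norm \<eta> \<le> (4 * ?d) * norm \<zeta>"
    proof -
      have "norm \<eta> \<le> (\<Sum>j\<in>UNIV. \<bar>\<eta> $ j\<bar>)" by (rule norm_le_l1_cart)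
      also have "\<dots> \<le> (\<Sum>j\<in>(UNIV :: 'n set). 1)" 
      proof (rule sum_mono)
        fix j show "\<bar>\<eta> $ j\<bar> \<le> 1" using eta[of j] by linarith
      qed
      also have "\<dots> = ?d" by simp
      also have "?d \<le> ?d * (4 * norm \<zeta>)"
      proof -
        have "1/4 \<le> norm \<zeta>" using component_le_norm_cart[of \<zeta> i] zi by linarith
        then show ?thesis using d by simp
      qed
      finally show ?thesis by (simp add: mult_ac)
    qed
    then have "norm \<eta> ^ r \<le> (4 * ?d) ^ r * norm \<zeta> ^ r" by (metis norm_ge_zero power_mono power_mult_distrib)
    ultimately have "norm (g \<theta>) * norm \<eta> ^ r \<le> norm (g \<zeta>) * ((4 * ?d) ^ r * norm \<zeta> ^ r)"
      by (simp add: mult_left_mono)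
    also have "\<dots> = (norm (g \<zeta>) * norm \<zeta> ^ r) * (4 * ?d) ^ r" by simp
    also have "\<dots> \<le> c * (4 * ?d) ^ r" using b d by (intro mult_right_mono) auto
    finally show ?thesis by (simp add: \<theta>_def)
  qed
qed

text \<open>Near the singularity, at distance less than \<open>2 r t\<close>, the difference is bounded because \<open>m\<close> is;
this gives the first summand. Farther away the whole segment from \<open>\<eta>\<close> to \<open>\<eta> + r t e\<^sub>i\<close>
keeps a distance of at least \<open>|\<eta>| / 2\<close> from the origin and the derivative of order \<open>r\<close> takes
over. The weight \<open>(1 + (|\<eta>| / t)\<^sup>2) ^ r\<close> records the decay \<open>(t / |\<eta>|) ^ r\<close> in a form
that covers both regimes.\<close>

lemma step_diff_pointwise_bound:
  fixes m :: "real ^ 'n::finite \<Rightarrow> complex"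
  assumes b: "\<And>x. norm (m x) \<le> b" and per: "periodic1 m" and r: "r = CARD('n) + 1"
    and smooth: "class_C r (- range of_int_vec) m" and c: "0 \<le> c"
    and bound: "\<And>\<xi>. (\<forall>j. \<bar>\<xi> $ j\<bar> < 1/2) \<Longrightarrow> \<xi> \<noteq> 0 \<Longrightarrow> norm ((coord_deriv i ^^ r) m \<xi>) * norm \<xi> ^ r \<le> c"
    and t: "0 < t" "t \<le> 1 / (4 * real r)" and eta: "\<And>j. \<bar>\<eta> $ j\<bar> < 1/2"
  shows "(norm (step_diff r (t *\<^sub>R axis i 1) m \<eta>))\<^sup>2 * (1 + (norm \<eta> / t)\<^sup>2) ^ r
    \<le> (2 ^ r * b)\<^sup>2 * (1 + (2 * real r)\<^sup>2) ^ r + (c * (4 * real CARD('n)) ^ r)\<^sup>2 * 2 ^ r"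
    (is "_ \<le> ?C1 + ?C2")
proof (cases "norm \<eta> < 2 * real r * t")
  case True
  have "norm \<eta> / t \<le> 2 * real r" using True t by (simp add: divide_le_eq)
  then have "(norm \<eta> / t)\<^sup>2 \<le> (2 * real r)\<^sup>2" using t by (intro power_mono) auto
  then have "(1 + (norm \<eta> / t)\<^sup>2) ^ r \<le> (1 + (2 * real r)\<^sup>2) ^ r" by (intro power_mono) auto
  moreover have "(norm (step_diff r (t *\<^sub>R axis i 1) m \<eta>))\<^sup>2 \<le> (2 ^ r * b)\<^sup>2"
    using step_diff_le_sup[OF b] by (intro power_mono) auto
  ultimately have "(norm (step_diff r (t *\<^sub>R axis i 1) m \<eta>))\<^sup>2 * (1 + (norm \<eta> / t)\<^sup>2) ^ r \<le> ?C1"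
    by (intro mult_mono) auto
  moreover have "0 \<le> ?C2" by simp
  ultimately show ?thesis by linarith
next
  case False
  have r1: "1 \<le> real r" using r by simp
  have rt: "real r * t \<le> 1/4" using t r1 by (simp add: field_simps)
  have far: "2 * (real r * t) \<le> norm \<eta>" using False by simp
  have "t \<le> real r * t" using r1 t by simp
  then have t_le: "t \<le> norm \<eta>" "0 < norm \<eta>" using far t by linarith+
  define U where "U k = (coord_deriv i ^^ k) m" for k
  let ?M = "c * (4 * real CARD('n)) ^ r / norm \<eta> ^ r"
  have contU: "continuous_on (- range of_int_vec) (U r)"
    using class_C_funpow[of 0 r _ m i] smooth by (simp add: U_def)
  have perU: "periodic1 (U r)" unfolding U_def using per by (rule periodic1_funpow_coord_deriv)
  have near: "\<eta> + s *\<^sub>R axis i 1 \<notin> range of_int_vec"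
    "norm (U r (\<eta> + s *\<^sub>R axis i 1)) * norm \<eta> ^ r \<le> c * (4 * real CARD('n)) ^ r"
    if s: "0 \<le> s" "s \<le> real r * t" for s
  proof -
    have s': "s \<le> 1/4" "s \<le> norm \<eta> / 2" using s rt far by linarith+
    have e0: "\<eta> \<noteq> 0" using t_le by auto
    show "\<eta> + s *\<^sub>R axis i 1 \<notin> range of_int_vec"
      by (rule derivative_bound_near_cube(1)[OF contU perU c bound[folded U_def] eta e0 s(1) s'])
    show "norm (U r (\<eta> + s *\<^sub>R axis i 1)) * norm \<eta> ^ r \<le> c * (4 * real CARD('n)) ^ r"
      by (rule derivative_bound_near_cube(2)[OF contU perU c bound[folded U_def] eta e0 s(1) s'])
  qed
  have "norm (step_diff r (t *\<^sub>R axis i 1) (U 0) \<eta>) \<le> ?M * t ^ r"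
  proof (rule step_diff_le_derivative)
    fix k s assume k: "k < r" and s: "0 \<le> s" "s \<le> real r * t"
    obtain j where j: "r = Suc j + k" using k less_iff_Suc_add by (metis add.commute add_Suc)
    have "class_C (Suc j) (- range of_int_vec) (U k)"
      unfolding U_def using class_C_funpow[of "Suc j" k] smooth j by simp
    then have "coord_differentiable i (U k) (\<eta> + s *\<^sub>R axis i 1)" using near(1)[OF s] by simp
    from coord_line_derivative[OF this]
    show "((\<lambda>s. U k (\<eta> + s *\<^sub>R axis i 1)) has_vector_derivative U (Suc k) (\<eta> + s *\<^sub>R axis i 1)) (at s)"
      by (simp add: U_def)
  next
    fix s assume s: "0 \<le> s" "s \<le> real r * t"
    show "norm (U r (\<eta> + s *\<^sub>R axis i 1)) \<le> ?M"
      using near(2)[OF s] t_le by (simp add: le_divide_eq)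
  qed (use t in simp)
  then have D: "norm (step_diff r (t *\<^sub>R axis i 1) m \<eta>) \<le> c * (4 * real CARD('n)) ^ r * (t / norm \<eta>) ^ r"
    by (simp add: U_def power_divide)
  have "1 \<le> (norm \<eta> / t)\<^sup>2" using t t_le by simp
  then have "(1 + (norm \<eta> / t)\<^sup>2) ^ r \<le> (2 * (norm \<eta> / t)\<^sup>2) ^ r" by (intro power_mono) auto
  also have "\<dots> = 2 ^ r * ((norm \<eta> / t) ^ r)\<^sup>2" by (simp add: power_mult_distrib power_mult[symmetric] mult.commute)
  finally have "(norm (step_diff r (t *\<^sub>R axis i 1) m \<eta>))\<^sup>2 * (1 + (norm \<eta> / t)\<^sup>2) ^ r
      \<le> (c * (4 * real CARD('n)) ^ r * (t / norm \<eta>) ^ r)\<^sup>2 * (2 ^ r * ((norm \<eta> / t) ^ r)\<^sup>2)"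
    using D by (intro mult_mono power_mono) auto
  also have "\<dots> = (c * (4 * real CARD('n)) ^ r)\<^sup>2 * 2 ^ r * ((t / norm \<eta> * (norm \<eta> / t)) ^ r)\<^sup>2"
    by (simp only: power_mult_distrib mult_ac)
  also have "t / norm \<eta> * (norm \<eta> / t) = 1" using t t_le by simp
  finally have "(norm (step_diff r (t *\<^sub>R axis i 1) m \<eta>))\<^sup>2 * (1 + (norm \<eta> / t)\<^sup>2) ^ r \<le> ?C2" by simp
  moreover have "0 \<le> ?C1" by (intro mult_nonneg_nonneg) auto
  ultimately show ?thesis by linarith
qed

section \<open>Square integrals of functions concentrated near the lattice\<close>

text \<open>The profile against which the decay away from the lattice is measured. Its integral is proportional to
\<open>t\<close>, and the product of \<open>d\<close> such factors dominates \<open>(1 + (|x| / t)\<^sup>2) ^ (- d)\<close>, so that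
integrals in \<open>d\<close> variables reduce to one variable without polar coordinates.\<close>

definition bump :: "real \<Rightarrow> real \<Rightarrow> real" where
  "bump t x = 1 / (1 + (x / t)\<^sup>2)"

lemma bump_pos: "0 < bump t x"
  unfolding bump_def by (simp add: add_pos_nonneg)

lemma borel_bump [measurable]: "bump t \<in> borel_measurable borel"
  unfolding bump_def[abs_def] by measurable

lemma nn_integral_bump:
  assumes t: "0 < t"
  shows "(\<integral>\<^sup>+x. ennreal (bump t x) \<partial>lborel) \<le> ennreal (pi * t)"
proof -
  have half: "(\<integral>\<^sup>+x. ennreal (bump t x) * indicator {0..} x \<partial>lborel) = ennreal (t * (pi / 2) - t * arctan (0 / t))"
  proof (rule nn_integral_FTC_atLeast)
    show "DERIV (\<lambda>x. t * arctan (x / t)) x :> bump t x" for x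
      using t by (auto intro!: derivative_eq_intros simp: bump_def divide_inverse)
    have "filterlim (\<lambda>x. x / t) at_top at_top"
      using t by (intro filterlim_at_top_mult_tendsto_pos[of "\<lambda>_. inverse t" "inverse t", unfolded divide_inverse[symmetric]]) (auto simp: divide_inverse filterlim_ident)
    then have "((\<lambda>x. arctan (x / t)) \<longlongrightarrow> pi / 2) at_top"
      using tendsto_arctan_at_top filterlim_compose by blast
    then show "((\<lambda>x. t * arctan (x / t)) \<longlongrightarrow> t * (pi / 2)) at_top" by (intro tendsto_intros)
  qed (auto simp: bump_pos less_imp_le)
  have "(\<integral>\<^sup>+x. ennreal (bump t x) * indicator {..0} x \<partial>lborel)
      = ennreal \<bar>-1\<bar> * (\<integral>\<^sup>+x. ennreal (bump t (0 + (-1) * x)) * indicator {..0} (0 + (-1) * x) \<partial>lborel)"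
    by (rule nn_integral_real_affine) auto
  also have "\<dots> = (\<integral>\<^sup>+x. ennreal (bump t x) * indicator {0..} x \<partial>lborel)"
    by (auto simp: bump_def indicator_def intro!: nn_integral_cong)
  finally have left: "(\<integral>\<^sup>+x. ennreal (bump t x) * indicator {..0} x \<partial>lborel) = ennreal (t * (pi / 2))"
    using half by simp
  have "(\<integral>\<^sup>+x. ennreal (bump t x) \<partial>lborel)
      \<le> (\<integral>\<^sup>+x. ennreal (bump t x) * indicator {..0} x + ennreal (bump t x) * indicator {0..} x \<partial>lborel)"
    by (intro nn_integral_mono) (auto simp: indicator_def)
  also have "\<dots> = ennreal (t * (pi / 2)) + ennreal (t * (pi / 2))"
    using half left by (subst nn_integral_add) auto
  also have "\<dots> = ennreal (pi * t)" using t by (simp add: field_simps flip: ennreal_plus)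
  finally show ?thesis .
qed

lemma nn_integral_bump_pair:
  assumes t: "0 < t"
  shows "(\<integral>\<^sup>+x. ennreal (bump t x + bump t (x - 1)) \<partial>lborel) \<le> ennreal (2 * pi * t)"
proof -
  have "(\<integral>\<^sup>+x. ennreal (bump t x) \<partial>lborel) = ennreal \<bar>1\<bar> * (\<integral>\<^sup>+x. ennreal (bump t (- 1 + 1 * x)) \<partial>lborel)"
    by (rule nn_integral_real_affine) auto
  then have shift: "(\<integral>\<^sup>+x. ennreal (bump t (x - 1)) \<partial>lborel) = (\<integral>\<^sup>+x. ennreal (bump t x) \<partial>lborel)"
    by simp
  have "(\<integral>\<^sup>+x. ennreal (bump t x + bump t (x - 1)) \<partial>lborel)
      = (\<integral>\<^sup>+x. ennreal (bump t x) + ennreal (bump t (x - 1)) \<partial>lborel)"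
    by (intro nn_integral_cong) (simp add: bump_pos less_imp_le)
  also have "\<dots> = (\<integral>\<^sup>+x. ennreal (bump t x) \<partial>lborel) + (\<integral>\<^sup>+x. ennreal (bump t (x - 1)) \<partial>lborel)"
    by (rule nn_integral_add) measurable
  also have "\<dots> \<le> ennreal (pi * t) + ennreal (pi * t)"
    unfolding shift using nn_integral_bump[OF t] by (intro add_mono)
  also have "\<dots> = ennreal (2 * pi * t)" using t by (simp flip: ennreal_plus)
  finally show ?thesis .
qed

lemma nn_integral_prod_bump_pair:
  assumes t: "0 < t"
  shows "(\<integral>\<^sup>+x. (\<Prod>j\<in>UNIV. ennreal (bump t ((x :: real ^ 'n::finite) $ j) + bump t (x $ j - 1))) \<partial>lborel)
    \<le> ennreal ((2 * pi * t) ^ CARD('n))"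
proof -
  let ?f = "\<lambda>y. ennreal (bump t y + bump t (y - 1))"
  have Basis: "(Basis :: (real ^ 'n) set) = range (\<lambda>j. axis j 1)" by (auto simp: Basis_vec_def)
  have inj: "inj (\<lambda>j. axis j (1::real) :: real ^ 'n)" by (auto intro!: injI simp: axis_eq_axis)
  have prod_Basis: "(\<Prod>b\<in>(Basis :: (real ^ 'n) set). ?f (x \<bullet> b)) = (\<Prod>j\<in>UNIV. ?f (x $ j))" for x :: "real ^ 'n"
    unfolding Basis by (subst prod.reindex[OF inj]) (simp add: inner_axis)
  have "(\<integral>\<^sup>+x. (\<Prod>j\<in>UNIV. ?f ((x :: real ^ 'n) $ j)) \<partial>lborel)
      = (\<integral>\<^sup>+x. (\<Prod>b\<in>(Basis :: (real ^ 'n) set). ?f (x \<bullet> b)) \<partial>lborel)"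
    by (simp only: prod_Basis)
  also have "\<dots> = (\<Prod>b\<in>(Basis :: (real ^ 'n) set). \<integral>\<^sup>+x. ?f x \<partial>lborel)"
    by (rule nn_integral_lborel_prod) auto
  also have "\<dots> \<le> (\<Prod>b\<in>(Basis :: (real ^ 'n) set). ennreal (2 * pi * t))"
    by (intro prod_mono_ennreal nn_integral_bump_pair t)
  also have "\<dots> = ennreal ((2 * pi * t) ^ CARD('n))" using t by (simp add: ennreal_power)
  finally show ?thesis .
qed

text \<open>The cube of integration touches lattice points at its corners, while the hypothesis is about the
centred cube. A point \<open>\<xi>\<close> of the former is moved to a point \<open>\<eta>\<close> of the latter by subtracting
0 or 1 from each coordinate; adding both possibilities in every coordinate keeps the product structure.\<close>

lemma torus_norm2_le_bump:
  fixes G :: "real ^ 'n::finite \<Rightarrow> complex"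
  assumes G: "torus_fun G" and t: "0 < t" and C: "0 \<le> C"
    and bound: "\<And>\<eta>. (\<And>j. \<bar>\<eta> $ j\<bar> < 1/2) \<Longrightarrow> (norm (G \<eta>))\<^sup>2 * (1 + (norm \<eta> / t)\<^sup>2) ^ CARD('n) \<le> C"
  shows "(\<integral>\<xi>. (norm (G \<xi>))\<^sup>2 \<partial>torus) \<le> C * (2 * pi * t) ^ CARD('n)"
proof -
  let ?P = "\<lambda>x :: real ^ 'n. \<Prod>j\<in>UNIV. ennreal (bump t (x $ j) + bump t (x $ j - 1))"
  have per: "G (x + (\<Sum>j\<in>J. axis j 1)) = G x" for x and J :: "'n set"
  proof -
    have "finite J" by simp
    then show ?thesis
    proof (induction J)
      case (insert j J)
      have "G (x + (\<Sum>j\<in>J. axis j 1) + axis j 1) = G (x + (\<Sum>j\<in>J. axis j 1))"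
        using G by (simp add: torus_fun_def periodic1_def)
      then show ?case using insert by (simp add: algebra_simps)
    qed simp
  qed
  have point: "ennreal ((norm (G \<xi>))\<^sup>2) \<le> ennreal C * ?P \<xi>"
    if xi: "\<xi> \<in> box 0 1" and half: "\<And>j. \<xi> $ j \<noteq> 1/2" for \<xi>
  proof -
    have box: "0 < \<xi> $ j" "\<xi> $ j < 1" for j using xi by (auto simp: mem_box_cart)
    define J where "J = {j. 1/2 < \<xi> $ j}"
    define \<eta> where "\<eta> = \<xi> - (\<Sum>j\<in>J. axis j 1)"
    have nth: "\<eta> $ j = (if j \<in> J then \<xi> $ j - 1 else \<xi> $ j)" for j
    proof -
      have "(\<Sum>k\<in>J. axis k (1 :: real)) $ j = (\<Sum>k\<in>J. if k = j then 1 else 0)"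
        unfolding sum_component by (intro sum.cong) (auto simp: axis_def)
      also have "\<dots> = (if j \<in> J then 1 else 0)" by (simp add: sum.delta)
      finally show ?thesis by (simp add: \<eta>_def)
    qed
    have cube: "\<bar>\<eta> $ j\<bar> < 1/2" for j
      using box[of j] half[of j] by (auto simp: nth J_def abs_if not_less)
    have Geq: "G \<xi> = G \<eta>" using per[of \<eta> J] by (simp add: \<eta>_def)
    let ?a = "1 + (norm \<eta> / t)\<^sup>2"
    have a: "0 < ?a" by (simp add: add_pos_nonneg)
    have "(norm (G \<eta>))\<^sup>2 \<le> C * (1 / ?a) ^ CARD('n)"
      using bound[OF cube] a by (simp add: power_divide le_divide_eq)
    also have "(1 / ?a) ^ CARD('n) = (\<Prod>j\<in>(UNIV :: 'n set). 1 / ?a)" by simp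
    also have "\<dots> \<le> (\<Prod>j\<in>UNIV. bump t (\<xi> $ j) + bump t (\<xi> $ j - 1))"
    proof (intro prod_mono conjI)
      fix j
      show "0 \<le> 1 / ?a" using a by simp
      have "(\<eta> $ j / t)\<^sup>2 \<le> (norm \<eta> / t)\<^sup>2"
        using component_le_norm_cart[of \<eta> j] t by (simp add: power_divide divide_right_mono flip: abs_le_square_iff)
      then have "1 / ?a \<le> bump t (\<eta> $ j)"
        unfolding bump_def by (intro divide_left_mono mult_pos_pos) (auto simp: add_pos_nonneg)
      also have "\<dots> \<le> bump t (\<xi> $ j) + bump t (\<xi> $ j - 1)"
        using bump_pos[of t "\<xi> $ j"] bump_pos[of t "\<xi> $ j - 1"] by (simp add: nth)
      finally show "1 / ?a \<le> bump t (\<xi> $ j) + bump t (\<xi> $ j - 1)" .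
    qed
    finally have "(norm (G \<xi>))\<^sup>2 \<le> C * (\<Prod>j\<in>UNIV. bump t (\<xi> $ j) + bump t (\<xi> $ j - 1))"
      using C by (simp add: Geq mult_left_mono)
    then have "ennreal ((norm (G \<xi>))\<^sup>2) \<le> ennreal (C * (\<Prod>j\<in>UNIV. bump t (\<xi> $ j) + bump t (\<xi> $ j - 1)))"
      by (rule ennreal_leI)
    also have "\<dots> = ennreal C * ?P \<xi>"
    proof -
      have nn: "0 \<le> bump t (\<xi> $ j) + bump t (\<xi> $ j - 1)" for j
        by (intro add_nonneg_nonneg less_imp_le bump_pos)
      then have "?P \<xi> = ennreal (\<Prod>j\<in>UNIV. bump t (\<xi> $ j) + bump t (\<xi> $ j - 1))"
        by (rule prod_ennreal)
      moreover have "0 \<le> (\<Prod>j\<in>UNIV. bump t (\<xi> $ j) + bump t (\<xi> $ j - 1))"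
        using nn by (rule prod_nonneg)
      ultimately show ?thesis using C by (simp only: ennreal_mult)
    qed
    finally show ?thesis .
  qed
  have half: "AE x in lborel. \<forall>j. (x :: real ^ 'n) $ j \<noteq> 1/2"
  proof -
    have "AE x in lborel. \<forall>j\<in>UNIV. (x :: real ^ 'n) $ j \<noteq> 1/2"
      by (intro AE_finite_allI AE_lborel_coordinate) simp
    then show ?thesis by simp
  qed
  have "ennreal (\<integral>\<xi>. (norm (G \<xi>))\<^sup>2 \<partial>torus) = (\<integral>\<^sup>+\<xi>. ennreal ((norm (G \<xi>))\<^sup>2) \<partial>torus)"
    by (rule nn_integral_eq_integral[symmetric]) (auto intro: torus_norm2_integrable G)
  also have "\<dots> = (\<integral>\<^sup>+\<xi>. ennreal ((norm (G \<xi>))\<^sup>2) * indicator (box 0 1) \<xi> \<partial>lborel)"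
    by (simp add: nn_integral_restrict_space nn_integral_completion)
  also have "\<dots> \<le> (\<integral>\<^sup>+\<xi>. ennreal C * ?P \<xi> \<partial>lborel)"
  proof (rule nn_integral_mono_AE)
    show "AE \<xi> in lborel. ennreal ((norm (G \<xi>))\<^sup>2) * indicator (box 0 1) \<xi> \<le> ennreal C * ?P \<xi>"
      using half by eventually_elim (use point in \<open>auto simp: indicator_def\<close>)
  qed
  also have "\<dots> = ennreal C * (\<integral>\<^sup>+\<xi>. ?P \<xi> \<partial>lborel)" by (rule nn_integral_cmult) measurable
  also have "\<dots> \<le> ennreal C * ennreal ((2 * pi * t) ^ CARD('n))"
    by (intro mult_left_mono nn_integral_prod_bump_pair t) simp
  also have "\<dots> = ennreal (C * (2 * pi * t) ^ CARD('n))" using C t by (simp add: ennreal_mult)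
  finally show ?thesis using C t by (simp add: ennreal_le_iff)
qed

section \<open>The kernel satisfies the Calderon-Zygmund conditions\<close>


lemma norm_cis_minus_1: "norm (cis x - 1) = 2 * \<bar>sin (x / 2)\<bar>"
proof -
  have "(norm (cis x - 1))\<^sup>2 = (cos x - 1)\<^sup>2 + (sin x)\<^sup>2" by (simp add: cmod_power2)
  also have "\<dots> = 2 - 2 * cos x" using sin_cos_squared_add[of x] by (simp add: power2_eq_square algebra_simps)
  also have "\<dots> = (2 * \<bar>sin (x / 2)\<bar>)\<^sup>2" using cos_double_sin[of "x / 2"] by (simp add: power_mult_distrib)
  finally show ?thesis by (rule power2_eq_imp_eq) auto
qed

lemma norm_cis_diff_le: "norm (cis x - cis y) \<le> \<bar>x - y\<bar>"
proof -
  have "cis x - cis y = cis y * (cis (x - y) - 1)" by (simp add: cis_mult algebra_simps)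
  then have "norm (cis x - cis y) = 2 * \<bar>sin ((x - y) / 2)\<bar>" by (simp add: norm_mult norm_cis_minus_1)
  also have "\<dots> \<le> \<bar>x - y\<bar>" using abs_sin_x_le_abs_x[of "(x - y) / 2"] by simp
  finally show ?thesis .
qed

lemma sum_norm_le_sqrt_card:
  assumes "finite B" and "(\<Sum>n\<in>B. (norm (f n))\<^sup>2) \<le> Y" and "real (card B) \<le> X"
  shows "(\<Sum>n\<in>B. norm (f n)) \<le> sqrt (X * Y)"
proof -
  have "(\<Sum>n\<in>B. 1 * norm (f n))\<^sup>2 \<le> (\<Sum>n\<in>B. 1\<^sup>2) * (\<Sum>n\<in>B. (norm (f n))\<^sup>2)"
    by (rule Cauchy_Schwarz_ineq_sum)
  also have "\<dots> \<le> X * Y" using assms by (intro mult_mono) (auto intro: sum_nonneg)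
  finally show ?thesis by (intro real_le_rsqrt) simp
qed

text \<open>Lattice points of size comparable to \<open>R\<close> whose \<open>i\<close>-th coordinate is also comparable to
\<open>R\<close>, so that differences along the \<open>i\<close>-th axis see them.\<close>

definition shell :: "'n::finite \<Rightarrow> real \<Rightarrow> (int ^ 'n) set" where
  "shell i R = {n. R / 2 \<le> \<bar>real_of_int (n $ i)\<bar> \<and> (\<forall>j. \<bar>real_of_int (n $ j)\<bar> \<le> 4 * R)}"

lemma shell_card:
  fixes B :: "(int ^ 'n::finite) set"
  assumes "1 \<le> R" "finite B" "B \<subseteq> shell i R"
  shows "real (card B) \<le> (10 * R) ^ CARD('n)"
proof -
  let ?b = "\<lfloor>4 * R\<rfloor> + 1"
  have b: "0 \<le> ?b" "real_of_int ?b \<le> 5 * R" using assms by linarith+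
  have "B \<subseteq> {n. sup_abs (n - 0) < ?b}"
  proof
    fix n assume "n \<in> B"
    then have "\<bar>real_of_int (n $ j)\<bar> \<le> 4 * R" for j using assms by (auto simp: shell_def)
    then have "\<bar>n $ j\<bar> < ?b" for j by (metis floor_mono floor_of_int of_int_abs zless_add1_eq le_less)
    then show "n \<in> {n. sup_abs (n - 0) < ?b}" by (simp add: sup_abs_less_iff sup_abs_le_iff)
  qed
  then have "real (card B) \<le> real (card {n :: int ^ 'n. sup_abs (n - 0) < ?b})"
    using sup_abs_ball_finite_card(1)[OF b(1), of 0] by (intro of_nat_mono card_mono)
  also have "\<dots> \<le> (2 * real_of_int ?b) ^ CARD('n)" by (rule sup_abs_ball_finite_card(2)[OF b(1)])
  also have "\<dots> \<le> (10 * R) ^ CARD('n)" using b by (intro power_mono) auto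
  finally show ?thesis .
qed

text \<open>Let \<open>w n\<close> be the factor by which the \<open>r\<close>-fold difference multiplies \<open>K n\<close>; on the shell
\<open>|w n|\<close> is bounded below. Bessel's inequality for \<open>D\<close> bounds the \<open>\<ell>\<^sup>2\<close> norm of \<open>w K\<close>. Multiplying
\<open>D\<close> by a character minus 1 shifts its coefficients and gains a factor of size \<open>|\<xi>|\<close>, which
bounds the \<open>\<ell>\<^sup>2\<close> norm of the unit difference of \<open>w K\<close> with an additional factor
\<open>t\<close>. The Cauchy-Schwarz inequality passes to \<open>\<ell>\<^sup>1\<close>; finally the difference is moved from
\<open>w K\<close> to \<open>K\<close>, since \<open>w\<close> varies by \<open>O(t)\<close> over a unit step.\<close>

lemma kernel_unit_step_sum_le:
  fixes m :: "real ^ 'n::finite \<Rightarrow> complex"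
  assumes m: "torus_fun m" and r: "r = CARD('n) + 1" and C0: "0 \<le> C0"
    and bound: "\<And>i t \<eta>. 0 < t \<Longrightarrow> t \<le> 1 / (4 * real r) \<Longrightarrow> (\<And>j. \<bar>\<eta> $ j\<bar> < 1/2) \<Longrightarrow>
      (norm (step_diff r (t *\<^sub>R axis i 1) m \<eta>))\<^sup>2 * (1 + (norm \<eta> / t)\<^sup>2) ^ r \<le> C0"
  shows "\<exists>C. 0 \<le> C \<and> (\<forall>i j R B. 1 \<le> R \<longrightarrow> finite B \<longrightarrow> B \<subseteq> shell i R \<longrightarrow> (\<lambda>n. n - axis j 1) ` B \<subseteq> shell i R \<longrightarrow>
     (\<Sum>n\<in>B. norm (inv_fourier m (n - axis j 1) - inv_fourier m n)) \<le> C / R)"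
proof -
  let ?K = "inv_fourier m"
  let ?d = "CARD('n)"
  \<comment> \<open>With the step \<open>t = 1 / (16 r R)\<close> below, \<open>|n\<^sub>i| t\<close> lies between \<open>1 / (32 r)\<close> and
    \<open>1 / (4 r)\<close> on the shell. There \<open>|cis (2 pi n\<^sub>i t) - 1| = 2 |sin (pi n\<^sub>i t)|\<close> is at least
    \<open>\<kappa>\<close>.\<close>
  define \<kappa> where "\<kappa> = sin (pi / (32 * real r))"
  have r1: "1 \<le> real r" using r by simp
  have "2 \<le> 32 * real r" using r1 by linarith
  then have angle: "0 < pi / (32 * real r)" "pi / (32 * real r) \<le> pi / 2"
    using r1 by (simp, intro divide_left_mono) auto
  have k: "0 < \<kappa>" unfolding \<kappa>_def using angle pi_gt_zero by (intro sin_gt_zero) linarith+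
  define C1 where "C1 = sqrt (C0 * (20 * pi / (16 * real r)) ^ ?d)"
  define C where "C = (2 * pi * C1 + real r * 2 ^ r * (2 * pi) * (C1 / \<kappa> ^ r)) / \<kappa> ^ r / (16 * real r)"
  have C1: "0 \<le> C1" unfolding C1_def using C0 r1 by (intro real_sqrt_ge_zero mult_nonneg_nonneg) auto
  have C: "0 \<le> C" unfolding C_def using C1 k r1 by (intro divide_nonneg_nonneg add_nonneg_nonneg mult_nonneg_nonneg) auto
  have "(\<Sum>n\<in>B. norm (?K (n - axis j 1) - ?K n)) \<le> C / R"
    if R: "1 \<le> R" and B: "finite B" "B \<subseteq> shell i R" "(\<lambda>n. n - axis j 1) ` B \<subseteq> shell i R" for i j R B
  proof -
    define t where "t = 1 / (16 * real r * R)"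
    have t0: "0 < t" unfolding t_def using R r1 by simp
    have Rt: "R * t = 1 / (16 * real r)" unfolding t_def using R by simp
    have t1: "t \<le> 1 / (4 * real r)"
      unfolding t_def using R r1 by (intro divide_left_mono) (auto simp: mult_left_mono[of 1 R] intro: order_trans[of _ "16 * real r"])
    have "1 / (4 * real r) \<le> 1" using r1 by simp
    then have t_le1: "t \<le> 1" using t1 by linarith
    define D where "D = step_diff r (t *\<^sub>R axis i 1) m"
    have D: "torus_fun D" unfolding D_def using m by (rule torus_fun_step_diff)
    define w where "w n = (cis (2 * pi * (real_of_int (n $ i) * t)) - 1) ^ r" for n :: "int ^ 'n"
    have D_hat: "inv_fourier D n = w n * ?K n" for n
      unfolding D_def w_def using m t0 t_le1 by (intro inv_fourier_step_diff) auto
    have D_point: "(norm (D \<eta>))\<^sup>2 * (1 + (norm \<eta> / t)\<^sup>2) ^ r \<le> C0" if "\<And>j. \<bar>\<eta> $ j\<bar> < 1/2" for \<eta>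
      unfolding D_def using bound[OF t0 t1 that] .
    have D_int: "(\<integral>\<xi>. (norm (D \<xi>))\<^sup>2 \<partial>torus) \<le> C0 * (2 * pi * t) ^ ?d"
    proof (rule torus_norm2_le_bump[OF D t0 C0])
      fix \<eta> :: "real ^ 'n" assume eta: "\<And>j. \<bar>\<eta> $ j\<bar> < 1/2"
      have "(1 + (norm \<eta> / t)\<^sup>2) ^ ?d \<le> (1 + (norm \<eta> / t)\<^sup>2) ^ r"
        unfolding r by (intro power_increasing) auto
      then have "(norm (D \<eta>))\<^sup>2 * (1 + (norm \<eta> / t)\<^sup>2) ^ ?d \<le> (norm (D \<eta>))\<^sup>2 * (1 + (norm \<eta> / t)\<^sup>2) ^ r"
        by (intro mult_left_mono) auto
      then show "(norm (D \<eta>))\<^sup>2 * (1 + (norm \<eta> / t)\<^sup>2) ^ ?d \<le> C0" using D_point[OF eta] by linarith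
    qed
    define G where "G \<xi> = character (axis j 1) \<xi> * D \<xi> - D \<xi>" for \<xi>
    have G: "torus_fun G" unfolding G_def[abs_def] using D by (intro torus_fun_intros)
    have G_hat: "inv_fourier G n = w (n - axis j 1) * ?K (n - axis j 1) - w n * ?K n" for n
      unfolding G_def[abs_def] using D
      by (subst inv_fourier_diff) (auto intro: torus_fun_intros simp: inv_fourier_mult_character D_hat)
    have G_int: "(\<integral>\<xi>. (norm (G \<xi>))\<^sup>2 \<partial>torus) \<le> ((2 * pi * t)\<^sup>2 * C0) * (2 * pi * t) ^ ?d"
    proof (rule torus_norm2_le_bump[OF G t0])
      show "0 \<le> (2 * pi * t)\<^sup>2 * C0" using C0 by simp
      fix \<eta> :: "real ^ 'n" assume eta: "\<And>j. \<bar>\<eta> $ j\<bar> < 1/2"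
      let ?a = "1 + (norm \<eta> / t)\<^sup>2"
      have a: "0 < ?a" by (simp add: add_pos_nonneg)
      have "norm (character (axis j 1) \<eta> - 1) \<le> \<bar>2 * pi * (\<eta> $ j)\<bar>"
        using norm_cis_diff_le[of "2 * pi * (\<eta> $ j)" 0]
        by (simp add: character_def of_int_vec_axis inner_axis inner_commute)
      also have "\<dots> \<le> 2 * pi * norm \<eta>" using component_le_norm_cart[of \<eta> j] by (simp add: abs_mult)
      finally have "(norm (character (axis j 1) \<eta> - 1))\<^sup>2 \<le> (2 * pi * norm \<eta>)\<^sup>2" by (intro power_mono) auto
      also have "\<dots> = (2 * pi * t)\<^sup>2 * (norm \<eta> / t)\<^sup>2" using t0 by (simp add: power_mult_distrib power_divide)
      also have "\<dots> \<le> (2 * pi * t)\<^sup>2 * ?a" by (intro mult_left_mono) auto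
      finally have c: "(norm (character (axis j 1) \<eta> - 1))\<^sup>2 \<le> (2 * pi * t)\<^sup>2 * ?a" .
      have "G \<eta> = (character (axis j 1) \<eta> - 1) * D \<eta>" by (simp add: G_def algebra_simps)
      then have "(norm (G \<eta>))\<^sup>2 = (norm (character (axis j 1) \<eta> - 1))\<^sup>2 * (norm (D \<eta>))\<^sup>2"
        by (simp add: norm_mult power_mult_distrib)
      also have "\<dots> \<le> ((2 * pi * t)\<^sup>2 * ?a) * (norm (D \<eta>))\<^sup>2" using c by (intro mult_right_mono) auto
      finally have "(norm (G \<eta>))\<^sup>2 * ?a ^ ?d \<le> ((2 * pi * t)\<^sup>2 * ?a) * (norm (D \<eta>))\<^sup>2 * ?a ^ ?d"
        using a by (intro mult_right_mono) auto
      also have "\<dots> = (2 * pi * t)\<^sup>2 * ((norm (D \<eta>))\<^sup>2 * ?a ^ r)" by (simp add: r mult_ac)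
      also have "\<dots> \<le> (2 * pi * t)\<^sup>2 * C0" using D_point[OF eta] by (intro mult_left_mono) auto
      finally show "(norm (G \<eta>))\<^sup>2 * ?a ^ ?d \<le> (2 * pi * t)\<^sup>2 * C0" .
    qed
    have card: "real (card B) \<le> (10 * R) ^ ?d" using R B by (intro shell_card) auto
    have scale: "(10 * R) ^ ?d * (2 * pi * t) ^ ?d = (20 * pi / (16 * real r)) ^ ?d"
    proof -
      have "(10 * R) * (2 * pi * t) = 20 * pi * (R * t)" by simp
      also have "\<dots> = 20 * pi / (16 * real r)" unfolding Rt by simp
      finally show ?thesis by (simp only: power_mult_distrib[symmetric])
    qed
    have "(\<Sum>n\<in>B. norm (w n * ?K n)) \<le> sqrt ((10 * R) ^ ?d * (C0 * (2 * pi * t) ^ ?d))"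
      using bessel_inequality[OF B(1) D] D_int card unfolding D_hat
      by (intro sum_norm_le_sqrt_card B(1)) auto
    also have "(10 * R) ^ ?d * (C0 * (2 * pi * t) ^ ?d) = C0 * ((10 * R) ^ ?d * (2 * pi * t) ^ ?d)" by (simp only: mult_ac)
    also have "sqrt \<dots> = C1" by (simp only: scale C1_def)
    finally have sum_wK: "(\<Sum>n\<in>B. norm (w n * ?K n)) \<le> C1" .
    have "(\<Sum>n\<in>B. norm (w (n - axis j 1) * ?K (n - axis j 1) - w n * ?K n))
        \<le> sqrt ((10 * R) ^ ?d * (((2 * pi * t)\<^sup>2 * C0) * (2 * pi * t) ^ ?d))"
      using bessel_inequality[OF B(1) G] G_int card unfolding G_hat
      by (intro sum_norm_le_sqrt_card B(1)) auto
    also have "(10 * R) ^ ?d * (((2 * pi * t)\<^sup>2 * C0) * (2 * pi * t) ^ ?d)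
        = (2 * pi * t)\<^sup>2 * (C0 * ((10 * R) ^ ?d * (2 * pi * t) ^ ?d))" by (simp only: mult_ac)
    also have "sqrt \<dots> = 2 * pi * t * C1" unfolding scale C1_def real_sqrt_mult using t0 by simp
    finally have sum_diff: "(\<Sum>n\<in>B. norm (w (n - axis j 1) * ?K (n - axis j 1) - w n * ?K n)) \<le> 2 * pi * t * C1" .
    have w_lower: "\<kappa> ^ r \<le> norm (w n)" if n: "n \<in> shell i R" for n
    proof -
      let ?y = "pi * (\<bar>real_of_int (n $ i)\<bar> * t)"
      have n1: "R / 2 \<le> \<bar>real_of_int (n $ i)\<bar>" "\<bar>real_of_int (n $ i)\<bar> \<le> 4 * R" using n by (auto simp: shell_def)
      have "R / 2 * t \<le> \<bar>real_of_int (n $ i)\<bar> * t" "\<bar>real_of_int (n $ i)\<bar> * t \<le> 4 * R * t"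
        using n1 t0 by (intro mult_right_mono; simp)+
      then have n2: "1 / (32 * real r) \<le> \<bar>real_of_int (n $ i)\<bar> * t" "\<bar>real_of_int (n $ i)\<bar> * t \<le> 1 / (4 * real r)"
        using Rt by simp_all
      have "1 / (4 * real r) \<le> 1 / 2" using r1 by simp
      then have "\<bar>real_of_int (n $ i)\<bar> * t \<le> 1 / 2" using n2(2) by (rule order_trans[rotated])
      from mult_left_mono[OF this, of pi] mult_left_mono[OF n2(1), of pi]
      have y: "pi / (32 * real r) \<le> ?y" "?y \<le> pi / 2" by auto
      have "\<kappa> \<le> sin ?y" unfolding \<kappa>_def using y angle by (intro sin_monotone_2pi_le) linarith+
      also have "sin ?y \<le> \<bar>sin (pi * (real_of_int (n $ i) * t))\<bar>"
        by (cases "0 \<le> n $ i") (auto simp: abs_mult)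
      also have "\<dots> \<le> norm (cis (2 * pi * (real_of_int (n $ i) * t)) - 1)"
        by (simp add: norm_cis_minus_1)
      finally show ?thesis unfolding w_def norm_power using k by (intro power_mono) auto
    qed
    have w_diff: "norm (w n - w (n - axis j 1)) \<le> real r * 2 ^ r * (2 * pi * t)" for n
    proof -
      define a where "a = (cis (2 * pi * (real_of_int (n $ i) * t)) - 1) / 2"
      define b where "b = (cis (2 * pi * (real_of_int ((n - axis j 1) $ i) * t)) - 1) / 2"
      have half: "norm ((cis x - 1) / 2) \<le> 1" for x
        using norm_triangle_ineq4[of "cis x" 1] by (simp add: norm_divide)
      have "norm (2 * (a - b)) = norm (cis (2 * pi * (real_of_int (n $ i) * t)) - cis (2 * pi * (real_of_int ((n - axis j 1) $ i) * t)))"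
      proof -
        have "2 * ((x - 1) / 2 - (y - 1) / 2) = x - y" for x y :: complex by (simp add: field_simps)
        then show ?thesis unfolding a_def b_def by (simp only:)
      qed
      also have "\<dots> \<le> \<bar>2 * pi * (real_of_int (n $ i) * t) - 2 * pi * (real_of_int ((n - axis j 1) $ i) * t)\<bar>"
        by (rule norm_cis_diff_le)
      also have "\<dots> \<le> 2 * pi * t" using t0 by (auto simp: axis_def algebra_simps)
      finally have "2 * norm (a - b) \<le> 2 * pi * t" by (simp only: norm_mult norm_numeral)
      then have ab: "norm (a - b) \<le> 2 * pi * t" using norm_ge_zero[of "a - b"] by linarith
      have "w n - w (n - axis j 1) = 2 ^ r * (a ^ r - b ^ r)"
        by (simp add: w_def a_def b_def power_divide right_diff_distrib)
      then have "norm (w n - w (n - axis j 1)) = 2 ^ r * norm (a ^ r - b ^ r)" by (simp add: norm_mult norm_power)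
      also have "\<dots> \<le> 2 ^ r * (real r * norm (a - b))"
        using half by (intro mult_left_mono norm_power_diff) (auto simp: a_def b_def)
      also have "\<dots> \<le> 2 ^ r * (real r * (2 * pi * t))" using ab by (intro mult_left_mono) auto
      finally show ?thesis by (simp add: mult_ac)
    qed
    have sum_K: "(\<Sum>n\<in>B. norm (?K n)) \<le> C1 / \<kappa> ^ r"
    proof -
      have "\<kappa> ^ r * (\<Sum>n\<in>B. norm (?K n)) \<le> (\<Sum>n\<in>B. norm (w n * ?K n))"
        unfolding sum_distrib_left norm_mult using B w_lower by (intro sum_mono mult_right_mono) auto
      then show ?thesis using sum_wK k by (simp add: le_divide_eq mult.commute)
    qed
    have "\<kappa> ^ r * (\<Sum>n\<in>B. norm (?K (n - axis j 1) - ?K n))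
        \<le> (\<Sum>n\<in>B. norm (w (n - axis j 1) * ?K (n - axis j 1) - w n * ?K n) + (real r * 2 ^ r * (2 * pi * t)) * norm (?K n))"
      unfolding sum_distrib_left
    proof (rule sum_mono)
      fix n assume n: "n \<in> B"
      have "\<kappa> ^ r * norm (?K (n - axis j 1) - ?K n) \<le> norm (w (n - axis j 1)) * norm (?K (n - axis j 1) - ?K n)"
        using n B w_lower by (intro mult_right_mono) auto
      also have "\<dots> = norm ((w (n - axis j 1) * ?K (n - axis j 1) - w n * ?K n) + (w n - w (n - axis j 1)) * ?K n)"
        by (simp add: algebra_simps flip: norm_mult)
      also have "\<dots> \<le> norm (w (n - axis j 1) * ?K (n - axis j 1) - w n * ?K n) + norm (w n - w (n - axis j 1)) * norm (?K n)"
        by (metis norm_mult norm_triangle_ineq)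
      also have "\<dots> \<le> norm (w (n - axis j 1) * ?K (n - axis j 1) - w n * ?K n) + (real r * 2 ^ r * (2 * pi * t)) * norm (?K n)"
        using w_diff by (intro add_left_mono mult_right_mono) auto
      finally show "\<kappa> ^ r * norm (?K (n - axis j 1) - ?K n)
          \<le> norm (w (n - axis j 1) * ?K (n - axis j 1) - w n * ?K n) + (real r * 2 ^ r * (2 * pi * t)) * norm (?K n)" .
    qed
    also have "\<dots> \<le> 2 * pi * t * C1 + (real r * 2 ^ r * (2 * pi * t)) * (C1 / \<kappa> ^ r)"
      unfolding sum.distrib sum_distrib_left[symmetric] using sum_diff sum_K t0 by (intro add_mono mult_left_mono) auto
    also have "\<dots> = (2 * pi * C1 + real r * 2 ^ r * (2 * pi) * (C1 / \<kappa> ^ r)) * t" by (simp add: algebra_simps)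
    finally have "(\<Sum>n\<in>B. norm (?K (n - axis j 1) - ?K n))
        \<le> (2 * pi * C1 + real r * 2 ^ r * (2 * pi) * (C1 / \<kappa> ^ r)) * t / \<kappa> ^ r"
      using k by (simp add: le_divide_eq mult.commute)
    also have "\<dots> = C / R" by (simp add: C_def t_def)
    finally show ?thesis .
  qed
  then show ?thesis using C by blast
qed

text \<open>Walk from 0 to \<open>h\<close> by unit steps that never increase any coordinate in absolute value beyond that of
\<open>h\<close>. All intermediate points \<open>n - h'\<close> then stay in the shell, and the triangle inequality adds
up as many unit differences as there are steps.\<close>

lemma shift_sum_path:
  fixes K :: "int ^ 'n::finite \<Rightarrow> complex"
  assumes C: "0 \<le> C" and R: "1 \<le> R"
    and unit: "\<And>j B. finite B \<Longrightarrow> B \<subseteq> shell i R \<Longrightarrow> (\<lambda>n. n - axis j 1) ` B \<subseteq> shell i R \<Longrightarrow>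
     (\<Sum>n\<in>B. norm (K (n - axis j 1) - K n)) \<le> C / R"
    and B: "finite B" and far: "\<And>n. n \<in> B \<Longrightarrow> R \<le> \<bar>real_of_int (n $ i)\<bar>"
    and near: "\<And>n. n \<in> B \<Longrightarrow> real_of_int (sup_abs n) \<le> 2 * R"
    and h: "4 * real_of_int (sup_abs h) \<le> R"
  shows "(\<Sum>n\<in>B. norm (K (n - h) - K n)) \<le> real_of_int (\<Sum>j\<in>UNIV. \<bar>h $ j\<bar>) * (C / R)"
proof -
  have in_shell: "n - h \<in> shell i R" if "n \<in> B" "4 * real_of_int (sup_abs h) \<le> R" for n h
  proof -
    have hj: "4 * \<bar>real_of_int (h $ j)\<bar> \<le> R" for j
    proof -
      have "\<bar>real_of_int (h $ j)\<bar> \<le> real_of_int (sup_abs h)"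
        using abs_le_sup_abs[of h j] by (metis of_int_abs of_int_le_iff)
      then show ?thesis using that by linarith
    qed
    have nj: "\<bar>real_of_int (n $ j)\<bar> \<le> 2 * R" for j
    proof -
      have "\<bar>real_of_int (n $ j)\<bar> \<le> real_of_int (sup_abs n)"
        using abs_le_sup_abs[of n j] by (metis of_int_abs of_int_le_iff)
      then show ?thesis using near[OF that(1)] by linarith
    qed
    have "R / 2 \<le> \<bar>real_of_int ((n - h) $ i)\<bar>" 
      using far[OF that(1)] hj[of i] abs_triangle_ineq2[of "real_of_int (n $ i)" "real_of_int (h $ i)"]
      unfolding vector_minus_component of_int_diff by linarith
    moreover have "\<bar>real_of_int ((n - h) $ j)\<bar> \<le> 4 * R" for j
      using nj[of j] hj[of j] R abs_triangle_ineq4[of "real_of_int (n $ j)" "real_of_int (h $ j)"]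
      unfolding vector_minus_component of_int_diff by linarith
    ultimately show ?thesis by (simp add: shell_def)
  qed
  have step: "(\<Sum>n\<in>B. norm (K (n - h' - axis j 1) - K (n - h'))) \<le> C / R"
    if "4 * real_of_int (sup_abs h') \<le> R" "4 * real_of_int (sup_abs (h' + axis j 1)) \<le> R" for h' j
  proof -
    have "(\<Sum>n\<in>B. norm (K (n - h' - axis j 1) - K (n - h')))
        = (\<Sum>n\<in>(\<lambda>n. n - h') ` B. norm (K (n - axis j 1) - K n))"
      by (subst sum.reindex) (auto intro: inj_onI)
    also have "\<dots> \<le> C / R"
    proof (rule unit)
      show "(\<lambda>n. n - h') ` B \<subseteq> shell i R" using in_shell that(1) by blast
      have "n - h' - axis j 1 \<in> shell i R" if "n \<in> B" for n
        using in_shell[OF that \<open>4 * real_of_int (sup_abs (h' + axis j 1)) \<le> R\<close>] by (simp add: diff_diff_eq)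
      then show "(\<lambda>n. n - axis j 1) ` (\<lambda>n. n - h') ` B \<subseteq> shell i R" by blast
    qed (use B in simp)
    finally show ?thesis .
  qed
  show ?thesis using h
  proof (induction "nat (\<Sum>j\<in>UNIV. \<bar>h $ j\<bar>)" arbitrary: h)
    case 0
    have "(\<Sum>j\<in>UNIV. \<bar>h $ j\<bar>) = 0" 
    proof -
      have "0 \<le> (\<Sum>j\<in>UNIV. \<bar>h $ j\<bar>)" by (rule sum_nonneg) simp
      then show ?thesis using 0(1) by linarith
    qed
    then have "h = 0" by (simp add: sum_nonneg_eq_0_iff vec_eq_iff)
    then show ?case by simp
  next
    case (Suc N)
    have "h \<noteq> 0" using Suc(2) by auto
    then obtain j where j: "h $ j \<noteq> 0" by (auto simp: vec_eq_iff)
    define e :: "int ^ 'n" where "e = axis j (sgn (h $ j))"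
    define h' where "h' = h - e"
    have h'_nth: "h' $ l = (if l = j then h $ l - sgn (h $ j) else h $ l)" for l
      by (simp add: h'_def e_def axis_def)
    have abs_h': "\<bar>h' $ l\<bar> = \<bar>h $ l\<bar> - (if l = j then 1 else 0)" for l
      using j by (auto simp: h'_nth sgn_if abs_if)
    have sum_h': "(\<Sum>l\<in>UNIV. \<bar>h' $ l\<bar>) = (\<Sum>l\<in>UNIV. \<bar>h $ l\<bar>) - 1"
      by (simp add: abs_h' sum_subtractf)
    have "sup_abs h' \<le> sup_abs h"
    proof -
      have "\<bar>h' $ l\<bar> \<le> sup_abs h" for l
        unfolding abs_h' using abs_le_sup_abs[of h l] by (cases "l = j") auto
      then show ?thesis by (simp add: sup_abs_le_iff)
    qed
    then have h'4: "4 * real_of_int (sup_abs h') \<le> R" using Suc.prems by linarith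
    have "N = nat (\<Sum>l\<in>UNIV. \<bar>h' $ l\<bar>)" unfolding sum_h' using Suc(2) by simp
    from Suc(1)[OF this h'4]
    have IH: "(\<Sum>n\<in>B. norm (K (n - h') - K n)) \<le> (real_of_int (\<Sum>l\<in>UNIV. \<bar>h $ l\<bar>) - 1) * (C / R)"
      unfolding sum_h' by simp
    have one: "(\<Sum>n\<in>B. norm (K (n - h) - K (n - h'))) \<le> C / R"
    proof (cases "0 < h $ j")
      case True
      then have "h = h' + axis j 1" by (simp add: h'_def e_def)
      then show ?thesis using step[OF h'4, of j] Suc.prems by (simp add: diff_diff_eq)
    next
      case False
      then have "axis j (sgn (h $ j)) = - axis j (1 :: int)" using j by (auto simp: axis_def vec_eq_iff sgn_if)
      then have h': "h' = h + axis j 1" by (simp add: h'_def e_def)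
      have "(\<Sum>n\<in>B. norm (K (n - h) - K (n - h'))) = (\<Sum>n\<in>B. norm (K (n - h - axis j 1) - K (n - h)))"
        by (simp add: h' diff_diff_eq norm_minus_commute)
      then show ?thesis using step[OF Suc.prems, of j] h'4 h' by simp
    qed
    have "(\<Sum>n\<in>B. norm (K (n - h) - K n)) \<le> (\<Sum>n\<in>B. norm (K (n - h) - K (n - h')) + norm (K (n - h') - K n))"
      by (intro sum_mono) (metis diff_add_cancel add_diff_eq norm_triangle_ineq)
    also have "\<dots> \<le> C / R + (real_of_int (\<Sum>l\<in>UNIV. \<bar>h $ l\<bar>) - 1) * (C / R)"
      unfolding sum.distrib using one IH by (rule add_mono)
    finally show ?case by (simp add: algebra_simps)
  qed
qed

lemma conv_on_inv_fourier:
  assumes m: "torus_fun m"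
  shows "conv_on (inv_fourier m) A f n = inv_fourier (\<lambda>\<xi>. m \<xi> * trig_poly A f \<xi>) n"
proof -
  have "inv_fourier (\<lambda>\<xi>. m \<xi> * trig_poly A f \<xi>) n = (\<integral>\<xi>. (\<Sum>k\<in>A. f k * (character k \<xi> * m \<xi> * character (- n) \<xi>)) \<partial>torus)"
    by (simp add: inv_fourier_character trig_poly_def sum_distrib_left sum_distrib_right mult_ac)
  also have "\<dots> = (\<Sum>k\<in>A. f k * inv_fourier (\<lambda>\<xi>. character k \<xi> * m \<xi>) n)"
    unfolding inv_fourier_character using m
    by (subst Bochner_Integration.integral_sum) (auto intro!: torus_integrable torus_fun_intros)
  finally show ?thesis by (simp add: inv_fourier_mult_character conv_on_def)
qed

lemma conv_on_l2_bound:
  assumes m: "torus_fun m" and b: "\<And>\<xi>. norm (m \<xi>) \<le> b" and A: "finite A" and B: "finite B"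
  shows "(\<Sum>n\<in>B. (norm (conv_on (inv_fourier m) A f n))\<^sup>2) \<le> b\<^sup>2 * (\<Sum>k\<in>A. (norm (f k))\<^sup>2)"
proof -
  have "(\<Sum>n\<in>B. (norm (conv_on (inv_fourier m) A f n))\<^sup>2) \<le> (\<integral>\<xi>. (norm (m \<xi> * trig_poly A f \<xi>))\<^sup>2 \<partial>torus)"
    unfolding conv_on_inv_fourier[OF m] using m by (intro bessel_inequality B torus_fun_mult torus_fun_trig_poly)
  also have "\<dots> \<le> (\<integral>\<xi>. b\<^sup>2 * (norm (trig_poly A f \<xi>))\<^sup>2 \<partial>torus)"
  proof (rule integral_mono)
    show "integrable torus (\<lambda>\<xi>. (norm (m \<xi> * trig_poly A f \<xi>))\<^sup>2)"
      using m by (intro torus_norm2_integrable torus_fun_mult torus_fun_trig_poly)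
    show "integrable torus (\<lambda>\<xi>. b\<^sup>2 * (norm (trig_poly A f \<xi>))\<^sup>2)"
      by (intro integrable_mult_right torus_norm2_integrable torus_fun_trig_poly)
    show "(norm (m \<xi> * trig_poly A f \<xi>))\<^sup>2 \<le> b\<^sup>2 * (norm (trig_poly A f \<xi>))\<^sup>2" for \<xi>
      using b[of \<xi>] by (simp add: norm_mult power_mult_distrib mult_right_mono power_mono)
  qed
  also have "\<dots> = b\<^sup>2 * (\<Sum>k\<in>A. (norm (f k))\<^sup>2)" using A by (simp add: trig_poly_norm)
  finally show ?thesis .
qed

text \<open>Cut the region \<open>|n| \<ge> 4 H\<close>, where \<open>H\<close> is the size of \<open>h\<close>, into dyadic annuli of radius
\<open>R = 4 H 2 ^ k\<close>, and each annulus according to the coordinate that attains the maximum. A path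
from 0 to \<open>h\<close> has at most \<open>d H\<close> steps, so an annulus contributes at most a multiple of
\<open>H / R\<close>, and the series over \<open>k\<close> is geometric.\<close>

lemma hoermander_condition_from_unit_steps:
  fixes K :: "int ^ 'n::finite \<Rightarrow> complex"
  assumes C: "0 \<le> C"
    and unit: "\<And>i j R B. 1 \<le> R \<Longrightarrow> finite B \<Longrightarrow> B \<subseteq> shell i R \<Longrightarrow> (\<lambda>n. n - axis j 1) ` B \<subseteq> shell i R \<Longrightarrow>
     (\<Sum>n\<in>B. norm (K (n - axis j 1) - K n)) \<le> C / R"
    and B: "finite B" and far: "\<And>n. n \<in> B \<Longrightarrow> 4 * sup_abs h \<le> sup_abs n"
  shows "(\<Sum>n\<in>B. norm (K (n - h) - K n)) \<le> (real CARD('n))\<^sup>2 * C"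
proof (cases "h = 0")
  case False
  let ?d = "real CARD('n)"
  let ?a = "\<lambda>n. norm (K (n - h) - K n)"
  define H where "H = real_of_int (sup_abs h)"
  have "1 \<le> sup_abs h"
  proof (rule ccontr)
    assume "\<not> 1 \<le> sup_abs h"
    then have "sup_abs h \<le> 0" by simp
    then show False using False by (auto simp: sup_abs_le_iff vec_eq_iff)
  qed
  then have H: "1 \<le> H" by (simp add: H_def)
  have sum_h: "real_of_int (\<Sum>j\<in>UNIV. \<bar>h $ j\<bar>) \<le> ?d * H"
  proof -
    have "(\<Sum>j\<in>UNIV. \<bar>h $ j\<bar>) \<le> (\<Sum>j\<in>(UNIV :: 'n set). sup_abs h)" by (intro sum_mono abs_le_sup_abs)
    then have "(\<Sum>j\<in>UNIV. \<bar>h $ j\<bar>) \<le> int CARD('n) * sup_abs h" by simp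
    then have "real_of_int (\<Sum>j\<in>UNIV. \<bar>h $ j\<bar>) \<le> real_of_int (int CARD('n) * sup_abs h)" by (simp only: of_int_le_iff)
    then show ?thesis by (simp add: H_def)
  qed
  have farH: "4 * H \<le> real_of_int (sup_abs n)" if "n \<in> B" for n
  proof -
    have "real_of_int (4 * sup_abs h) \<le> real_of_int (sup_abs n)" using far[OF that] by (simp only: of_int_le_iff)
    then show ?thesis by (simp add: H_def)
  qed
  have annulus: "(\<Sum>n\<in>A. ?a n) \<le> ?d\<^sup>2 * C * (H / R)"
    if R: "4 * H \<le> R" and A: "finite A" "\<And>n. n \<in> A \<Longrightarrow> R \<le> sup_abs n \<and> sup_abs n \<le> 2 * R" for R :: real and A :: "(int ^ 'n) set"
  proof -
    have R1: "1 \<le> R" using R H by linarith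
    let ?A = "\<lambda>i. {n \<in> A. R \<le> \<bar>real_of_int (n $ i)\<bar>}"
    have "(\<Sum>n\<in>A. ?a n) \<le> (\<Sum>n\<in>A. \<Sum>i\<in>UNIV. if R \<le> \<bar>real_of_int (n $ i)\<bar> then ?a n else 0)"
    proof (rule sum_mono)
      fix n assume n: "n \<in> A"
      obtain i where i: "\<bar>n $ i\<bar> = sup_abs n" by (rule sup_abs_attained)
      have "\<bar>real_of_int (n $ i)\<bar> = real_of_int (sup_abs n)" unfolding i[symmetric] by simp
      then have "?a n = (if R \<le> \<bar>real_of_int (n $ i)\<bar> then ?a n else 0)" using A(2)[OF n] by simp
      also have "\<dots> \<le> (\<Sum>i\<in>UNIV. if R \<le> \<bar>real_of_int (n $ i)\<bar> then ?a n else 0)"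
        by (rule member_le_sum) auto
      finally show "?a n \<le> (\<Sum>i\<in>UNIV. if R \<le> \<bar>real_of_int (n $ i)\<bar> then ?a n else 0)" .
    qed
    also have "\<dots> = (\<Sum>i\<in>UNIV. \<Sum>n\<in>?A i. ?a n)"
      by (subst sum.swap) (simp add: sum.inter_filter A)
    also have "\<dots> \<le> (\<Sum>i\<in>(UNIV :: 'n set). ?d * H * (C / R))"
    proof (rule sum_mono)
      fix i
      have "(\<Sum>n\<in>?A i. ?a n) \<le> real_of_int (\<Sum>j\<in>UNIV. \<bar>h $ j\<bar>) * (C / R)"
        using A R R1 by (intro shift_sum_path[OF C R1 unit[OF R1, where i = i]]) (auto simp: H_def)
      also have "\<dots> \<le> ?d * H * (C / R)" using sum_h C R1 by (intro mult_right_mono) auto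
      finally show "(\<Sum>n\<in>?A i. ?a n) \<le> ?d * H * (C / R)" .
    qed
    also have "\<dots> = ?d\<^sup>2 * C * (H / R)" by (simp add: power2_eq_square)
    finally show ?thesis .
  qed
  have dyadic: "(\<Sum>n | n \<in> B \<and> real_of_int (sup_abs n) < 4 * H * 2 ^ N. ?a n) \<le> ?d\<^sup>2 * C * (\<Sum>k<N. (1/2) ^ k / 4)" for N
  proof (induction N)
    case 0
    have "{n. n \<in> B \<and> real_of_int (sup_abs n) < 4 * H * 2 ^ 0} = {}" by (auto dest!: farH)
    then show ?case by (simp only: sum.empty) simp
  next
    case (Suc N)
    define R where "R = 4 * H * 2 ^ N"
    have "4 * H * 1 \<le> R" unfolding R_def using H by (intro mult_left_mono) auto
    then have R: "4 * H \<le> R" "0 < R" using H by linarith+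
    have twice: "4 * H * 2 ^ Suc N = 2 * R" by (simp add: R_def)
    let ?lo = "{n. n \<in> B \<and> real_of_int (sup_abs n) < R}"
    let ?hi = "{n. n \<in> B \<and> R \<le> real_of_int (sup_abs n) \<and> real_of_int (sup_abs n) < 2 * R}"
    have "{n. n \<in> B \<and> real_of_int (sup_abs n) < 2 * R} = ?lo \<union> ?hi"
      using R by (auto simp: not_le intro: less_trans[of _ R "2 * R"])
    moreover have "(\<Sum>n\<in>?lo \<union> ?hi. ?a n) = (\<Sum>n\<in>?lo. ?a n) + (\<Sum>n\<in>?hi. ?a n)"
      using B by (intro sum.union_disjoint) auto
    moreover have "(\<Sum>n\<in>?hi. ?a n) \<le> ?d\<^sup>2 * C * (H / R)"
      using B R by (intro annulus) auto
    moreover have "H / R = (1/2) ^ N / 4" using H by (simp add: R_def power_divide)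
    ultimately show ?case using Suc.IH unfolding twice R_def[symmetric] by (simp add: distrib_left)
  qed
  obtain N :: nat where N: "\<And>n. n \<in> B \<Longrightarrow> real_of_int (sup_abs n) < 2 ^ N"
  proof
    let ?N = "Max (insert 0 ((\<lambda>n. nat (sup_abs n)) ` B))"
    fix n assume "n \<in> B"
    then have "nat (sup_abs n) \<le> ?N" using B by (intro Max_ge) auto
    then have "real_of_int (sup_abs n) \<le> real ?N" by linarith
    also have "real ?N < 2 ^ ?N" by (rule of_nat_less_two_power)
    finally show "real_of_int (sup_abs n) < 2 ^ ?N" .
  qed
  have "real_of_int (sup_abs n) < 4 * H * 2 ^ N" if "n \<in> B" for n
  proof -
    have "1 * 2 ^ N \<le> 4 * H * 2 ^ N" using H by (intro mult_right_mono) auto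
    then show ?thesis using N[OF that] by linarith
  qed
  then have "{n. n \<in> B \<and> real_of_int (sup_abs n) < 4 * H * 2 ^ N} = B" by auto
  then have "(\<Sum>n\<in>B. ?a n) \<le> ?d\<^sup>2 * C * (\<Sum>k<N. (1/2) ^ k / 4)" using dyadic[of N] by simp
  also have "\<dots> \<le> ?d\<^sup>2 * C * 1"
  proof (intro mult_left_mono)
    have "(\<Sum>k<N. (1/2 :: real) ^ k) \<le> 2" by (simp add: sum_gp_strict)
    then show "(\<Sum>k<N. (1/2 :: real) ^ k / 4) \<le> 1" by (simp flip: sum_divide_distrib)
  qed (use C in simp)
  finally show ?thesis by simp
qed (use C in simp)

section \<open>Existence of the Fourier transform of a square-summable function\<close>


lemma summable_on_small_tails:
  fixes a :: "'a \<Rightarrow> real"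
  assumes sum: "a summable_on UNIV" and a: "\<And>n. 0 \<le> a n" and \<epsilon>: "0 < \<epsilon>"
  shows "\<exists>A. finite A \<and> (\<forall>B. finite B \<longrightarrow> B \<inter> A = {} \<longrightarrow> (\<Sum>n\<in>B. a n) \<le> \<epsilon>)"
proof -
  define S where "S = infsum a UNIV"
  have "(sum a \<longlongrightarrow> S) (finite_subsets_at_top UNIV)"
    using has_sum_infsum[OF sum] by (simp add: has_sum_def S_def)
  then have "eventually (\<lambda>A. S - \<epsilon> < sum a A) (finite_subsets_at_top UNIV)"
    using \<epsilon> by (intro order_tendstoD) auto
  then obtain A where A: "finite A" "\<And>Y. finite Y \<Longrightarrow> A \<subseteq> Y \<Longrightarrow> S - \<epsilon> < sum a Y"
    unfolding eventually_finite_subsets_at_top by auto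
  have "sum a B \<le> \<epsilon>" if B: "finite B" "B \<inter> A = {}" for B
  proof -
    have "sum a A + sum a B = sum a (A \<union> B)" using A B by (subst sum.union_disjoint) auto
    also have "\<dots> \<le> S" unfolding S_def using A B a by (intro finite_sum_le_infsum sum) auto
    finally show ?thesis using A(2)[OF A(1) order_refl] by linarith
  qed
  then show ?thesis using A(1) by blast
qed

lemma trig_poly_dist:
  assumes A: "finite A" and B: "finite B"
  shows "(\<integral>\<xi>. (norm (trig_poly A f \<xi> - trig_poly B f \<xi>))\<^sup>2 \<partial>torus)
    = (\<Sum>n\<in>(A - B) \<union> (B - A). (norm (f n))\<^sup>2)"
proof -
  define g where "g n = (if n \<in> A then f n else - f n)" for n
  have "trig_poly A f \<xi> - trig_poly B f \<xi> = trig_poly ((A - B) \<union> (B - A)) g \<xi>" for \<xi>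
  proof -
    have "trig_poly A f \<xi> = (\<Sum>n\<in>A - B. f n * character n \<xi>) + (\<Sum>n\<in>A \<inter> B. f n * character n \<xi>)"
      unfolding trig_poly_def using A by (metis (no_types) add.commute sum.Int_Diff)
    moreover have "trig_poly B f \<xi> = (\<Sum>n\<in>B - A. f n * character n \<xi>) + (\<Sum>n\<in>A \<inter> B. f n * character n \<xi>)"
      unfolding trig_poly_def using B by (metis (no_types) add.commute sum.Int_Diff Int_commute)
    moreover have "trig_poly ((A - B) \<union> (B - A)) g \<xi>
        = (\<Sum>n\<in>A - B. g n * character n \<xi>) + (\<Sum>n\<in>B - A. g n * character n \<xi>)"
      unfolding trig_poly_def using A B by (intro sum.union_disjoint) auto
    ultimately show ?thesis by (simp add: g_def sum_negf)
  qed
  then have "(\<integral>\<xi>. (norm (trig_poly A f \<xi> - trig_poly B f \<xi>))\<^sup>2 \<partial>torus)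
      = (\<Sum>n\<in>(A - B) \<union> (B - A). (norm (g n))\<^sup>2)"
    using A B by (simp add: trig_poly_norm)
  also have "\<dots> = (\<Sum>n\<in>(A - B) \<union> (B - A). (norm (f n))\<^sup>2)"
    by (intro sum.cong) (auto simp: g_def)
  finally show ?thesis .
qed

lemma norm_diff_squared_le:
  fixes x y :: "'a::real_normed_vector"
  shows "(norm (x - y))\<^sup>2 \<le> 2 * (norm x)\<^sup>2 + 2 * (norm y)\<^sup>2"
proof -
  have "(norm (x - y))\<^sup>2 \<le> (norm x + norm y)\<^sup>2" by (intro power_mono norm_triangle_ineq4) simp
  also have "\<dots> \<le> 2 * (norm x)\<^sup>2 + 2 * (norm y)\<^sup>2"
    using zero_le_power2[of "norm x - norm y"] by (simp add: power2_eq_square algebra_simps)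
  finally show ?thesis .
qed

lemma L2_torus_diff:
  assumes "u \<in> L2_torus" "v \<in> L2_torus" shows "(\<lambda>\<xi>. u \<xi> - v \<xi>) \<in> L2_torus"
proof -
  have [measurable]: "u \<in> borel_measurable torus" "v \<in> borel_measurable torus" using assms by (auto simp: L2_torus_def)
  have "integrable torus (\<lambda>\<xi>. 2 * (norm (u \<xi>))\<^sup>2 + 2 * (norm (v \<xi>))\<^sup>2)"
    using assms by (intro Bochner_Integration.integrable_add integrable_mult_right) (auto simp: L2_torus_def)
  then have "integrable torus (\<lambda>\<xi>. (norm (u \<xi> - v \<xi>))\<^sup>2)"
    by (rule Bochner_Integration.integrable_bound) (auto intro!: AE_I2 order_trans[OF norm_diff_squared_le])
  then show ?thesis by (simp add: L2_torus_def)
qed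

lemma trig_poly_L2: "trig_poly A f \<in> L2_torus"
  using torus_fun_trig_poly[of A f] unfolding L2_torus_def
  by (auto intro: borel_torus torus_norm2_integrable simp: torus_fun_def)

text \<open>The torus has total mass 1, so the inequality says that the variance of \<open>|g|\<close> is nonnegative.\<close>

lemma L2_torus_L1:
  fixes g :: "real ^ 'n::finite \<Rightarrow> complex"
  assumes "g \<in> L2_torus"
  shows "integrable torus g"
    and "(\<integral>\<xi>. norm (g \<xi>) \<partial>torus) \<le> sqrt (\<integral>\<xi>. (norm (g \<xi>))\<^sup>2 \<partial>torus)"
proof -
  interpret finite_measure "torus :: (real ^ 'n) measure" by (rule finite_measure_torus)
  have meas: "g \<in> borel_measurable torus" and sq: "integrable torus (\<lambda>\<xi>. (norm (g \<xi>))\<^sup>2)"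
    using assms by (auto simp: L2_torus_def)
  have le: "x \<le> 1 + x\<^sup>2" if "0 \<le> x" for x :: real
    using zero_le_power2[of "x - 1"] that by (simp add: power2_eq_square algebra_simps)
  have "integrable torus (\<lambda>\<xi>. 1 + (norm (g \<xi>))\<^sup>2)"
    using sq by (intro Bochner_Integration.integrable_add integrable_const)
  then show int: "integrable torus g"
    by (rule Bochner_Integration.integrable_bound) (use meas le in \<open>auto intro!: AE_I2\<close>)
  define I where "I = (\<integral>\<xi>. norm (g \<xi>) \<partial>torus)"
  have "0 \<le> (\<integral>\<xi>. (norm (g \<xi>) - I)\<^sup>2 \<partial>torus)" by simp
  also have "\<dots> = (\<integral>\<xi>. (norm (g \<xi>))\<^sup>2 - 2 * I * norm (g \<xi>) + I\<^sup>2 \<partial>torus)"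
    by (simp add: power2_eq_square algebra_simps)
  also have "\<dots> = (\<integral>\<xi>. (norm (g \<xi>))\<^sup>2 \<partial>torus) - 2 * I * I + I\<^sup>2"
  proof -
    have "integrable torus (\<lambda>\<xi>. 2 * I * norm (g \<xi>))" using int by (intro integrable_mult_right integrable_norm)
    then have "(\<integral>\<xi>. (norm (g \<xi>))\<^sup>2 - 2 * I * norm (g \<xi>) + I\<^sup>2 \<partial>torus)
        = (\<integral>\<xi>. (norm (g \<xi>))\<^sup>2 \<partial>torus) - (\<integral>\<xi>. 2 * I * norm (g \<xi>) \<partial>torus) + (\<integral>\<xi>. I\<^sup>2 \<partial>(torus :: (real ^ 'n) measure))"
      using sq by (simp only: Bochner_Integration.integral_add Bochner_Integration.integral_diff
          Bochner_Integration.integrable_diff integrable_const)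
    then show ?thesis by (simp add: I_def measure_torus)
  qed
  finally have "I\<^sup>2 \<le> (\<integral>\<xi>. (norm (g \<xi>))\<^sup>2 \<partial>torus)" by (simp add: power2_eq_square)
  then show "(\<integral>\<xi>. norm (g \<xi>) \<partial>torus) \<le> sqrt (\<integral>\<xi>. (norm (g \<xi>))\<^sup>2 \<partial>torus)"
    unfolding I_def[symmetric] by (rule real_le_rsqrt)
qed

text \<open>The Riesz-Fischer theorem. Partial sums \<open>P k\<close> over finite sets \<open>E k\<close> that leave out a tail of
size \<open>4 ^ (- k)\<close> have increments that are summable in \<open>L\<^sup>1\<close>; hence they converge almost
everywhere. Fatou's lemma then bounds the \<open>L\<^sup>2\<close> distance of the limit from the partial sum over
any finite set that contains \<open>E j\<close>.\<close>

lemma is_fourier_exists: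
  fixes f :: "int ^ 'n::finite \<Rightarrow> complex"
  assumes sum: "(\<lambda>n. (norm (f n))\<^sup>2) summable_on UNIV"
  shows "\<exists>u. is_fourier f u"
proof -
  let ?a = "\<lambda>n. (norm (f n))\<^sup>2"
  have "\<exists>A. finite A \<and> (\<forall>B. finite B \<longrightarrow> B \<inter> A = {} \<longrightarrow> (\<Sum>n\<in>B. ?a n) \<le> (1/4) ^ k)" for k :: nat
    using sum by (rule summable_on_small_tails) auto
  then obtain A where A: "\<And>k. finite (A k)" "\<And>k B. finite B \<Longrightarrow> B \<inter> A k = {} \<Longrightarrow> (\<Sum>n\<in>B. ?a n) \<le> (1/4) ^ k"
    by metis
  define E where "E k = (\<Union>j\<le>k. A j)" for k :: nat
  have E: "finite (E k)" for k using A by (simp add: E_def)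
  have E_mono: "j \<le> k \<Longrightarrow> E j \<subseteq> E k" for j k unfolding E_def by (intro UN_mono) auto
  have tail: "(\<Sum>n\<in>B. ?a n) \<le> (1/4) ^ k" if "finite B" "B \<inter> E k = {}" for B k
    using that A(2)[of B k] by (auto simp: E_def)
  define P where "P k = trig_poly (E k) f" for k
  have P: "torus_fun (P k)" for k unfolding P_def by (rule torus_fun_trig_poly)
  have P_meas [measurable]: "P k \<in> borel_measurable torus" for k
    using P[of k] by (intro borel_torus) (simp add: torus_fun_def)
  have P_dist: "(\<integral>\<xi>. (norm (P k \<xi> - trig_poly B f \<xi>))\<^sup>2 \<partial>torus) \<le> (1/4) ^ j"
    if "finite B" "E j \<subseteq> B" "j \<le> k" for B j k
  proof -
    have "(E k - B \<union> (B - E k)) \<inter> E j = {}" using that E_mono[OF that(3)] by blast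
    then show ?thesis unfolding P_def
      using that E by (subst trig_poly_dist) (auto intro!: tail)
  qed
  define g where "g k \<xi> = P (Suc k) \<xi> - P k \<xi>" for k \<xi>
  have g_L2: "g k \<in> L2_torus" for k
    unfolding g_def[abs_def] P_def by (intro L2_torus_diff trig_poly_L2)
  have g_L1: "(\<integral>\<xi>. norm (g k \<xi>) \<partial>torus) \<le> (1/2) ^ k" for k
  proof -
    have "(\<integral>\<xi>. (norm (g k \<xi>))\<^sup>2 \<partial>torus) \<le> (1/4) ^ k"
      unfolding g_def using P_dist[OF E, of k k "Suc k"] by (simp add: P_def)
    also have "(1/4 :: real) ^ k = ((1/2) ^ k)\<^sup>2" by (simp add: power2_eq_square flip: power_mult_distrib)
    finally have "sqrt (\<integral>\<xi>. (norm (g k \<xi>))\<^sup>2 \<partial>torus) \<le> (1/2) ^ k" by (intro real_le_lsqrt) auto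
    then show ?thesis using L2_torus_L1(2)[OF g_L2, of k] by linarith
  qed
  have g_meas [measurable]: "g k \<in> borel_measurable torus" for k using g_L2[of k] by (simp add: L2_torus_def)
  have "(\<integral>\<^sup>+\<xi>. (\<Sum>k. ennreal (norm (g k \<xi>))) \<partial>torus) = (\<Sum>k. \<integral>\<^sup>+\<xi>. ennreal (norm (g k \<xi>)) \<partial>torus)"
    by (rule nn_integral_suminf) measurable
  also have "\<dots> \<le> (\<Sum>k. ennreal ((1/2) ^ k))"
  proof (intro suminf_le allI)
    fix k
    have "(\<integral>\<^sup>+\<xi>. ennreal (norm (g k \<xi>)) \<partial>torus) = ennreal (\<integral>\<xi>. norm (g k \<xi>) \<partial>torus)"
      by (intro nn_integral_eq_integral integrable_norm L2_torus_L1(1) g_L2) auto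
    then show "(\<integral>\<^sup>+\<xi>. ennreal (norm (g k \<xi>)) \<partial>torus) \<le> ennreal ((1/2) ^ k)"
      using g_L1[of k] by (simp add: ennreal_leI)
  qed auto
  also have "\<dots> = ennreal (\<Sum>k. (1/2) ^ k)" by (intro suminf_ennreal2) (auto intro: summable_geometric)
  also have "\<dots> < \<infinity>" by simp
  finally have "AE \<xi> in torus. (\<Sum>k. ennreal (norm (g k \<xi>))) \<noteq> \<infinity>"
    by (intro nn_integral_noteq_infinite) auto
  then have conv: "AE \<xi> in torus. convergent (\<lambda>k. P k \<xi>)"
  proof eventually_elim
    case (elim \<xi>)
    then have "summable (\<lambda>k. norm (g k \<xi>))" by (intro summable_suminf_not_top) auto
    then have "summable (\<lambda>k. g k \<xi>)" by (rule summable_norm_cancel)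
    then have "convergent (\<lambda>k. \<Sum>j<k. g j \<xi>)" by (simp add: summable_iff_convergent)
    moreover have "(\<Sum>j<k. g j \<xi>) = P k \<xi> - P 0 \<xi>" for k by (induction k) (auto simp: g_def)
    ultimately have "convergent (\<lambda>k. P k \<xi> - P 0 \<xi>)" by simp
    then show ?case by (simp add: convergent_diff_const_right_iff)
  qed
  define u where "u \<xi> = lim (\<lambda>k. P k \<xi>)" for \<xi>
  have u_meas [measurable]: "u \<in> borel_measurable torus"
    unfolding u_def[abs_def] by (rule borel_measurable_lim_metric) measurable
  have lim: "AE \<xi> in torus. (\<lambda>k. P k \<xi>) \<longlonglongrightarrow> u \<xi>"
    using conv by eventually_elim (simp add: u_def convergent_LIMSEQ_iff)
  have nn_dist: "(\<integral>\<^sup>+\<xi>. ennreal ((norm (u \<xi> - trig_poly B f \<xi>))\<^sup>2) \<partial>torus) \<le> ennreal ((1/4) ^ j)"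
    if B: "finite B" "E j \<subseteq> B" for B j
  proof -
    have [measurable]: "trig_poly B f \<in> borel_measurable torus" using trig_poly_L2[of B f] by (simp add: L2_torus_def)
    have "(\<integral>\<^sup>+\<xi>. ennreal ((norm (u \<xi> - trig_poly B f \<xi>))\<^sup>2) \<partial>torus)
        = (\<integral>\<^sup>+\<xi>. liminf (\<lambda>k. ennreal ((norm (P k \<xi> - trig_poly B f \<xi>))\<^sup>2)) \<partial>torus)"
    proof (rule nn_integral_cong_AE)
      show "AE \<xi> in torus. ennreal ((norm (u \<xi> - trig_poly B f \<xi>))\<^sup>2)
          = liminf (\<lambda>k. ennreal ((norm (P k \<xi> - trig_poly B f \<xi>))\<^sup>2))"
        using lim
      proof eventually_elim
        case (elim \<xi>)
        then have "(\<lambda>k. ennreal ((norm (P k \<xi> - trig_poly B f \<xi>))\<^sup>2)) \<longlonglongrightarrow> ennreal ((norm (u \<xi> - trig_poly B f \<xi>))\<^sup>2)"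
          by (intro tendsto_ennrealI tendsto_intros)
        then show ?case by (intro lim_imp_Liminf[symmetric]) auto
      qed
    qed
    also have "\<dots> \<le> liminf (\<lambda>k. \<integral>\<^sup>+\<xi>. ennreal ((norm (P k \<xi> - trig_poly B f \<xi>))\<^sup>2) \<partial>torus)"
      by (rule nn_integral_liminf) measurable
    also have "\<dots> \<le> liminf (\<lambda>k. ennreal ((1/4) ^ j))"
    proof (rule Liminf_mono)
      have "(\<integral>\<^sup>+\<xi>. ennreal ((norm (P k \<xi> - trig_poly B f \<xi>))\<^sup>2) \<partial>torus) \<le> ennreal ((1/4) ^ j)" if "j \<le> k" for k
      proof -
        have "torus_fun (\<lambda>\<xi>. P k \<xi> - trig_poly B f \<xi>)" by (intro torus_fun_diff P torus_fun_trig_poly)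
        then have "(\<integral>\<^sup>+\<xi>. ennreal ((norm (P k \<xi> - trig_poly B f \<xi>))\<^sup>2) \<partial>torus)
            = ennreal (\<integral>\<xi>. (norm (P k \<xi> - trig_poly B f \<xi>))\<^sup>2 \<partial>torus)"
          by (intro nn_integral_eq_integral torus_norm2_integrable) auto
        then show ?thesis using P_dist[OF B that] by (simp add: ennreal_leI)
      qed
      then show "\<forall>\<^sub>F k in sequentially. (\<integral>\<^sup>+\<xi>. ennreal ((norm (P k \<xi> - trig_poly B f \<xi>))\<^sup>2) \<partial>torus) \<le> ennreal ((1/4) ^ j)"
        by (auto simp: eventually_sequentially)
    qed
    also have "\<dots> = ennreal ((1/4) ^ j)" by (simp add: Liminf_const)
    finally show ?thesis .
  qed
  have diff_L2: "(\<lambda>\<xi>. u \<xi> - P 0 \<xi>) \<in> L2_torus"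
  proof -
    have "integrable torus (\<lambda>\<xi>. (norm (u \<xi> - P 0 \<xi>))\<^sup>2)"
    proof (rule integrableI_bounded)
      have "(\<integral>\<^sup>+\<xi>. ennreal ((norm (u \<xi> - P 0 \<xi>))\<^sup>2) \<partial>torus) \<le> 1"
        using nn_dist[of "E 0" 0] E by (simp add: P_def)
      also have "(1 :: ennreal) < \<infinity>" by simp
      finally show "(\<integral>\<^sup>+\<xi>. ennreal (norm ((norm (u \<xi> - P 0 \<xi>))\<^sup>2)) \<partial>torus) < \<infinity>" by simp
    qed measurable
    then show ?thesis by (simp add: L2_torus_def)
  qed
  have "(\<lambda>\<xi>. (u \<xi> - P 0 \<xi>) - trig_poly (E 0) (\<lambda>n. - f n) \<xi>) \<in> L2_torus"
    by (intro L2_torus_diff diff_L2 trig_poly_L2)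
  then have u_L2: "u \<in> L2_torus" by (simp add: P_def trig_poly_def sum_negf)
  have "((\<lambda>B. \<integral>\<xi>. (norm (u \<xi> - trig_poly B f \<xi>))\<^sup>2 \<partial>torus) \<longlongrightarrow> 0) (finite_subsets_at_top UNIV)"
  proof (rule order_tendstoI)
    fix e :: real assume "e < 0"
    have "0 \<le> (\<integral>\<xi>. (norm (u \<xi> - trig_poly B f \<xi>))\<^sup>2 \<partial>torus)" for B by simp
    then show "\<forall>\<^sub>F B in finite_subsets_at_top UNIV. e < (\<integral>\<xi>. (norm (u \<xi> - trig_poly B f \<xi>))\<^sup>2 \<partial>torus)"
      using \<open>e < 0\<close> by (intro always_eventually allI) (rule less_le_trans)
  next
    fix e :: real assume e: "0 < e"
    obtain j where j: "(1/4 :: real) ^ j < e" using real_arch_pow_inv[OF e, of "1/4"] by auto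
    have "(\<integral>\<xi>. (norm (u \<xi> - trig_poly B f \<xi>))\<^sup>2 \<partial>torus) < e" if B: "finite B" "E j \<subseteq> B" for B
    proof -
      have "integrable torus (\<lambda>\<xi>. (norm (u \<xi> - trig_poly B f \<xi>))\<^sup>2)"
        using L2_torus_diff[OF u_L2 trig_poly_L2, of B f] by (simp add: L2_torus_def)
      then have "ennreal (\<integral>\<xi>. (norm (u \<xi> - trig_poly B f \<xi>))\<^sup>2 \<partial>torus)
          = (\<integral>\<^sup>+\<xi>. ennreal ((norm (u \<xi> - trig_poly B f \<xi>))\<^sup>2) \<partial>torus)"
        by (intro nn_integral_eq_integral[symmetric]) auto
      also have "\<dots> \<le> ennreal ((1/4) ^ j)" by (rule nn_dist[OF B])
      finally show ?thesis using j by (simp add: ennreal_le_iff)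
    qed
    then show "\<forall>\<^sub>F B in finite_subsets_at_top UNIV. (\<integral>\<xi>. (norm (u \<xi> - trig_poly B f \<xi>))\<^sup>2 \<partial>torus) < e"
      unfolding eventually_finite_subsets_at_top using E[of j] by blast
  qed
  then have "is_fourier f u" using u_L2 by (simp add: is_fourier_def trig_poly_def character_def)
  then show ?thesis by blast
qed

section \<open>The multiplier operator\<close>


lemma multiplier_kernel_cz:
  fixes m :: "real ^ 'n::finite \<Rightarrow> complex"
  assumes m: "torus_fun m" and smooth: "class_C (CARD('n) + 1) (- range of_int_vec) m" and c: "0 \<le> c"
    and bound: "\<And>i \<xi>. (\<forall>j. \<bar>\<xi> $ j\<bar> < 1/2) \<Longrightarrow> \<xi> \<noteq> 0 \<Longrightarrow>
      norm ((coord_deriv i ^^ (CARD('n) + 1)) m \<xi>) * norm \<xi> ^ (CARD('n) + 1) \<le> c"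
  shows "\<exists>M. cz_kernel M (inv_fourier m)"
proof -
  define r where "r = CARD('n) + 1"
  obtain b where b: "\<And>\<xi>. norm (m \<xi>) \<le> b" using m unfolding torus_fun_def bounded_iff by auto
  define C0 where "C0 = (2 ^ r * b)\<^sup>2 * (1 + (2 * real r)\<^sup>2) ^ r + (c * (4 * real CARD('n)) ^ r)\<^sup>2 * 2 ^ r"
  have "0 \<le> C0" unfolding C0_def by (intro add_nonneg_nonneg mult_nonneg_nonneg) auto
  moreover have "(norm (step_diff r (t *\<^sub>R axis i 1) m \<eta>))\<^sup>2 * (1 + (norm \<eta> / t)\<^sup>2) ^ r \<le> C0"
    if "0 < t" "t \<le> 1 / (4 * real r)" "\<And>j. \<bar>\<eta> $ j\<bar> < 1/2" for i t \<eta>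
    unfolding C0_def
    using m smooth bound by (intro step_diff_pointwise_bound[OF b _ r_def _ c _ that]) (auto simp: r_def torus_fun_def)
  ultimately have "\<exists>C. 0 \<le> C \<and> (\<forall>i j R B. 1 \<le> R \<longrightarrow> finite B \<longrightarrow> B \<subseteq> shell i R \<longrightarrow> (\<lambda>n. n - axis j 1) ` B \<subseteq> shell i R \<longrightarrow>
      (\<Sum>n\<in>B. norm (inv_fourier m (n - axis j 1) - inv_fourier m n)) \<le> C / R)"
    by (rule kernel_unit_step_sum_le[OF m r_def])
  then obtain C where C: "0 \<le> C" and steps: "\<forall>i j R B. 1 \<le> R \<longrightarrow> finite B \<longrightarrow> B \<subseteq> shell i R \<longrightarrow> (\<lambda>n. n - axis j 1) ` B \<subseteq> shell i R \<longrightarrow>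
      (\<Sum>n\<in>B. norm (inv_fourier m (n - axis j 1) - inv_fourier m n)) \<le> C / R"
    by (elim exE conjE)
  define M where "M = b\<^sup>2 + (real CARD('n))\<^sup>2 * C"
  have "cz_kernel M (inv_fourier m)"
    unfolding cz_kernel_def
  proof (intro conjI allI impI)
    show "0 \<le> M" using C by (simp add: M_def)
  next
    fix A B :: "(int ^ 'n) set" and f assume AB: "finite A" "finite B"
    have "(\<Sum>n\<in>B. (norm (conv_on (inv_fourier m) A f n))\<^sup>2) \<le> b\<^sup>2 * (\<Sum>k\<in>A. (norm (f k))\<^sup>2)"
      by (rule conv_on_l2_bound[OF m b AB])
    also have "\<dots> \<le> M * (\<Sum>k\<in>A. (norm (f k))\<^sup>2)"
      using C by (intro mult_right_mono sum_nonneg) (auto simp: M_def)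
    finally show "(\<Sum>n\<in>B. (norm (conv_on (inv_fourier m) A f n))\<^sup>2) \<le> M * (\<Sum>k\<in>A. (norm (f k))\<^sup>2)" .
  next
    fix h :: "int ^ 'n" and B :: "(int ^ 'n) set"
    assume B: "finite B" "\<forall>n\<in>B. 4 * sup_abs h \<le> sup_abs n"
    have "(\<Sum>n\<in>B. norm (inv_fourier m (n - h) - inv_fourier m n)) \<le> (real CARD('n))\<^sup>2 * C"
      using B by (intro hoermander_condition_from_unit_steps[OF C steps[rule_format]]) auto
    then show "(\<Sum>n\<in>B. norm (inv_fourier m (n - h) - inv_fourier m n)) \<le> M"
      by (simp add: M_def add_increasing)
  qed
  then show ?thesis by blast
qed

text \<open>The truncated convolution is the multiplier operator applied to a partial sum of the Fourier series, and
evaluating a Fourier coefficient of \<open>m u\<close> is continuous for \<open>u\<close> in \<open>L\<^sup>2\<close>.\<close>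

lemma conv_on_tendsto_multiplier_op:
  fixes m :: "real ^ 'n::finite \<Rightarrow> complex"
  assumes m: "torus_fun m" and f: "is_fourier f (fourier f)"
  shows "((\<lambda>A. conv_on (inv_fourier m) A f n) \<longlongrightarrow> multiplier_op m f n) (finite_subsets_at_top UNIV)"
proof -
  let ?u = "fourier f"
  let ?I = "\<lambda>A. \<integral>\<xi>. (norm (?u \<xi> - trig_poly A f \<xi>))\<^sup>2 \<partial>torus"
  obtain b where b: "\<And>\<xi>. norm (m \<xi>) \<le> b" using m unfolding torus_fun_def bounded_iff by auto
  have b0: "0 \<le> b" using b[of 0] norm_ge_zero[of "m 0"] by linarith
  have u: "?u \<in> L2_torus" and lim: "(?I \<longlongrightarrow> 0) (finite_subsets_at_top UNIV)"
    using f by (simp_all add: is_fourier_def trig_poly_def character_def)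
  have [measurable]: "m \<in> borel_measurable torus" "character k \<in> borel_measurable torus" for k
    using m by (auto intro!: borel_torus simp: torus_fun_def)
  have int: "integrable torus (\<lambda>\<xi>. m \<xi> * g \<xi> * character (- n) \<xi>)"
    and le: "norm (\<integral>\<xi>. m \<xi> * g \<xi> * character (- n) \<xi> \<partial>torus) \<le> b * (\<integral>\<xi>. norm (g \<xi>) \<partial>torus)"
    if g: "integrable torus g" for g
  proof -
    have [measurable]: "g \<in> borel_measurable torus" using g by simp
    have dom: "integrable torus (\<lambda>\<xi>. b * norm (g \<xi>))" using g by (intro integrable_mult_right integrable_norm)
    have point: "norm (m \<xi> * g \<xi> * character (- n) \<xi>) \<le> b * norm (g \<xi>)" for \<xi>
      using b[of \<xi>] by (simp add: norm_mult mult_right_mono)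
    show int: "integrable torus (\<lambda>\<xi>. m \<xi> * g \<xi> * character (- n) \<xi>)"
      using dom by (rule Bochner_Integration.integrable_bound) (use point b0 in \<open>auto intro!: AE_I2\<close>)
    have "norm (\<integral>\<xi>. m \<xi> * g \<xi> * character (- n) \<xi> \<partial>torus) \<le> (\<integral>\<xi>. norm (m \<xi> * g \<xi> * character (- n) \<xi>) \<partial>torus)"
      by (rule integral_norm_bound)
    also have "\<dots> \<le> (\<integral>\<xi>. b * norm (g \<xi>) \<partial>torus)"
      using int dom point by (intro integral_mono integrable_norm) auto
    finally show "norm (\<integral>\<xi>. m \<xi> * g \<xi> * character (- n) \<xi> \<partial>torus) \<le> b * (\<integral>\<xi>. norm (g \<xi>) \<partial>torus)" by simp
  qed
  have dist: "norm (conv_on (inv_fourier m) A f n - multiplier_op m f n) \<le> b * sqrt (?I A)" for A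
  proof -
    have diff: "(\<lambda>\<xi>. ?u \<xi> - trig_poly A f \<xi>) \<in> L2_torus" by (intro L2_torus_diff u trig_poly_L2)
    have "multiplier_op m f n - conv_on (inv_fourier m) A f n
        = (\<integral>\<xi>. m \<xi> * ?u \<xi> * character (- n) \<xi> \<partial>torus) - (\<integral>\<xi>. m \<xi> * trig_poly A f \<xi> * character (- n) \<xi> \<partial>torus)"
      by (simp add: multiplier_op_def conv_on_inv_fourier[OF m] inv_fourier_character)
    also have "\<dots> = (\<integral>\<xi>. m \<xi> * ?u \<xi> * character (- n) \<xi> - m \<xi> * trig_poly A f \<xi> * character (- n) \<xi> \<partial>torus)"
      by (intro Bochner_Integration.integral_diff[symmetric] int L2_torus_L1 u trig_poly_L2)
    also have "\<dots> = (\<integral>\<xi>. m \<xi> * (?u \<xi> - trig_poly A f \<xi>) * character (- n) \<xi> \<partial>torus)"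
      by (simp add: algebra_simps)
    finally have "norm (multiplier_op m f n - conv_on (inv_fourier m) A f n)
        \<le> b * (\<integral>\<xi>. norm (?u \<xi> - trig_poly A f \<xi>) \<partial>torus)"
      using le[OF L2_torus_L1(1)[OF diff]] by simp
    also have "\<dots> \<le> b * sqrt (?I A)" using L2_torus_L1(2)[OF diff] b0 by (intro mult_left_mono)
    finally show ?thesis by (simp add: norm_minus_commute)
  qed
  have "((\<lambda>A. b * sqrt (?I A)) \<longlongrightarrow> b * sqrt 0) (finite_subsets_at_top UNIV)"
    by (intro tendsto_intros lim)
  then have "((\<lambda>A. conv_on (inv_fourier m) A f n - multiplier_op m f n) \<longlongrightarrow> 0) (finite_subsets_at_top UNIV)"
    by (intro Lim_null_comparison[OF always_eventually[OF allI[OF dist]]]) simp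
  then show ?thesis by (simp only: LIM_zero_iff)
qed

text \<open>Pass to the limit in the set \<open>A\<close> for fixed finite \<open>B\<close>, where only finitely many terms
converge, and only then let \<open>B\<close> exhaust the lattice.\<close>

lemma extends_bounded_lp_of_finite_sums:
  fixes m :: "real ^ 'n::finite \<Rightarrow> complex"
  assumes m: "torus_fun m" and p: "1 < p"
    and bound: "\<And>A B f. finite A \<Longrightarrow> finite B \<Longrightarrow>
      (\<Sum>n\<in>B. norm (conv_on (inv_fourier m) A f n) powr p) \<le> C * (\<Sum>k\<in>A. norm (f k) powr p)"
  shows "extends_bounded_lp p (multiplier_op m)"
proof -
  define C' where "C' = max C 0"
  have "multiplier_op m f \<in> lp p \<and> lp_norm p (multiplier_op m f) \<le> C' powr (1 / p) * lp_norm p f"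
    if f: "f \<in> lp 2 \<inter> lp p" for f :: "int ^ 'n \<Rightarrow> complex"
  proof -
    let ?S = "\<Sum>\<^sub>\<infinity>n. norm (f n) powr p"
    have sum_p: "(\<lambda>n. norm (f n) powr p) summable_on UNIV" using f by (simp add: lp_def)
    have "norm (f n) powr 2 = (norm (f n))\<^sup>2" for n by (cases "f n = 0") auto
    then have "(\<lambda>n. (norm (f n))\<^sup>2) summable_on UNIV" using f by (simp add: lp_def)
    from someI_ex[OF is_fourier_exists[OF this]] have four: "is_fourier f (fourier f)"
      unfolding fourier_def .
    have S: "0 \<le> ?S" by (intro infsum_nonneg) auto
    have fin: "(\<Sum>n\<in>B. norm (multiplier_op m f n) powr p) \<le> C' * ?S" if B: "finite B" for B
    proof (rule tendsto_upperbound)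
      show "((\<lambda>A. \<Sum>n\<in>B. norm (conv_on (inv_fourier m) A f n) powr p) \<longlongrightarrow> (\<Sum>n\<in>B. norm (multiplier_op m f n) powr p))
          (finite_subsets_at_top UNIV)"
        using p by (intro tendsto_sum tendsto_powr' tendsto_norm tendsto_const conv_on_tendsto_multiplier_op m four) auto
      have "(\<Sum>n\<in>B. norm (conv_on (inv_fourier m) A f n) powr p) \<le> C' * ?S" if A: "finite A" for A
      proof -
        have "(\<Sum>n\<in>B. norm (conv_on (inv_fourier m) A f n) powr p) \<le> C * (\<Sum>k\<in>A. norm (f k) powr p)"
          by (rule bound[OF A B])
        also have "\<dots> \<le> C' * (\<Sum>k\<in>A. norm (f k) powr p)" by (intro mult_right_mono sum_nonneg) (auto simp: C'_def)
        also have "\<dots> \<le> C' * ?S" using sum_p A by (intro mult_left_mono finite_sum_le_infsum) (auto simp: C'_def)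
        finally show ?thesis .
      qed
      then show "\<forall>\<^sub>F A in finite_subsets_at_top UNIV. (\<Sum>n\<in>B. norm (conv_on (inv_fourier m) A f n) powr p) \<le> C' * ?S"
        by (intro eventually_finite_subsets_at_top_weakI)
    qed simp
    have sum_T: "(\<lambda>n. norm (multiplier_op m f n) powr p) summable_on UNIV"
      using fin by (intro nonneg_bdd_above_summable_on bdd_aboveI2) auto
    have "lp_norm p (multiplier_op m f) \<le> (C' * ?S) powr (1 / p)"
      unfolding lp_norm_def
    proof (rule powr_mono2)
      show "(\<Sum>\<^sub>\<infinity>n. norm (multiplier_op m f n) powr p) \<le> C' * ?S"
        using fin by (intro infsum_le_finite_sums sum_T) auto
    qed (use p in \<open>auto intro: infsum_nonneg\<close>)
    also have "\<dots> = C' powr (1 / p) * lp_norm p f"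
      using S by (simp add: lp_norm_def powr_mult C'_def)
    finally show ?thesis using sum_T by (simp add: lp_def)
  qed
  then show ?thesis unfolding extends_bounded_lp_def by blast
qed

theorem theorem2p8:
  fixes m :: "real ^ 'n::finite \<Rightarrow> complex" and c :: real
  assumes "bounded (range m)"
    and "periodic1 m"
    and "class_C (CARD('n) + 1) (- range of_int_vec) m"
    and "c > 0"
    and "\<And>(\<alpha> :: nat ^ 'n) \<xi>. multi_order \<alpha> \<le> CARD('n) + 1 \<Longrightarrow>
           (\<forall>i. - (1/2) < \<xi> $ i \<and> \<xi> $ i < 1/2) \<Longrightarrow> \<xi> \<noteq> 0 \<Longrightarrow>
           norm (multi_deriv \<alpha> m \<xi>) \<le> c * norm \<xi> powr (- real (multi_order \<alpha>))"
  shows "\<forall>p. 1 < p \<longrightarrow> extends_bounded_lp p (multiplier_op m)"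
proof (intro allI impI)
  fix p :: real assume p: "1 < p"
  let ?r = "CARD('n) + 1"
  have deriv: "norm ((coord_deriv i ^^ ?r) m \<xi>) * norm \<xi> ^ ?r \<le> c"
    if cube: "\<forall>j. \<bar>\<xi> $ j\<bar> < 1/2" and xi: "\<xi> \<noteq> 0" for i \<xi>
  proof -
    let ?\<alpha> = "(\<chi> j. if j = i then ?r else 0) :: nat ^ 'n"
    have order: "multi_order ?\<alpha> \<le> ?r" unfolding multi_order_single ..
    have "\<forall>j. - (1/2) < \<xi> $ j \<and> \<xi> $ j < 1/2"
    proof
      fix j show "- (1/2) < \<xi> $ j \<and> \<xi> $ j < 1/2" using cube[rule_format, of j] by linarith
    qed
    from assms(5)[OF order this xi]
    have "norm (multi_deriv ?\<alpha> m \<xi>) \<le> c * norm \<xi> powr (- real (multi_order ?\<alpha>))" .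
    moreover have "norm \<xi> powr real ?r = norm \<xi> ^ ?r" using xi by (intro powr_realpow) simp
    ultimately have "norm ((coord_deriv i ^^ ?r) m \<xi>) \<le> c / norm \<xi> ^ ?r"
      unfolding multi_deriv_single multi_order_single powr_minus_divide by simp
    then show ?thesis using xi by (simp add: le_divide_eq)
  qed
  have "continuous_on (- range of_int_vec) m"
    by (rule class_C_imp_continuous_on[OF open_Compl[OF closed_lattice] assms(3)])
  then have m: "torus_fun m"
    using assms(1,2) borel_measurable_continuous_countable_exceptions[of "range of_int_vec" m]
    by (simp add: torus_fun_def)
  obtain M where "cz_kernel M (inv_fourier m)"
    using multiplier_kernel_cz[OF m assms(3) less_imp_le[OF assms(4)] deriv] by blast
  from cz_kernel_strong_type[OF this p] obtain C where "\<And>A B f. finite A \<Longrightarrow> finite B \<Longrightarrow>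
      (\<Sum>n\<in>B. norm (conv_on (inv_fourier m) A f n) powr p) \<le> C * (\<Sum>k\<in>A. norm (f k) powr p)"
    by blast
  then show "extends_bounded_lp p (multiplier_op m)" by (rule extends_bounded_lp_of_finite_sums[OF m p])
qed

end
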